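(* Let $R$ be a commutative Noetherian ring with non-zero identity and let $E$ be a non-zero finitely generated $R$-module. Suppose that $I$ is an ideal of $R$ such that $IE\neq E$ and $\operatorname{grade}(I,E)>0$. Let $\mathscr{R}=R[u,It]$ be the Rees ring of $R$ with respect to $I$ (where $t$ is an indeterminate and $u=t^{-1}$) and let $\mathscr{E}=E[u,It]$ be the graded Rees module of $E$ with respect to $I$. Then the following hold. (i) For every integer $n\geq 1$, $(u^n\mathscr{E}:_{\mathscr{E}}\langle It\rangle)\cap E=\widetilde{I^n_E}$. (ii) $I$ has linear growth of primary decompositions for Ratliff-Rush closures with respect to $E$. That is, there exists a positive integer $k$ such that, for every positive integer $n$, there exists a minimal primary decomposition of $\widetilde{I^n_E}$ in $E$, $$\widetilde{I^n_E}=Q_{(n,1)}\cap Q_{(n,2)}\cap\cdots\cap Q_{(n,l_n)},$$ such that $(\operatorname{Rad}(Q_{(n,i)}:_R E))^{kn}\subseteq (Q_{(n,i)}:_R E)$ for all $i=1,2,\dots,l_n$.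
   Context: For an ideal $J$ of $R$, the Ratliff-Rush closure of $J$ with respect to $E$ is the submodule $$\widetilde{J_E}=\bigcup_{k\in\mathbb{N}}(J^{k+1}E:_E J^k)=\{e\in E : J^k e\subseteq J^{k+1}E\text{ for some }k\in\mathbb{N}\}$$ of $E$; $\widetilde{I^n_E}$ denotes the Ratliff-Rush closure of the ideal $I^n$ with respect to $E$. The Rees ring is $\mathscr{R}=R[u,It]=\bigoplus_{n\in\mathbb{Z}}I^nt^n\subseteq R[t,t^{-1}]$, with $I^n=R$ for $n\le 0$. The Rees module is the finitely generated graded $\mathscr{R}$-module $\mathscr{E}=E[u,It]=\bigoplus_{n\in\mathbb{Z}}I^nE$, with $I^nE$ placed in degree $n$ (so $\mathscr{E}=\bigoplus_{n} I^nE\,t^n\subseteq E\otimes_R R[t,t^{-1}]$). $E$ is identified with the degree-$0$ component of $\mathscr{E}$. For a Noetherian ring $A$, a finitely generated $A$-module $X$, a submodule $Y\subseteq X$ and an ideal $J$ of $A$, $Y:_X\langle J\rangle$ denotes the ultimate constant value of the increasing sequence $Y\subseteq (Y:_XJ)\subseteq (Y:_XJ^2)\subseteq\cdots$. In $\langle It\rangle$, $It$ stands for the ideal of $\mathscr{R}$ generated by the elements $at$ with $a\in I$. $\operatorname{grade}(I,E)$ is the maximum length of all $E$-sequences contained in $I$. $\operatorname{Rad}(J)$ is the radical of the ideal $J$. *)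

theory Defs
  imports
    "HOL-Library.Extended_Nat"
    "HOL-Algebra.Algebra"
begin

section \<open>Modules over a commutative ring\<close>

definition submod_span :: "('a, 'r) ring_scheme \<Rightarrow> ('a, 'b, 'm) module_scheme \<Rightarrow> 'b set \<Rightarrow> 'b set"
  where "submod_span R M S = (\<lambda>N. submodule N R M) hull S"

definition fin_gen_module :: "('a, 'r) ring_scheme \<Rightarrow> ('a, 'b, 'm) module_scheme \<Rightarrow> bool"
  where "fin_gen_module R M \<longleftrightarrow>
    Module.module R M \<and> (\<exists>B. finite B \<and> B \<subseteq> carrier M \<and> carrier M = submod_span R M B)"

definition ideal_smult :: "('a, 'r) ring_scheme \<Rightarrow> ('a, 'b, 'm) module_scheme \<Rightarrow> 'a set \<Rightarrow> 'b set"
  where "ideal_smult R M J = submod_span R M {a \<odot>\<^bsub>M\<^esub> x | a x. a \<in> J \<and> x \<in> carrier M}"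

text \<open>Powers in the monoid of ideals; in particular the zeroth power is the whole ring.\<close>

abbreviation ideal_pow :: "('a, 'r) ring_scheme \<Rightarrow> 'a set \<Rightarrow> nat \<Rightarrow> 'a set"
  where "ideal_pow R J n \<equiv> J [^]\<^bsub>ideals_set R\<^esub> n"

text \<open>The submodule \<open>Y :\<^sub>M J\<close> of \<open>M\<close>, and the ideal \<open>Y :\<^sub>R M\<close> of \<open>R\<close>.\<close>

definition colon_mod :: "('a, 'b, 'm) module_scheme \<Rightarrow> 'b set \<Rightarrow> 'a set \<Rightarrow> 'b set"
  where "colon_mod M Y J = {x \<in> carrier M. \<forall>a\<in>J. a \<odot>\<^bsub>M\<^esub> x \<in> Y}"

definition colon_ring :: "('a, 'r) ring_scheme \<Rightarrow> ('a, 'b, 'm) module_scheme \<Rightarrow> 'b set \<Rightarrow> 'a set"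
  where "colon_ring R M Y = {a \<in> carrier R. \<forall>x\<in>carrier M. a \<odot>\<^bsub>M\<^esub> x \<in> Y}"

text \<open>\<open>Y :\<^sub>M \<langle>J\<rangle>\<close>: the ultimate constant value of the sequence \<open>Y :\<^sub>M J\<^sup>n\<close>
  (meaningful only if this sequence is eventually constant, e.g. for \<open>M\<close> Noetherian).\<close>

definition ultimate_colon ::
  "('a, 'r) ring_scheme \<Rightarrow> ('a, 'b, 'm) module_scheme \<Rightarrow> 'b set \<Rightarrow> 'a set \<Rightarrow> 'b set"
  where "ultimate_colon R M Y J =
    (THE Z. \<forall>\<^sub>F n in sequentially. colon_mod M Y (ideal_pow R J n) = Z)"

definition ratliff_rush :: "('a, 'r) ring_scheme \<Rightarrow> ('a, 'b, 'm) module_scheme \<Rightarrow> 'a set \<Rightarrow> 'b set"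
  where "ratliff_rush R M J =
    (\<Union>k. colon_mod M (ideal_smult R M (ideal_pow R J (k + 1))) (ideal_pow R J k))"


section \<open>Regular sequences and grade\<close>

text \<open>Each \<open>x\<^sub>i\<close> is a non-zerodivisor on \<open>M / (x\<^sub>1, \<dots>, x\<^sub>i\<^sub>-\<^sub>1)M\<close>,
  and \<open>(x\<^sub>1, \<dots>, x\<^sub>r)M \<noteq> M\<close>.\<close>

definition regular_seq :: "('a, 'r) ring_scheme \<Rightarrow> ('a, 'b, 'm) module_scheme \<Rightarrow> 'a list \<Rightarrow> bool"
  where "regular_seq R M xs \<longleftrightarrow>
    set xs \<subseteq> carrier R \<and>
    (\<forall>i < length xs. \<forall>y\<in>carrier M.
        (xs ! i) \<odot>\<^bsub>M\<^esub> y \<in> ideal_smult R M (genideal R (set (take i xs))) \<longrightarrow>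
        y \<in> ideal_smult R M (genideal R (set (take i xs)))) \<and>
    ideal_smult R M (genideal R (set xs)) \<noteq> carrier M"

definition grade :: "('a, 'r) ring_scheme \<Rightarrow> 'a set \<Rightarrow> ('a, 'b, 'm) module_scheme \<Rightarrow> enat"
  where "grade R J M = Sup {enat (length xs) | xs. regular_seq R M xs \<and> set xs \<subseteq> J}"


section \<open>Primary decomposition\<close>

definition rad :: "('a, 'r) ring_scheme \<Rightarrow> 'a set \<Rightarrow> 'a set"
  where "rad R J = {a \<in> carrier R. \<exists>n::nat. a [^]\<^bsub>R\<^esub> n \<in> J}"

definition primary_submodule ::
  "('a, 'r) ring_scheme \<Rightarrow> ('a, 'b, 'm) module_scheme \<Rightarrow> 'b set \<Rightarrow> bool"
  where "primary_submodule R M Q \<longleftrightarrow>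
    submodule Q R M \<and> Q \<noteq> carrier M \<and>
    (\<forall>a\<in>carrier R. \<forall>x\<in>carrier M.
        a \<odot>\<^bsub>M\<^esub> x \<in> Q \<longrightarrow> x \<notin> Q \<longrightarrow> a \<in> rad R (colon_ring R M Q))"

text \<open>\<open>N = Q\<^sub>1 \<inter> \<dots> \<inter> Q\<^sub>l\<close> with primary components, pairwise distinct radicals and
  no redundant component. The intersection with \<open>carrier M\<close> only serves to give the
  empty intersection (which occurs in the last clause for \<open>l = 1\<close>) its value in \<open>M\<close>.\<close>

definition minimal_primary_decomposition ::
  "('a, 'r) ring_scheme \<Rightarrow> ('a, 'b, 'm) module_scheme \<Rightarrow> 'b set \<Rightarrow> nat \<Rightarrow> (nat \<Rightarrow> 'b set) \<Rightarrow> bool"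
  where "minimal_primary_decomposition R M N l Q \<longleftrightarrow>
    1 \<le> l \<and>
    (\<forall>i\<in>{1..l}. primary_submodule R M (Q i)) \<and>
    N = (\<Inter>i\<in>{1..l}. Q i) \<and>
    inj_on (\<lambda>i. rad R (colon_ring R M (Q i))) {1..l} \<and>
    (\<forall>j\<in>{1..l}. \<not> carrier M \<inter> (\<Inter>i\<in>{1..l} - {j}. Q i) \<subseteq> Q j)"


section \<open>Rees ring and Rees module\<close>

text \<open>\<open>R[t, t\<^sup>-\<^sup>1]\<close> and \<open>M \<otimes>\<^sub>R R[t, t\<^sup>-\<^sup>1]\<close>: an element is its finitely supported family of
  coefficients, the value at \<open>n\<close> being the coefficient of \<open>t\<^sup>n\<close>.\<close>

definition laurent_ring :: "('a, 'r) ring_scheme \<Rightarrow> (int \<Rightarrow> 'a) ring"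
  where "laurent_ring R =
    \<lparr> carrier = {f. range f \<subseteq> carrier R \<and> finite {n. f n \<noteq> \<zero>\<^bsub>R\<^esub>}},
      monoid.mult = (\<lambda>f g n. \<Oplus>\<^bsub>R\<^esub>i\<in>{i. f i \<noteq> \<zero>\<^bsub>R\<^esub>}. f i \<otimes>\<^bsub>R\<^esub> g (n - i)),
      one = (\<lambda>n. if n = 0 then \<one>\<^bsub>R\<^esub> else \<zero>\<^bsub>R\<^esub>),
      ring.zero = (\<lambda>n. \<zero>\<^bsub>R\<^esub>),
      ring.add = (\<lambda>f g n. f n \<oplus>\<^bsub>R\<^esub> g n) \<rparr>"

text \<open>The record type of modules carries ring operations that the module axioms ignore.\<close>

definition laurent_module ::
  "('a, 'r) ring_scheme \<Rightarrow> ('a, 'b, 'm) module_scheme \<Rightarrow> (int \<Rightarrow> 'a, int \<Rightarrow> 'b) module"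
  where "laurent_module R M =
    \<lparr> carrier = {x. range x \<subseteq> carrier M \<and> finite {n. x n \<noteq> \<zero>\<^bsub>M\<^esub>}},
      monoid.mult = undefined,
      one = undefined,
      ring.zero = (\<lambda>n. \<zero>\<^bsub>M\<^esub>),
      ring.add = (\<lambda>x y n. x n \<oplus>\<^bsub>M\<^esub> y n),
      module.smult = (\<lambda>f x n. \<Oplus>\<^bsub>M\<^esub>i\<in>{i. f i \<noteq> \<zero>\<^bsub>R\<^esub>}. f i \<odot>\<^bsub>M\<^esub> x (n - i)) \<rparr>"

text \<open>The monomial \<open>c t\<^sup>d\<close>, with \<open>A\<close> either the ring or the module.\<close>

definition laurent_monom :: "('c, 'z) ring_scheme \<Rightarrow> 'c \<Rightarrow> int \<Rightarrow> int \<Rightarrow> 'c"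
  where "laurent_monom A c d = (\<lambda>n. if n = d then c else \<zero>\<^bsub>A\<^esub>)"

text \<open>Since \<open>nat n = 0\<close> for \<open>n \<le> 0\<close>, the convention \<open>I\<^sup>n = R\<close> for \<open>n \<le> 0\<close> is built in.\<close>

definition rees_ring :: "('a, 'r) ring_scheme \<Rightarrow> 'a set \<Rightarrow> (int \<Rightarrow> 'a) ring"
  where "rees_ring R I = (laurent_ring R)
    \<lparr> carrier := {f \<in> carrier (laurent_ring R). \<forall>n. f n \<in> ideal_pow R I (nat n)} \<rparr>"

definition rees_module ::
  "('a, 'r) ring_scheme \<Rightarrow> ('a, 'b, 'm) module_scheme \<Rightarrow> 'a set \<Rightarrow> (int \<Rightarrow> 'a, int \<Rightarrow> 'b) module"
  where "rees_module R M I = (laurent_module R M)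
    \<lparr> carrier := {x \<in> carrier (laurent_module R M).
                    \<forall>n. x n \<in> ideal_smult R M (ideal_pow R I (nat n))} \<rparr>"

definition rees_u :: "('a, 'r) ring_scheme \<Rightarrow> int \<Rightarrow> 'a"
  where "rees_u R = laurent_monom R \<one>\<^bsub>R\<^esub> (-1)"

definition rees_It :: "('a, 'r) ring_scheme \<Rightarrow> 'a set \<Rightarrow> (int \<Rightarrow> 'a) set"
  where "rees_It R I = genideal (rees_ring R I) {laurent_monom R a 1 | a. a \<in> I}"

definition degree_zero :: "('a, 'b, 'm) module_scheme \<Rightarrow> 'b \<Rightarrow> int \<Rightarrow> 'b"
  where "degree_zero M e = laurent_monom M e 0"

end

theory Submission
  imports Defs "HOL-Library.Product_Plus"
begin

text \<open>
  Write \<open>J\<^sub>n\<close> for the Ratliff--Rush closure of \<open>I\<^sup>n\<close> with respect to \<open>E\<close>. The submodules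
  \<open>(I\<^sup>s\<^sup>+\<^sup>n E : I\<^sup>s)\<close> increase with \<open>s\<close> and have union \<open>J\<^sub>n\<close>, so \<open>J\<^sub>n\<close> equals one of them. The
  tool behind all finiteness statements is the ascending chain condition for graded families of submodules
  of \<open>E\<close>, a graded form of Hilbert's basis theorem (\<open>graded_basis\<close>, \<open>acc_bigraded\<close>).

  \<^bold>\<open>The saturation in the Rees module.\<close> An element \<open>\<Sum>\<^sub>d x\<^sub>d t\<^sup>d\<close> of \<open>\<E>\<close> is multiplied into \<open>u\<^sup>n \<E>\<close> by \<open>(It)\<^sup>s\<close>
  if and only if \<open>I\<^sup>s x\<^sub>d \<subseteq> I\<^sup>d\<^sup>+\<^sup>s\<^sup>+\<^sup>n E\<close> for all \<open>d\<close> (\<open>colon_u_multiples_iff\<close>). By the chain condition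
  the resulting submodules stop growing at some \<open>s\<close> that is good for all degrees \<open>d\<close>, and in degree \<open>0\<close>
  the condition describes \<open>J\<^sub>n\<close>.

  \<^bold>\<open>Linear growth.\<close> If \<open>P\<close> is an associated prime of \<open>E / J\<^sub>n\<close> and \<open>P\<^sup>K E \<inter> (J\<^sub>n : P) \<subseteq> J\<^sub>n\<close>, then \<open>P\<close> is not
  associated to \<open>(P\<^sup>K E + J\<^sub>n) / J\<^sub>n\<close>, and a submodule that contains \<open>P\<^sup>K E + J\<^sub>n\<close> and is maximal with this
  property is a \<open>P\<close>-primary component of \<open>J\<^sub>n\<close> (\<open>exists_component\<close>). So it suffices to find a \<open>k\<close> for which
  \<open>K = k n\<close> has this property for all \<open>n\<close> and all \<open>P\<close>.

  For fixed \<open>P\<close> this follows from two uniform Artin--Rees statements: there is a \<open>c\<close> such that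
  \<open>P\<^sup>c\<^sup>+\<^sup>i I\<^sup>d E \<inter> I\<^sup>d\<^sup>+\<^sup>1 E \<subseteq> P\<^sup>i I\<^sup>d\<^sup>+\<^sup>1 E\<close> and \<open>P\<^sup>c I\<^sup>d E \<inter> (I\<^sup>d\<^sup>+\<^sup>1 E : P) \<subseteq> I\<^sup>d\<^sup>+\<^sup>1 E\<close> for all \<open>i\<close> and \<open>d\<close>. Given
  \<open>x \<in> P\<^sup>k\<^sup>n E\<close> with \<open>P x \<subseteq> J\<^sub>n\<close> and \<open>f \<in> I\<^sup>s\<close>, they lift \<open>f x\<close> from \<open>I\<^sup>s E\<close> to \<open>I\<^sup>s\<^sup>+\<^sup>n E\<close> one step at a time, at
  the price of \<open>k\<close> powers of \<open>P\<close> for each step (\<open>ratliff_rush_linear_bound\<close>). Only finitely many \<open>P\<close> occur: each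
  of them is the annihilator of a homogeneous element of the associated graded module of \<open>E\<close>, which is Noetherian
  (\<open>finite_gr_primes\<close>, \<open>assoc_primes_ratliff_rush\<close>). Positive grade makes \<open>J\<^sub>n\<close> a proper submodule
  (\<open>ratliff_rush_proper\<close>), so that the decomposition has a component.
\<close>

section \<open>Ascending chains\<close>

definition acc_on :: "'x::order set \<Rightarrow> bool"
  where "acc_on S \<longleftrightarrow> (\<forall>N::nat \<Rightarrow> 'x. range N \<subseteq> S \<longrightarrow> incseq N \<longrightarrow> (\<exists>c. \<forall>s\<ge>c. N s = N c))"

lemma acc_onD:
  assumes "acc_on S" "\<And>s. N s \<in> S" "incseq N"
  obtains c where "\<And>s. s \<ge> c \<Longrightarrow> N s = N c"
proof -
  have "range N \<subseteq> S" using assms(2) by blast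
  with assms(1,3) have "\<exists>c. \<forall>s\<ge>c. N s = N c" unfolding acc_on_def by blast
  with that show thesis by blast
qed

lemma acc_on_maximal:
  assumes "acc_on S" "Z \<subseteq> S" "z \<in> Z"
  shows "\<exists>m. m \<in> Z \<and> (\<forall>y\<in>Z. m \<le> y \<longrightarrow> y = m)"
proof (rule ccontr)
  assume "\<not> ?thesis"
  then have no_max: "\<exists>y. y \<in> Z \<and> m < y" if "m \<in> Z" for m
    using that by (fastforce simp: less_le)
  have "\<exists>N. \<forall>s::nat. N s \<in> Z \<and> N s < N (Suc s)"
    by (rule dependent_nat_choice) (use assms(3) no_max in blast)+
  then obtain N where N: "\<And>s::nat. N s \<in> Z" "\<And>s. N s < N (Suc s)" by blast
  then have "incseq N" by (intro incseq_SucI) (simp add: less_imp_le)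
  moreover have "N s \<in> S" for s using N(1) assms(2) by blast
  ultimately obtain c where c: "\<And>s. s \<ge> c \<Longrightarrow> N s = N c" using acc_onD[OF assms(1)] by blast
  show False using c[of "Suc c"] N(2)[of c] by simp
qed

lemma finite_family_stabilises:
  assumes "finite J" "\<And>j. j \<in> J \<Longrightarrow> \<exists>c. \<forall>s\<ge>c. f j s = f j (c::nat)"
  shows "\<exists>c. \<forall>s\<ge>c. \<forall>j\<in>J. f j s = f j c"
proof -
  from assms(2) obtain c where c: "\<And>j s. j \<in> J \<Longrightarrow> s \<ge> c j \<Longrightarrow> f j s = f j (c j)" by metis
  have "f j s = f j (Max (insert 0 (c ` J)))" if "j \<in> J" "s \<ge> Max (insert 0 (c ` J))" for j s
  proof -
    have "c j \<le> Max (insert 0 (c ` J))" using assms(1) that(1) by simp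
    then show ?thesis using c that by (metis order.trans)
  qed
  then show ?thesis by blast
qed

text \<open>Beyond the point where the diagonal is constant, a doubly monotone family is squeezed
  between two equal diagonal terms; only finitely many rows are left.\<close>

lemma double_chain_stabilises:
  fixes f :: "nat \<Rightarrow> nat \<Rightarrow> 'x::order"
  assumes "acc_on S" and "\<And>j s. f j s \<in> S"
    and "\<And>j s. f j s \<le> f (Suc j) s" and "\<And>j s. f j s \<le> f j (Suc s)"
  shows "\<exists>c. \<forall>s\<ge>c. \<forall>j. f j s = f j c"
proof -
  have m1: "f j s \<le> f j' s" if "j \<le> j'" for j j' s
    using lift_Suc_mono_le[of "\<lambda>j. f j s"] assms(3) that by blast
  have m2: "f j s \<le> f j s'" if "s \<le> s'" for j s s'
    using lift_Suc_mono_le[of "\<lambda>s. f j s"] assms(4) that by blast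
  have "incseq (\<lambda>i. f i i)"
    by (intro incseq_SucI) (meson assms(3,4) order_trans)
  then obtain c where c: "\<And>i. i \<ge> c \<Longrightarrow> f i i = f c c"
    using acc_onD[OF assms(1), of "\<lambda>i. f i i"] assms(2) by blast
  have big: "f j s = f c c" if "j \<ge> c" "s \<ge> c" for j s
  proof (rule antisym)
    have "f j s \<le> f (max j s) (max j s)" using m1 m2 by (meson max.cobounded1 max.cobounded2 order_trans)
    then show "f j s \<le> f c c" using c[of "max j s"] that by simp
    show "f c c \<le> f j s" using m1 m2 that by (meson order_trans)
  qed
  have "\<exists>c. \<forall>s\<ge>c. f j s = f j c" for j
  proof -
    have "incseq (f j)" by (intro incseq_SucI) (rule assms(4))
    from acc_onD[OF assms(1) _ this] assms(2) show ?thesis by metis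
  qed
  then have "\<exists>c'. \<forall>s\<ge>c'. \<forall>j\<in>{..<c}. f j s = f j c'"
    by (intro finite_family_stabilises) auto
  then obtain c' where c': "\<And>s j. s \<ge> c' \<Longrightarrow> j < c \<Longrightarrow> f j s = f j c'" by blast
  have "f j s = f j (max c c')" if "s \<ge> max c c'" for j s
  proof (cases "j < c")
    case True
    then show ?thesis using c'[of s j] c'[of "max c c'" j] that by simp
  next
    case False
    then show ?thesis using big[of j s] big[of j "max c c'"] that by simp
  qed
  then show ?thesis by blast
qed

section \<open>Submodules and multiplication by ideals\<close>

definition ideal_mult :: "('a, 'r) ring_scheme \<Rightarrow> ('a, 'b, 'm) module_scheme \<Rightarrow> 'a set \<Rightarrow> 'b set \<Rightarrow> 'b set"
  where "ideal_mult R M J V = submod_span R M {a \<odot>\<^bsub>M\<^esub> x | a x. a \<in> J \<and> x \<in> V}"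

lemma ideal_smult_eq: "ideal_smult R M J = ideal_mult R M J (carrier M)"
  by (simp add: ideal_smult_def ideal_mult_def)

context module
begin

lemma sub_carr: "submodule N R M \<Longrightarrow> x \<in> N \<Longrightarrow> x \<in> carrier M"
  using submoduleE(1) by blast

lemma sub_zero: "submodule N R M \<Longrightarrow> \<zero>\<^bsub>M\<^esub> \<in> N"
  using submodule.axioms(1) subgroup.one_closed by fastforce

lemma sub_add: "submodule N R M \<Longrightarrow> x \<in> N \<Longrightarrow> y \<in> N \<Longrightarrow> x \<oplus>\<^bsub>M\<^esub> y \<in> N"
  by (rule submoduleE(5))

lemma sub_neg: "submodule N R M \<Longrightarrow> x \<in> N \<Longrightarrow> \<ominus>\<^bsub>M\<^esub> x \<in> N"
  by (rule submoduleE(3))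

lemma sub_smult: "submodule N R M \<Longrightarrow> a \<in> carrier R \<Longrightarrow> x \<in> N \<Longrightarrow> a \<odot>\<^bsub>M\<^esub> x \<in> N"
  by (rule submoduleE(4))

lemma sub_minus: "submodule N R M \<Longrightarrow> x \<in> N \<Longrightarrow> y \<in> N \<Longrightarrow> x \<ominus>\<^bsub>M\<^esub> y \<in> N"
  by (simp add: a_minus_def sub_add sub_neg)

lemma submoduleI':
  assumes "H \<subseteq> carrier M" "\<zero>\<^bsub>M\<^esub> \<in> H"
    and add: "\<And>x y. x \<in> H \<Longrightarrow> y \<in> H \<Longrightarrow> x \<oplus>\<^bsub>M\<^esub> y \<in> H"
    and smult: "\<And>a x. a \<in> carrier R \<Longrightarrow> x \<in> H \<Longrightarrow> a \<odot>\<^bsub>M\<^esub> x \<in> H"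
  shows "submodule H R M"
proof (rule submoduleI[OF assms(1,2)])
  fix x assume x: "x \<in> H"
  then have "(\<ominus> \<one>) \<odot>\<^bsub>M\<^esub> x \<in> H" using smult by simp
  then show "\<ominus>\<^bsub>M\<^esub> x \<in> H" using x assms(1) smult_l_minus[of \<one> x] by auto
qed (use assms in auto)

lemma sub_cancel:
  assumes "submodule N R M" "x \<oplus>\<^bsub>M\<^esub> y \<in> N" "x \<in> N" "x \<in> carrier M" "y \<in> carrier M"
  shows "y \<in> N"
proof -
  have "\<ominus>\<^bsub>M\<^esub> x \<oplus>\<^bsub>M\<^esub> (x \<oplus>\<^bsub>M\<^esub> y) \<in> N" using assms sub_add sub_neg by blast
  then show ?thesis using assms(4,5) by (simp add: M.r_neg1)
qed

lemma submodule_zero: "submodule {\<zero>\<^bsub>M\<^esub>} R M"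
  by (rule submoduleI') auto

lemma submodule_Inter:
  assumes "\<And>N. N \<in> F \<Longrightarrow> submodule N R M" "F \<noteq> {}"
  shows "submodule (\<Inter>F) R M"
proof (rule submoduleI')
  show "\<Inter>F \<subseteq> carrier M" using assms sub_carr by blast
qed (use assms sub_zero sub_add sub_smult in blast)+

lemma submodule_Int:
  assumes "submodule A R M" "submodule B R M"
  shows "submodule (A \<inter> B) R M"
  using submodule_Inter[of "{A, B}"] assms by auto

lemma submodule_Un_chain:
  fixes N :: "nat \<Rightarrow> 'c set"
  assumes "\<And>s. submodule (N s) R M" "incseq N"
  shows "submodule (\<Union>s. N s) R M"
proof (rule submoduleI')
  show "(\<Union>s. N s) \<subseteq> carrier M" using assms sub_carr by blast
  show "\<zero>\<^bsub>M\<^esub> \<in> (\<Union>s. N s)" using assms sub_zero by blast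
  fix x y assume "x \<in> (\<Union>s. N s)" "y \<in> (\<Union>s. N s)"
  then obtain s t where "x \<in> N s" "y \<in> N t" by blast
  then have "x \<in> N (max s t)" "y \<in> N (max s t)"
    using incseqD[OF assms(2), of s "max s t"] incseqD[OF assms(2), of t "max s t"] by auto
  then show "x \<oplus>\<^bsub>M\<^esub> y \<in> (\<Union>s. N s)" using sub_add[OF assms(1)] by blast
next
  fix a x assume "a \<in> carrier R" "x \<in> (\<Union>s. N s)"
  then show "a \<odot>\<^bsub>M\<^esub> x \<in> (\<Union>s. N s)" using sub_smult[OF assms(1)] by blast
qed

lemma submodule_set_add:
  assumes A: "submodule A R M" and B: "submodule B R M"
  shows "submodule (A <+>\<^bsub>M\<^esub> B) R M"
proof (rule submoduleI')
  note [simp] = sub_carr[OF A] sub_carr[OF B]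
  show "A <+>\<^bsub>M\<^esub> B \<subseteq> carrier M" unfolding set_add_def' by auto
  have "\<zero>\<^bsub>M\<^esub> \<oplus>\<^bsub>M\<^esub> \<zero>\<^bsub>M\<^esub> \<in> A <+>\<^bsub>M\<^esub> B"
    unfolding set_add_def' using sub_zero[OF A] sub_zero[OF B] by blast
  then show "\<zero>\<^bsub>M\<^esub> \<in> A <+>\<^bsub>M\<^esub> B" by simp
  fix x y assume "x \<in> A <+>\<^bsub>M\<^esub> B" "y \<in> A <+>\<^bsub>M\<^esub> B"
  then obtain a b a' b' where ab: "a \<in> A" "b \<in> B" "a' \<in> A" "b' \<in> B"
    "x = a \<oplus>\<^bsub>M\<^esub> b" "y = a' \<oplus>\<^bsub>M\<^esub> b'" unfolding set_add_def' by blast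
  then have "x \<oplus>\<^bsub>M\<^esub> y = (a \<oplus>\<^bsub>M\<^esub> a') \<oplus>\<^bsub>M\<^esub> (b \<oplus>\<^bsub>M\<^esub> b')" by (simp add: M.a_ac)
  moreover have "a \<oplus>\<^bsub>M\<^esub> a' \<in> A" "b \<oplus>\<^bsub>M\<^esub> b' \<in> B" using ab A B sub_add by blast+
  ultimately show "x \<oplus>\<^bsub>M\<^esub> y \<in> A <+>\<^bsub>M\<^esub> B" unfolding set_add_def' by blast
next
  note [simp] = sub_carr[OF A] sub_carr[OF B]
  fix r x assume r: "r \<in> carrier R" and "x \<in> A <+>\<^bsub>M\<^esub> B"
  then obtain a b where ab: "a \<in> A" "b \<in> B" "x = a \<oplus>\<^bsub>M\<^esub> b" unfolding set_add_def' by blast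
  then have "r \<odot>\<^bsub>M\<^esub> x = r \<odot>\<^bsub>M\<^esub> a \<oplus>\<^bsub>M\<^esub> r \<odot>\<^bsub>M\<^esub> b" using r by (simp add: smult_r_distr)
  moreover have "r \<odot>\<^bsub>M\<^esub> a \<in> A" "r \<odot>\<^bsub>M\<^esub> b \<in> B" using ab A B r sub_smult by blast+
  ultimately show "r \<odot>\<^bsub>M\<^esub> x \<in> A <+>\<^bsub>M\<^esub> B" unfolding set_add_def' by blast
qed

lemma set_add_left: "submodule B R M \<Longrightarrow> A \<subseteq> carrier M \<Longrightarrow> A \<subseteq> A <+>\<^bsub>M\<^esub> B"
  unfolding set_add_def' using sub_zero M.r_zero by force

lemma set_add_right: "submodule A R M \<Longrightarrow> B \<subseteq> carrier M \<Longrightarrow> B \<subseteq> A <+>\<^bsub>M\<^esub> B"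
  unfolding set_add_def' using sub_zero M.l_zero by force

lemma set_add_least:
  assumes "submodule N R M" "A \<subseteq> N" "B \<subseteq> N"
  shows "A <+>\<^bsub>M\<^esub> B \<subseteq> N"
proof
  fix x assume "x \<in> A <+>\<^bsub>M\<^esub> B"
  then obtain a b where "a \<in> A" "b \<in> B" "x = a \<oplus>\<^bsub>M\<^esub> b" unfolding set_add_def' by blast
  then show "x \<in> N" using sub_add[OF assms(1)] assms(2,3) by blast
qed

lemma submodule_smult_image:
  assumes a: "a \<in> carrier R" and N: "submodule N R M"
  shows "submodule ((\<odot>\<^bsub>M\<^esub>) a ` N) R M"
proof (rule submoduleI')
  note [simp] = sub_carr[OF N]
  show "(\<odot>\<^bsub>M\<^esub>) a ` N \<subseteq> carrier M" using a by auto
  show "\<zero>\<^bsub>M\<^esub> \<in> (\<odot>\<^bsub>M\<^esub>) a ` N" using sub_zero[OF N] a smult_r_null by (metis imageI)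
  fix x y assume "x \<in> (\<odot>\<^bsub>M\<^esub>) a ` N" "y \<in> (\<odot>\<^bsub>M\<^esub>) a ` N"
  then obtain x' y' where "x' \<in> N" "y' \<in> N" "x = a \<odot>\<^bsub>M\<^esub> x'" "y = a \<odot>\<^bsub>M\<^esub> y'" by blast
  then have "x \<oplus>\<^bsub>M\<^esub> y = a \<odot>\<^bsub>M\<^esub> (x' \<oplus>\<^bsub>M\<^esub> y')" "x' \<oplus>\<^bsub>M\<^esub> y' \<in> N"
    using a N by (simp_all add: smult_r_distr sub_add)
  then show "x \<oplus>\<^bsub>M\<^esub> y \<in> (\<odot>\<^bsub>M\<^esub>) a ` N" by blast
next
  note [simp] = sub_carr[OF N]
  fix r x assume r: "r \<in> carrier R" and "x \<in> (\<odot>\<^bsub>M\<^esub>) a ` N"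
  then obtain x' where x': "x' \<in> N" "x = a \<odot>\<^bsub>M\<^esub> x'" by blast
  then have "r \<odot>\<^bsub>M\<^esub> x = a \<odot>\<^bsub>M\<^esub> (r \<odot>\<^bsub>M\<^esub> x')"
    using a r by (simp add: smult_assoc1[symmetric] R.m_comm)
  then show "r \<odot>\<^bsub>M\<^esub> x \<in> (\<odot>\<^bsub>M\<^esub>) a ` N" using x' r sub_smult[OF N] by blast
qed

lemma submodule_cyclic_image:
  assumes K: "ideal K R" and y: "y \<in> carrier M"
  shows "submodule ((\<lambda>r. r \<odot>\<^bsub>M\<^esub> y) ` K) R M"
proof (rule submoduleI')
  note [simp] = ideal.Icarr[OF K]
  show "(\<lambda>r. r \<odot>\<^bsub>M\<^esub> y) ` K \<subseteq> carrier M" using y by auto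
  have "\<zero> \<in> K" by (rule additive_subgroup.zero_closed[OF ideal.axioms(1)[OF K]])
  then show "\<zero>\<^bsub>M\<^esub> \<in> (\<lambda>r. r \<odot>\<^bsub>M\<^esub> y) ` K" using y smult_l_null by (metis imageI)
  fix u v assume "u \<in> (\<lambda>r. r \<odot>\<^bsub>M\<^esub> y) ` K" "v \<in> (\<lambda>r. r \<odot>\<^bsub>M\<^esub> y) ` K"
  then show "u \<oplus>\<^bsub>M\<^esub> v \<in> (\<lambda>r. r \<odot>\<^bsub>M\<^esub> y) ` K"
    using y additive_subgroup.a_closed[OF ideal.axioms(1)[OF K]] by (auto simp: smult_l_distr[symmetric])
next
  note [simp] = ideal.Icarr[OF K]
  fix a v assume "a \<in> carrier R" "v \<in> (\<lambda>r. r \<odot>\<^bsub>M\<^esub> y) ` K"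
  then show "a \<odot>\<^bsub>M\<^esub> v \<in> (\<lambda>r. r \<odot>\<^bsub>M\<^esub> y) ` K"
    using y ideal.I_l_closed[OF K] by (auto simp: smult_assoc1[symmetric])
qed

lemma smult_left_commute:
  "a \<in> carrier R \<Longrightarrow> b \<in> carrier R \<Longrightarrow> x \<in> carrier M \<Longrightarrow> a \<odot>\<^bsub>M\<^esub> (b \<odot>\<^bsub>M\<^esub> x) = b \<odot>\<^bsub>M\<^esub> (a \<odot>\<^bsub>M\<^esub> x)"
  by (simp add: smult_assoc1[symmetric] R.m_comm)

text \<open>Used to extend a statement about the generators of an ideal to the whole ideal.\<close>

lemma ideal_multiplier:
  assumes N: "submodule N R M" and V: "V \<subseteq> carrier M"
  shows "ideal {a \<in> carrier R. \<forall>x\<in>V. a \<odot>\<^bsub>M\<^esub> x \<in> N} R"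
proof (rule idealI)
  show "ring R" by (rule R.ring_axioms)
  have Vc: "x \<in> carrier M" if "x \<in> V" for x using that V by blast
  let ?H = "{a \<in> carrier R. \<forall>x\<in>V. a \<odot>\<^bsub>M\<^esub> x \<in> N}"
  show "subgroup ?H (add_monoid R)"
  proof (rule R.add.subgroupI)
    show "?H \<noteq> {}" using N sub_zero Vc by (auto intro!: exI[of _ \<zero>])
  next
    fix a assume "a \<in> ?H" then show "\<ominus> a \<in> ?H"
      using N sub_neg Vc by (auto simp: smult_l_minus)
  next
    fix a b assume "a \<in> ?H" "b \<in> ?H" then show "a \<oplus> b \<in> ?H"
      using N sub_add Vc by (auto simp: smult_l_distr)
  qed auto
  fix a b assume "a \<in> ?H" "b \<in> carrier R"
  then show "b \<otimes> a \<in> ?H" using N sub_smult Vc by (auto simp: smult_assoc1)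
  then show "a \<otimes> b \<in> ?H" using \<open>a \<in> ?H\<close> \<open>b \<in> carrier R\<close> R.m_comm by auto
qed

lemma submodule_colon_mod:
  assumes Y: "submodule Y R M" and J: "J \<subseteq> carrier R"
  shows "submodule (colon_mod M Y J) R M"
proof (rule submoduleI')
  show "colon_mod M Y J \<subseteq> carrier M" unfolding colon_mod_def by blast
  show "\<zero>\<^bsub>M\<^esub> \<in> colon_mod M Y J" using J sub_zero[OF Y] unfolding colon_mod_def by auto
  fix x y assume "x \<in> colon_mod M Y J" "y \<in> colon_mod M Y J"
  then show "x \<oplus>\<^bsub>M\<^esub> y \<in> colon_mod M Y J"
    using J sub_add[OF Y] unfolding colon_mod_def by (auto simp: smult_r_distr subset_iff)
next
  fix a x assume "a \<in> carrier R" "x \<in> colon_mod M Y J"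
  then show "a \<odot>\<^bsub>M\<^esub> x \<in> colon_mod M Y J"
    using J sub_smult[OF Y] smult_left_commute[of _ a x]
    unfolding colon_mod_def by (auto simp: subset_iff)
qed

lemma submodule_span: "S \<subseteq> carrier M \<Longrightarrow> submodule (submod_span R M S) R M"
  unfolding submod_span_def hull_def
  by (rule submodule_Inter) (use carrier_is_submodule in auto)

lemma span_minimal: "S \<subseteq> N \<Longrightarrow> submodule N R M \<Longrightarrow> submod_span R M S \<subseteq> N"
  unfolding submod_span_def by (rule hull_minimal)

lemma span_superset: "S \<subseteq> submod_span R M S"
  unfolding submod_span_def by (rule hull_subset)

abbreviation mul :: "'a set \<Rightarrow> 'c set \<Rightarrow> 'c set" where "mul \<equiv> ideal_mult R M"

lemma submodule_mul: "J \<subseteq> carrier R \<Longrightarrow> V \<subseteq> carrier M \<Longrightarrow> submodule (mul J V) R M"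
  unfolding ideal_mult_def by (rule submodule_span) auto

lemma mul_mem: "a \<in> J \<Longrightarrow> x \<in> V \<Longrightarrow> a \<odot>\<^bsub>M\<^esub> x \<in> mul J V"
  unfolding ideal_mult_def by (rule subsetD[OF span_superset]) blast

lemma mul_least:
  assumes "submodule N R M" "\<And>a x. a \<in> J \<Longrightarrow> x \<in> V \<Longrightarrow> a \<odot>\<^bsub>M\<^esub> x \<in> N"
  shows "mul J V \<subseteq> N"
  unfolding ideal_mult_def by (rule span_minimal) (use assms in auto)

lemma mul_mono: "J \<subseteq> J' \<Longrightarrow> V \<subseteq> V' \<Longrightarrow> mul J V \<subseteq> mul J' V'"
  unfolding ideal_mult_def submod_span_def by (rule hull_mono) blast

lemma mul_subset: "J \<subseteq> carrier R \<Longrightarrow> submodule V R M \<Longrightarrow> mul J V \<subseteq> V"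
  by (rule mul_least) (use sub_smult in auto)

lemma mul_carrier_left: "submodule V R M \<Longrightarrow> mul (carrier R) V = V"
proof (rule antisym)
  assume V: "submodule V R M"
  then show "mul (carrier R) V \<subseteq> V" by (simp add: mul_subset)
  show "V \<subseteq> mul (carrier R) V"
  proof
    fix x assume "x \<in> V"
    then show "x \<in> mul (carrier R) V"
      using mul_mem[OF R.one_closed \<open>x \<in> V\<close>] sub_carr[OF V] by simp
  qed
qed

lemma mul_mul:
  assumes "J \<subseteq> carrier R" "K \<subseteq> carrier R" "submodule V R M"
  shows "mul (J \<cdot> K) V = mul J (mul K V)"
proof (rule antisym)
  note Vc = sub_carr[OF assms(3)]
  have KX: "submodule (mul K V) R M" 
    by (rule submodule_mul[OF assms(2) submoduleE(1)[OF assms(3)]])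
  have JKX: "submodule (mul J (mul K V)) R M"
    by (rule submodule_mul[OF assms(1) submoduleE(1)[OF KX]])
  have sub: "a \<in> carrier R \<and> (\<forall>x\<in>V. a \<odot>\<^bsub>M\<^esub> x \<in> mul J (mul K V))" if "a \<in> J \<cdot> K" for a
    using that
  proof induction
    case (prod i j)
    then have "i \<in> carrier R" "j \<in> carrier R" using assms by auto
    then have "(i \<otimes> j) \<odot>\<^bsub>M\<^esub> x \<in> mul J (mul K V)" if "x \<in> V" for x
      using mul_mem[OF prod(1) mul_mem[OF prod(2) that]] that Vc by (simp add: smult_assoc1)
    then show ?case using \<open>i \<in> carrier R\<close> \<open>j \<in> carrier R\<close> by simp
  next
    case (sum a b)
    then show ?case by (simp add: smult_l_distr Vc sub_add[OF JKX])
  qed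
  show "mul (J \<cdot> K) V \<subseteq> mul J (mul K V)"
    by (rule mul_least[OF JKX]) (simp add: sub)
  have JK_carr: "J \<cdot> K \<subseteq> carrier R" using sub by blast
  then have JK: "submodule (mul (J \<cdot> K) V) R M"
    by (rule submodule_mul[OF _ submoduleE(1)[OF assms(3)]])
  show "mul J (mul K V) \<subseteq> mul (J \<cdot> K) V"
  proof (rule mul_least[OF JK])
    fix a y assume a: "a \<in> J" and y: "y \<in> mul K V"
    have "mul K V \<subseteq> colon_mod M (mul (J \<cdot> K) V) J"
    proof (rule mul_least[OF submodule_colon_mod[OF JK assms(1)]])
      fix b x assume b: "b \<in> K" and x: "x \<in> V"
      have "c \<odot>\<^bsub>M\<^esub> (b \<odot>\<^bsub>M\<^esub> x) \<in> mul (J \<cdot> K) V" if "c \<in> J" for c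
      proof -
        have "(c \<otimes> b) \<odot>\<^bsub>M\<^esub> x \<in> mul (J \<cdot> K) V"
          by (intro mul_mem x ideal_prod.prod that b)
        moreover have "c \<in> carrier R" "b \<in> carrier R" using that b assms(1,2) by blast+
        ultimately show ?thesis using Vc[OF x] by (simp add: smult_assoc1)
      qed
      then show "b \<odot>\<^bsub>M\<^esub> x \<in> colon_mod M (mul (J \<cdot> K) V) J"
        using b x assms(2) Vc[OF x] smult_closed[of b x] unfolding colon_mod_def by blast
    qed
    then have "y \<in> colon_mod M (mul (J \<cdot> K) V) J" using y by (rule subsetD)
    then show "a \<odot>\<^bsub>M\<^esub> y \<in> mul (J \<cdot> K) V" using a unfolding colon_mod_def by simp
  qed
qed

end

lemma ideal_subset_carrier: "ideal J R \<Longrightarrow> J \<subseteq> carrier R"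
  by (rule additive_subgroup.a_subset[OF ideal.axioms(1)])

section \<open>Powers of ideals\<close>

context cring
begin

lemma ideal_pow_ideal: "ideal J R \<Longrightarrow> ideal (ideal_pow R J n) R"
proof -
  assume J: "ideal J R"
  interpret ISet: comm_monoid "ideals_set R" by (rule ideals_set_is_comm_monoid)
  have "J \<in> carrier (ideals_set R)" using J by (simp add: ideals_set_def)
  then show ?thesis using ISet.nat_pow_closed[of J n] by (simp add: ideals_set_def)
qed

lemma ideal_pow_carr: "ideal J R \<Longrightarrow> ideal_pow R J n \<subseteq> carrier R"
  by (rule ideal_subset_carrier[OF ideal_pow_ideal])

lemma ideal_pow_0: "ideal_pow R J 0 = carrier R"
  by (simp add: ideals_set_def)

lemma ideal_pow_Suc: "ideal_pow R J (Suc n) = ideal_pow R J n \<cdot> J"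
  by (simp add: ideals_set_def)

lemma ideal_pow_add:
  "ideal J R \<Longrightarrow> ideal_pow R J (m + n) = ideal_pow R J m \<cdot> ideal_pow R J n"
proof -
  assume J: "ideal J R"
  interpret ISet: comm_monoid "ideals_set R" by (rule ideals_set_is_comm_monoid)
  have "J \<in> carrier (ideals_set R)" using J by (simp add: ideals_set_def)
  from ISet.nat_pow_mult[OF this, of m n] show ?thesis by (simp add: ideals_set_def)
qed

lemma ideal_pow_1: "ideal J R \<Longrightarrow> ideal_pow R J (Suc 0) = J"
proof -
  assume J: "ideal J R"
  interpret ISet: comm_monoid "ideals_set R" by (rule ideals_set_is_comm_monoid)
  have "J \<in> carrier (ideals_set R)" using J by (simp add: ideals_set_def)
  from ISet.nat_pow_eone[OF this] show ?thesis by simp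
qed

lemma ideal_pow_pow:
  "ideal J R \<Longrightarrow> ideal_pow R (ideal_pow R J m) n = ideal_pow R J (m * n)"
proof -
  assume J: "ideal J R"
  interpret ISet: comm_monoid "ideals_set R" by (rule ideals_set_is_comm_monoid)
  have "J \<in> carrier (ideals_set R)" using J by (simp add: ideals_set_def)
  from ISet.nat_pow_pow[OF this, of m n] show ?thesis by simp
qed

lemma ideal_pow_mult:
  assumes "ideal J R" "a \<in> ideal_pow R J m" "b \<in> ideal_pow R J n"
  shows "a \<otimes> b \<in> ideal_pow R J (m + n)"
  unfolding ideal_pow_add[OF assms(1)] by (intro ideal_prod.prod assms(2,3))

lemma ideal_pow_anti:
  assumes J: "ideal J R" and "m \<le> n"
  shows "ideal_pow R J n \<subseteq> ideal_pow R J m"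
proof -
  have "ideal_pow R J n = ideal_pow R J m \<cdot> ideal_pow R J (n - m)"
    using ideal_pow_add[OF J, of m "n - m"] assms(2) by simp
  also have "\<dots> \<subseteq> ideal_pow R J m"
    using ideal_prod_inter[OF ideal_pow_ideal[OF J] ideal_pow_ideal[OF J]] by blast
  finally show ?thesis .
qed

lemma elem_pow_in_ideal_pow:
  assumes "ideal J R" "a \<in> J"
  shows "a [^] n \<in> ideal_pow R J n"
proof (induction n)
  case 0
  show ?case by (simp add: ideals_set_def)
next
  case (Suc n)
  from ideal_prod.prod[OF Suc assms(2), of R] show ?case by (simp add: ideals_set_def)
qed

end

text \<open>The default rewrite rules would turn \<open>J\<^sup>n\<^sup>+\<^sup>1\<close> into a product in the monoid of ideals, a form
  to which the rules for \<open>J\<^sup>m\<^sup>+\<^sup>n M\<close> do not apply.\<close>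

declare Group.nat_pow_Suc [simp del] Group.nat_pow_0 [simp del]

context module
begin

abbreviation pw :: "'a set \<Rightarrow> nat \<Rightarrow> 'c set"
  where "pw J n \<equiv> mul (ideal_pow R J n) (carrier M)"

lemma mul_pow_add:
  assumes "ideal J R" "submodule V R M"
  shows "mul (ideal_pow R J m) (mul (ideal_pow R J n) V) = mul (ideal_pow R J (m + n)) V"
  using assms by (simp add: R.ideal_pow_add mul_mul R.ideal_pow_carr)

lemma mul_commute:
  assumes "ideal J R" "ideal K R" "submodule V R M"
  shows "mul J (mul K V) = mul K (mul J V)"
proof -
  note c = ideal_subset_carrier[OF assms(1)] ideal_subset_carrier[OF assms(2)]
  show ?thesis
    using mul_mul[OF c assms(3)] mul_mul[OF c(2,1) assms(3)] R.ideal_prod_commute[OF assms(1,2)] by simp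
qed

lemma mul_pow_sub: "ideal J R \<Longrightarrow> submodule V R M \<Longrightarrow> submodule (mul (ideal_pow R J n) V) R M"
  by (rule submodule_mul[OF R.ideal_pow_carr submoduleE(1)])

lemma pw_sub: "ideal J R \<Longrightarrow> submodule (pw J n) R M"
  by (rule submodule_mul[OF R.ideal_pow_carr order_refl])

lemma pw_0: "pw J 0 = carrier M"
  unfolding R.ideal_pow_0 by (rule mul_carrier_left[OF carrier_is_submodule])

lemma pw_anti: "ideal J R \<Longrightarrow> m \<le> n \<Longrightarrow> pw J n \<subseteq> pw J m"
  by (intro mul_mono R.ideal_pow_anti) auto

lemma mul_pow_pw: "ideal J R \<Longrightarrow> mul (ideal_pow R J m) (pw J n) = pw J (m + n)"
  by (rule mul_pow_add[OF _ carrier_is_submodule])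

lemma pw_smult: "ideal J R \<Longrightarrow> a \<in> ideal_pow R J m \<Longrightarrow> x \<in> pw J n \<Longrightarrow> a \<odot>\<^bsub>M\<^esub> x \<in> pw J (m + n)"
  using mul_mem[of a "ideal_pow R J m" x "pw J n"] by (simp add: mul_pow_pw)

lemma mul_pow_Suc:
  assumes "ideal J R" "submodule V R M"
  shows "mul (ideal_pow R J (Suc n)) V = mul J (mul (ideal_pow R J n) V)"
  using mul_pow_add[OF assms, of "Suc 0" n] by (simp only: R.ideal_pow_1[OF assms(1)] plus_nat.add_Suc plus_nat.add_0)

lemma pw_Suc: "ideal J R \<Longrightarrow> pw J (Suc n) = mul J (pw J n)"
  by (rule mul_pow_Suc[OF _ carrier_is_submodule])

end

section \<open>Graded families of submodules and the basis theorem\<close>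

locale fg_module_noetherian_ring = module R M + noetherian_ring R
  for R :: "('a, 'r) ring_scheme" (structure) and M :: "('a, 'b, 'm) module_scheme" (structure) +
  assumes fin_gen: "fin_gen_module R M"
begin

lemma acc_ideals: "acc_on {J. ideal J R}"
  unfolding acc_on_def
proof (intro allI impI)
  fix N :: "nat \<Rightarrow> 'a set"
  assume N: "range N \<subseteq> {J. ideal J R}" and inc: "incseq N"
  have "N x \<subseteq> N y \<or> N y \<subseteq> N x" for x y
    using incseqD[OF inc, of x y] incseqD[OF inc, of y x] by linarith
  then have "subset.chain {J. ideal J R} (range N)"
    using N by (intro subset.chainI) auto
  then have "\<Union>(range N) \<in> range N" by (intro ideal_chain_is_trivial) auto
  then obtain c where c: "\<Union>(range N) = N c" by blast
  have "N s = N c" if "s \<ge> c" for s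
    using c incseqD[OF inc that] by blast
  then show "\<exists>c. \<forall>s\<ge>c. N s = N c" by blast
qed

text \<open>The usual exact-sequence argument: a submodule \<open>N\<close> of \<open>\<langle>B, x\<rangle>\<close> is controlled by
  \<open>N \<inter> \<langle>B\<rangle>\<close> and by the ideal of coefficients of \<open>x\<close>.\<close>

lemma acc_submodules_span:
  assumes "finite B" "B \<subseteq> carrier M"
  shows "acc_on {N. submodule N R M \<and> N \<subseteq> submod_span R M B}"
  using assms
proof (induction B)
  case empty
  have "submod_span R M {} = {\<zero>\<^bsub>M\<^esub>}"
    using span_minimal[OF _ submodule_zero, of "{}"] sub_zero[OF submodule_span[of "{}"]] by auto
  then have "N = {\<zero>\<^bsub>M\<^esub>}" if "submodule N R M" "N \<subseteq> submod_span R M {}" for N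
    using that sub_zero by auto
  then show ?case unfolding acc_on_def by (metis (no_types, lifting) mem_Collect_eq rangeI subsetD)
next
  case (insert x B)
  let ?B = "submod_span R M B"
  have x: "x \<in> carrier M" and B: "B \<subseteq> carrier M" using insert by auto
  have sB: "submodule ?B R M" by (rule submodule_span[OF B])
  have sx: "submodule ((\<lambda>r. r \<odot>\<^bsub>M\<^esub> x) ` carrier R) R M" by (rule submodule_cyclic_image[OF R.oneideal x])
  have span: "submod_span R M (insert x B) \<subseteq> ?B <+>\<^bsub>M\<^esub> ((\<lambda>r. r \<odot>\<^bsub>M\<^esub> x) ` carrier R)"
  proof (rule span_minimal[OF _ submodule_set_add[OF sB sx]])
    have "B \<subseteq> ?B" by (rule span_superset)
    also have "?B \<subseteq> ?B <+>\<^bsub>M\<^esub> ((\<lambda>r. r \<odot>\<^bsub>M\<^esub> x) ` carrier R)"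
      by (rule set_add_left[OF sx submoduleE(1)[OF sB]])
    finally have 1: "B \<subseteq> ?B <+>\<^bsub>M\<^esub> ((\<lambda>r. r \<odot>\<^bsub>M\<^esub> x) ` carrier R)" .
    have "x = \<one> \<odot>\<^bsub>M\<^esub> x" using x by simp
    then have "x \<in> (\<lambda>r. r \<odot>\<^bsub>M\<^esub> x) ` carrier R" using R.one_closed by blast
    then have "x \<in> ?B <+>\<^bsub>M\<^esub> ((\<lambda>r. r \<odot>\<^bsub>M\<^esub> x) ` carrier R)"
      by (rule subsetD[OF set_add_right[OF sB submoduleE(1)[OF sx]]])
    with 1 show "insert x B \<subseteq> ?B <+>\<^bsub>M\<^esub> ((\<lambda>r. r \<odot>\<^bsub>M\<^esub> x) ` carrier R)" by simp
  qed
  show ?case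
    unfolding acc_on_def
  proof (intro allI impI)
    fix N :: "nat \<Rightarrow> 'b set"
    assume "range N \<subseteq> {N. submodule N R M \<and> N \<subseteq> submod_span R M (insert x B)}" and inc: "incseq N"
    then have sN: "\<And>s. submodule (N s) R M" and Ns: "\<And>s. N s \<subseteq> submod_span R M (insert x B)" by auto
    define D where "D s = {r \<in> carrier R. \<exists>b\<in>?B. b \<oplus>\<^bsub>M\<^esub> r \<odot>\<^bsub>M\<^esub> x \<in> N s}" for s
    have D_eq: "D s = {r \<in> carrier R. \<forall>y\<in>{x}. r \<odot>\<^bsub>M\<^esub> y \<in> ?B <+>\<^bsub>M\<^esub> N s}" for s
    proof (rule equalityI; rule subsetI)
      note [simp] = sub_carr[OF sB] sub_carr[OF sN[of s]]
      fix r assume "r \<in> D s"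
      then obtain b where b: "r \<in> carrier R" "b \<in> ?B" "b \<oplus>\<^bsub>M\<^esub> r \<odot>\<^bsub>M\<^esub> x \<in> N s" unfolding D_def by blast
      then have "r \<odot>\<^bsub>M\<^esub> x = \<ominus>\<^bsub>M\<^esub> b \<oplus>\<^bsub>M\<^esub> (b \<oplus>\<^bsub>M\<^esub> r \<odot>\<^bsub>M\<^esub> x)" using x by (simp add: M.r_neg1)
      moreover have "\<ominus>\<^bsub>M\<^esub> b \<in> ?B" using b sub_neg[OF sB] by blast
      ultimately show "r \<in> {r \<in> carrier R. \<forall>y\<in>{x}. r \<odot>\<^bsub>M\<^esub> y \<in> ?B <+>\<^bsub>M\<^esub> N s}"
        using b unfolding set_add_def' by blast
    next
      note [simp] = sub_carr[OF sB] sub_carr[OF sN[of s]]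
      fix r assume "r \<in> {r \<in> carrier R. \<forall>y\<in>{x}. r \<odot>\<^bsub>M\<^esub> y \<in> ?B <+>\<^bsub>M\<^esub> N s}"
      then obtain b z where b: "r \<in> carrier R" "b \<in> ?B" "z \<in> N s" "r \<odot>\<^bsub>M\<^esub> x = b \<oplus>\<^bsub>M\<^esub> z"
        unfolding set_add_def' by blast
      then have "\<ominus>\<^bsub>M\<^esub> b \<oplus>\<^bsub>M\<^esub> r \<odot>\<^bsub>M\<^esub> x = z" by (simp add: M.r_neg1)
      with b(3) have "\<ominus>\<^bsub>M\<^esub> b \<oplus>\<^bsub>M\<^esub> r \<odot>\<^bsub>M\<^esub> x \<in> N s" by simp
      moreover have "\<ominus>\<^bsub>M\<^esub> b \<in> ?B" using b sub_neg[OF sB] by blast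
      ultimately show "r \<in> D s" using b(1) unfolding D_def by blast
    qed
    have "ideal (D s) R" for s
      unfolding D_eq by (rule ideal_multiplier[OF submodule_set_add[OF sB sN]]) (use x in simp)
    moreover have "incseq D"
    proof (rule incseq_SucI)
      fix s show "D s \<le> D (Suc s)" using incseq_SucD[OF inc, of s] unfolding D_def by blast
    qed
    ultimately obtain c1 where c1: "\<And>s. s \<ge> c1 \<Longrightarrow> D s = D c1"
      using acc_onD[OF acc_ideals] by (metis mem_Collect_eq)
    have "submodule (N s \<inter> ?B) R M \<and> N s \<inter> ?B \<subseteq> ?B" for s
      using submodule_Int[OF sN sB] by blast
    moreover have "incseq (\<lambda>s. N s \<inter> ?B)"
    proof (rule incseq_SucI)
      fix s show "N s \<inter> ?B \<le> N (Suc s) \<inter> ?B" using incseq_SucD[OF inc, of s] by blast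
    qed
    ultimately obtain c2 where c2: "\<And>s. s \<ge> c2 \<Longrightarrow> N s \<inter> ?B = N c2 \<inter> ?B"
      using acc_onD[OF insert.IH[OF B], of "\<lambda>s. N s \<inter> ?B"] by blast
    define c where "c = max c1 c2"
    have "N s \<subseteq> N c" if "s \<ge> c" for s
    proof
      note [simp] = sub_carr[OF sB] sub_carr[OF sN]
      fix z assume z: "z \<in> N s"
      then have "z \<in> ?B <+>\<^bsub>M\<^esub> ((\<lambda>r. r \<odot>\<^bsub>M\<^esub> x) ` carrier R)" using Ns span by blast
      then obtain b r where br: "b \<in> ?B" "r \<in> carrier R" "z = b \<oplus>\<^bsub>M\<^esub> r \<odot>\<^bsub>M\<^esub> x"
        unfolding set_add_def' by blast
      then have "r \<in> D s" using z unfolding D_def by blast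
      then have "r \<in> D c" using c1[of s] c1[of c] that by (simp add: c_def)
      then obtain b' where b': "b' \<in> ?B" "b' \<oplus>\<^bsub>M\<^esub> r \<odot>\<^bsub>M\<^esub> x \<in> N c" unfolding D_def by blast
      have b'': "b' \<oplus>\<^bsub>M\<^esub> r \<odot>\<^bsub>M\<^esub> x \<in> N s" using b'(2) incseqD[OF inc that] by blast
      have z_eq: "z = (b' \<oplus>\<^bsub>M\<^esub> r \<odot>\<^bsub>M\<^esub> x) \<oplus>\<^bsub>M\<^esub> (b \<ominus>\<^bsub>M\<^esub> b')"
      proof -
        have "(b' \<oplus>\<^bsub>M\<^esub> r \<odot>\<^bsub>M\<^esub> x) \<oplus>\<^bsub>M\<^esub> (b \<ominus>\<^bsub>M\<^esub> b') = (b \<oplus>\<^bsub>M\<^esub> r \<odot>\<^bsub>M\<^esub> x) \<oplus>\<^bsub>M\<^esub> (b' \<oplus>\<^bsub>M\<^esub> \<ominus>\<^bsub>M\<^esub> b')"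
          using br b' x unfolding a_minus_def by (simp add: M.a_ac)
        then show ?thesis using br b' x by (simp add: M.r_neg)
      qed
      have "b \<ominus>\<^bsub>M\<^esub> b' \<in> N s"
      proof (rule sub_cancel[OF sN _ b''])
        show "(b' \<oplus>\<^bsub>M\<^esub> r \<odot>\<^bsub>M\<^esub> x) \<oplus>\<^bsub>M\<^esub> (b \<ominus>\<^bsub>M\<^esub> b') \<in> N s" using z z_eq by simp
      qed (use br b' x in auto)
      moreover have "b \<ominus>\<^bsub>M\<^esub> b' \<in> ?B" using br b' sub_minus[OF sB] by blast
      ultimately have "b \<ominus>\<^bsub>M\<^esub> b' \<in> N c" using c2[of s] c2[of c] that by (auto simp: c_def)
      then show "z \<in> N c" unfolding z_eq by (rule sub_add[OF sN b'(2)])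
    qed
    then show "\<exists>c. \<forall>s\<ge>c. N s = N c" using incseqD[OF inc] by blast
  qed
qed

lemma acc_submodules: "acc_on {N. submodule N R M}"
proof -
  obtain B where B: "finite B" "B \<subseteq> carrier M" "carrier M = submod_span R M B"
    using fin_gen unfolding fin_gen_module_def by blast
  have "{N. submodule N R M \<and> N \<subseteq> submod_span R M B} = {N. submodule N R M}"
    using submoduleE(1) B(3) by auto
  then show ?thesis using acc_submodules_span[OF B(1,2)] by simp
qed

text \<open>A graded submodule is represented by the family of its homogeneous components, all of them
  submodules of \<open>M\<close>: an element \<open>a\<close> of degree \<open>\<delta>\<close> acts by multiplication and shifts the degree. This
  avoids polynomial rings and their modules altogether.\<close>

definition graded_closed :: "('d::ab_group_add \<times> 'a) set \<Rightarrow> ('d \<Rightarrow> 'b set) \<Rightarrow> bool"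
  where "graded_closed S N \<longleftrightarrow> (\<forall>d. submodule (N d) R M) \<and>
    (\<forall>(\<delta>, a)\<in>S. \<forall>d. \<forall>x\<in>N d. a \<odot>\<^bsub>M\<^esub> x \<in> N (d + \<delta>))"

lemma graded_closedD:
  assumes "graded_closed S N"
  shows "submodule (N d) R M" and "(\<delta>, a) \<in> S \<Longrightarrow> x \<in> N d \<Longrightarrow> a \<odot>\<^bsub>M\<^esub> x \<in> N (d + \<delta>)"
  using assms unfolding graded_closed_def by blast+

text \<open>Hilbert's basis theorem for the graded module that finitely many homogeneous operators generate
  from \<open>M\<close> in degree \<open>0\<close>. The family \<open>T\<close> consists of the sums of the submodules \<open>a\<^sub>1\<^sup>n\<^sub>1 \<dots> a\<^sub>r\<^sup>n\<^sub>r M\<close>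
  over the monomials of the given degree. The operators are added one at a time. If \<open>a\<close> is added to \<open>S\<close>, a closed family
  \<open>N\<close> has for each \<open>j\<close> a family of leading coefficients at \<open>a\<^sup>j\<close>. It is closed under \<open>S\<close>, it
  increases with \<open>N\<close> and, because \<open>N\<close> is closed under \<open>a\<close>, with \<open>j\<close>. So the leading
  coefficients of an ascending chain become constant for all \<open>j\<close> at once, and cancelling leading terms
  then shows that the chain itself is constant.\<close>

theorem graded_basis:
  fixes S :: "('d::ab_group_add \<times> 'a) set"
  assumes "finite S" "snd ` S \<subseteq> carrier R"
  shows "\<exists>T. graded_closed S T \<and> T 0 = carrier M \<and> acc_on {N. graded_closed S N \<and> N \<le> T}"
  using assms
proof (induction S)
  case empty
  define T where "T = (\<lambda>d::'d. if d = 0 then carrier M else {\<zero>\<^bsub>M\<^esub>})"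
  have "graded_closed {} T"
    unfolding graded_closed_def T_def using carrier_is_submodule submodule_zero by auto
  moreover have "acc_on {N. graded_closed {} N \<and> N \<le> T}"
    unfolding acc_on_def
  proof (intro allI impI)
    fix N :: "nat \<Rightarrow> 'd \<Rightarrow> 'b set"
    assume "range N \<subseteq> {N. graded_closed {} N \<and> N \<le> T}" and inc: "incseq N"
    then have sN: "\<And>s d. submodule (N s d) R M" and NT: "\<And>s d. N s d \<subseteq> T d"
      unfolding graded_closed_def by (auto simp: le_fun_def)
    have "incseq (\<lambda>s. N s 0)" using inc by (auto simp: incseq_def le_fun_def)
    then obtain c where c: "\<And>s. s \<ge> c \<Longrightarrow> N s 0 = N c 0"
      using acc_onD[OF acc_submodules, of "\<lambda>s. N s 0"] sN by blast
    have "N s d = N c d" if "s \<ge> c" for s d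
    proof (cases "d = 0")
      case True
      then show ?thesis using c[OF that] by simp
    next
      case False
      then have "N t d = {\<zero>\<^bsub>M\<^esub>}" for t
        using NT[of t d] sub_zero[OF sN[of t d]] unfolding T_def by auto
      then show ?thesis by simp
    qed
    then show "\<exists>c. \<forall>s\<ge>c. N s = N c" by (intro exI[of _ c] allI impI ext)
  qed
  ultimately show ?case by (intro exI[of _ T]) (simp add: T_def)
next
  case (insert q S)
  obtain \<delta> a where q: "q = (\<delta>, a)" by (cases q)
  have a: "a \<in> carrier R" and S: "snd ` S \<subseteq> carrier R" using insert.prems q by auto
  obtain T where T: "graded_closed S T" "T 0 = carrier M" and acc: "acc_on {N. graded_closed S N \<and> N \<le> T}"
    using insert.IH[OF S] by blast
  note sT = graded_closedD(1)[OF T(1)]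
  define sh where "sh j = (\<Sum>l<j. \<delta>)" for j :: nat
  have sh_0 [simp]: "sh 0 = 0" and sh_Suc [simp]: "sh (Suc j) = sh j + \<delta>" for j
    by (simp_all add: sh_def)
  \<comment> \<open>polynomials in \<open>a\<close> with coefficients in \<open>T\<close> and fewer than \<open>j\<close> terms; \<open>sh j\<close> is the degree of \<open>a\<^sup>j\<close>\<close>
  define G where "G j e = rec_nat {\<zero>\<^bsub>M\<^esub>} (\<lambda>j V. V <+>\<^bsub>M\<^esub> ((\<odot>\<^bsub>M\<^esub>) (a [^] j) ` T (e - sh j))) j" for j e
  have G_0 [simp]: "G 0 e = {\<zero>\<^bsub>M\<^esub>}" for e by (simp add: G_def)
  have G_Suc: "G (Suc j) e = G j e <+>\<^bsub>M\<^esub> ((\<odot>\<^bsub>M\<^esub>) (a [^] j) ` T (e - sh j))" for j e by (simp add: G_def)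
  have s_aT: "submodule ((\<odot>\<^bsub>M\<^esub>) (a [^] (j::nat)) ` T e) R M" for j e
    by (rule submodule_smult_image[OF R.nat_pow_closed[OF a] sT])
  have sG: "submodule (G j e) R M" for j e
    by (induction j) (simp_all only: G_0 G_Suc submodule_zero submodule_set_add s_aT)
  note [simp] = sub_carr[OF sG] sub_carr[OF sT] a
  have G_memI: "g \<oplus>\<^bsub>M\<^esub> (a [^] j) \<odot>\<^bsub>M\<^esub> x \<in> G (Suc j) e" if "g \<in> G j e" "x \<in> T (e - sh j)" for g x j e
    using that unfolding G_Suc set_add_def' by blast
  have G_memE: "\<exists>g\<in>G j e. \<exists>x\<in>T (e - sh j). z = g \<oplus>\<^bsub>M\<^esub> (a [^] j) \<odot>\<^bsub>M\<^esub> x" if "z \<in> G (Suc j) e" for z j e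
    using that unfolding G_Suc set_add_def' by blast
  have G_inc: "incseq (\<lambda>j. G j e)" for e
    by (rule incseq_SucI) (unfold G_Suc, rule set_add_left[OF s_aT submoduleE(1)[OF sG]])
  have G_S: "b \<odot>\<^bsub>M\<^esub> z \<in> G j (e + \<epsilon>)" if "(\<epsilon>, b) \<in> S" "z \<in> G j e" for \<epsilon> b j e z
    using that(2)
  proof (induction j arbitrary: z)
    case 0
    then show ?case using that(1) S by force
  next
    case (Suc j)
    have b: "b \<in> carrier R" using that(1) S by force
    obtain g x where gx: "g \<in> G j e" "x \<in> T (e - sh j)" "z = g \<oplus>\<^bsub>M\<^esub> (a [^] j) \<odot>\<^bsub>M\<^esub> x"
      using G_memE[OF Suc.prems] by blast
    have "b \<odot>\<^bsub>M\<^esub> x \<in> T (e - sh j + \<epsilon>)" by (rule graded_closedD(2)[OF T(1) that(1) gx(2)])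
    then have "b \<odot>\<^bsub>M\<^esub> x \<in> T (e + \<epsilon> - sh j)" by (simp add: algebra_simps)
    from G_memI[OF Suc.IH[OF gx(1)] this]
    show ?case using gx b by (simp add: smult_r_distr smult_left_commute)
  qed
  have G_a: "a \<odot>\<^bsub>M\<^esub> z \<in> G (Suc j) (e + \<delta>)" if "z \<in> G j e" for j e z
    using that
  proof (induction j arbitrary: z)
    case 0
    then show ?case using sub_zero[OF sG] by simp
  next
    case (Suc j)
    obtain g x where gx: "g \<in> G j e" "x \<in> T (e - sh j)" "z = g \<oplus>\<^bsub>M\<^esub> (a [^] j) \<odot>\<^bsub>M\<^esub> x"
      using G_memE[OF Suc.prems] by blast
    have "x \<in> T (e + \<delta> - sh (Suc j))" using gx(2) by (simp add: algebra_simps)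
    from G_memI[OF Suc.IH[OF gx(1)] this]
    show ?case using gx by (simp add: smult_r_distr smult_assoc1[symmetric] R.m_comm)
  qed
  define T' where "T' e = (\<Union>j. G j e)" for e
  have "graded_closed (insert q S) T'"
    unfolding graded_closed_def
  proof (intro conjI allI ballI)
    show "submodule (T' d) R M" for d unfolding T'_def by (rule submodule_Un_chain[OF sG G_inc])
    fix p assume "p \<in> insert q S"
    moreover obtain \<epsilon> b where "p = (\<epsilon>, b)" by (cases p)
    ultimately show "case p of (\<delta>, a) \<Rightarrow> \<forall>d. \<forall>x\<in>T' d. a \<odot>\<^bsub>M\<^esub> x \<in> T' (d + \<delta>)"
      unfolding T'_def q using G_S G_a by auto blast+
  qed
  moreover have "T' 0 = carrier M"
  proof
    show "T' 0 \<subseteq> carrier M" unfolding T'_def by auto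
    show "carrier M \<subseteq> T' 0"
    proof
      fix x assume x: "x \<in> carrier M"
      have "\<zero>\<^bsub>M\<^esub> \<oplus>\<^bsub>M\<^esub> (a [^] (0::nat)) \<odot>\<^bsub>M\<^esub> x \<in> G (Suc 0) 0"
        by (rule G_memI) (use x T(2) in auto)
      then show "x \<in> T' 0" using x unfolding T'_def by auto
    qed
  qed
  moreover have "acc_on {N. graded_closed (insert q S) N \<and> N \<le> T'}"
    unfolding acc_on_def
  proof (intro allI impI)
    fix N :: "nat \<Rightarrow> 'd \<Rightarrow> 'b set"
    assume range: "range N \<subseteq> {N. graded_closed (insert q S) N \<and> N \<le> T'}" and inc: "incseq N"
    then have cN: "\<And>s. graded_closed (insert q S) (N s)" and NT: "\<And>s d. N s d \<subseteq> T' d"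
      by (auto simp: le_fun_def)
    note sN = graded_closedD(1)[OF cN]
    have N_inc: "N s d \<subseteq> N t d" if "s \<le> t" for s t d
      using incseqD[OF inc that] by (simp add: le_fun_def)
    \<comment> \<open>coefficients at \<open>a\<^sup>j\<close> of the elements of \<open>N s\<close> that have degree at most \<open>j\<close> in \<open>a\<close>\<close>
    define L where "L j s = (\<lambda>d. {x \<in> T d. \<exists>g\<in>G j (d + sh j). g \<oplus>\<^bsub>M\<^esub> (a [^] j) \<odot>\<^bsub>M\<^esub> x \<in> N s (d + sh j)})"
      for j s :: nat
    have L_closed: "graded_closed S (L j s)" for j s
      unfolding graded_closed_def
    proof (intro conjI allI ballI)
      fix d
      show "submodule (L j s d) R M"
      proof (rule submoduleI')
        show "L j s d \<subseteq> carrier M" unfolding L_def by auto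
        have "\<zero>\<^bsub>M\<^esub> \<oplus>\<^bsub>M\<^esub> (a [^] j) \<odot>\<^bsub>M\<^esub> \<zero>\<^bsub>M\<^esub> \<in> N s (d + sh j)" using sub_zero[OF sN] by simp
        then show "\<zero>\<^bsub>M\<^esub> \<in> L j s d" using sub_zero[OF sG] sub_zero[OF sT] unfolding L_def by blast
      next
        fix x y assume "x \<in> L j s d" "y \<in> L j s d"
        then obtain g h where *: "x \<in> T d" "y \<in> T d" "g \<in> G j (d + sh j)" "h \<in> G j (d + sh j)"
          "g \<oplus>\<^bsub>M\<^esub> (a [^] j) \<odot>\<^bsub>M\<^esub> x \<in> N s (d + sh j)" "h \<oplus>\<^bsub>M\<^esub> (a [^] j) \<odot>\<^bsub>M\<^esub> y \<in> N s (d + sh j)"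
          unfolding L_def by blast
        have "(g \<oplus>\<^bsub>M\<^esub> h) \<oplus>\<^bsub>M\<^esub> (a [^] j) \<odot>\<^bsub>M\<^esub> (x \<oplus>\<^bsub>M\<^esub> y)
          = (g \<oplus>\<^bsub>M\<^esub> (a [^] j) \<odot>\<^bsub>M\<^esub> x) \<oplus>\<^bsub>M\<^esub> (h \<oplus>\<^bsub>M\<^esub> (a [^] j) \<odot>\<^bsub>M\<^esub> y)"
          using * by (simp add: smult_r_distr M.a_ac)
        then have "(g \<oplus>\<^bsub>M\<^esub> h) \<oplus>\<^bsub>M\<^esub> (a [^] j) \<odot>\<^bsub>M\<^esub> (x \<oplus>\<^bsub>M\<^esub> y) \<in> N s (d + sh j)"
          using sub_add[OF sN *(5,6)] by simp
        then show "x \<oplus>\<^bsub>M\<^esub> y \<in> L j s d"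
          using sub_add[OF sG *(3,4)] sub_add[OF sT *(1,2)] unfolding L_def by blast
      next
        fix r x assume r: "r \<in> carrier R" and "x \<in> L j s d"
        then obtain g where *: "x \<in> T d" "g \<in> G j (d + sh j)"
          "g \<oplus>\<^bsub>M\<^esub> (a [^] j) \<odot>\<^bsub>M\<^esub> x \<in> N s (d + sh j)"
          unfolding L_def by blast
        have "r \<odot>\<^bsub>M\<^esub> g \<oplus>\<^bsub>M\<^esub> (a [^] j) \<odot>\<^bsub>M\<^esub> (r \<odot>\<^bsub>M\<^esub> x) = r \<odot>\<^bsub>M\<^esub> (g \<oplus>\<^bsub>M\<^esub> (a [^] j) \<odot>\<^bsub>M\<^esub> x)"
          using * r by (simp add: smult_r_distr smult_left_commute)
        then have "r \<odot>\<^bsub>M\<^esub> g \<oplus>\<^bsub>M\<^esub> (a [^] j) \<odot>\<^bsub>M\<^esub> (r \<odot>\<^bsub>M\<^esub> x) \<in> N s (d + sh j)"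
          using sub_smult[OF sN r *(3)] by simp
        then show "r \<odot>\<^bsub>M\<^esub> x \<in> L j s d"
          using sub_smult[OF sG r *(2)] sub_smult[OF sT r *(1)] unfolding L_def by blast
      qed
    next
      fix p assume p: "p \<in> S"
      obtain \<epsilon> b where pb: "p = (\<epsilon>, b)" by (cases p)
      have b: "b \<in> carrier R" using p pb S by force
      have "b \<odot>\<^bsub>M\<^esub> x \<in> L j s (d + \<epsilon>)" if "x \<in> L j s d" for d x
      proof -
        obtain g where *: "x \<in> T d" "g \<in> G j (d + sh j)"
          "g \<oplus>\<^bsub>M\<^esub> (a [^] j) \<odot>\<^bsub>M\<^esub> x \<in> N s (d + sh j)"
          using \<open>x \<in> L j s d\<close> unfolding L_def by blast
        have e: "d + sh j + \<epsilon> = d + \<epsilon> + sh j" by (simp add: algebra_simps)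
        have "b \<odot>\<^bsub>M\<^esub> g \<oplus>\<^bsub>M\<^esub> (a [^] j) \<odot>\<^bsub>M\<^esub> (b \<odot>\<^bsub>M\<^esub> x) = b \<odot>\<^bsub>M\<^esub> (g \<oplus>\<^bsub>M\<^esub> (a [^] j) \<odot>\<^bsub>M\<^esub> x)"
          using * b by (simp add: smult_r_distr smult_left_commute)
        then have "b \<odot>\<^bsub>M\<^esub> g \<oplus>\<^bsub>M\<^esub> (a [^] j) \<odot>\<^bsub>M\<^esub> (b \<odot>\<^bsub>M\<^esub> x) \<in> N s (d + \<epsilon> + sh j)"
          using graded_closedD(2)[OF cN _ *(3), of \<epsilon> b] p pb by (simp add: e)
        moreover have "b \<odot>\<^bsub>M\<^esub> g \<in> G j (d + \<epsilon> + sh j)" using G_S[OF _ *(2), of \<epsilon> b] p pb by (simp add: e)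
        moreover have "b \<odot>\<^bsub>M\<^esub> x \<in> T (d + \<epsilon>)" using graded_closedD(2)[OF T(1) _ *(1), of \<epsilon> b] p pb by simp
        ultimately show ?thesis unfolding L_def by blast
      qed
      then show "case p of (\<delta>, a) \<Rightarrow> \<forall>d. \<forall>x\<in>L j s d. a \<odot>\<^bsub>M\<^esub> x \<in> L j s (d + \<delta>)" using pb by simp
    qed
    have "\<exists>c. \<forall>s\<ge>c. \<forall>j. L j s = L j c"
    proof (rule double_chain_stabilises[OF acc])
      show "L j s \<in> {N. graded_closed S N \<and> N \<le> T}" for j s
        using L_closed by (auto simp: le_fun_def L_def)
      show "L j s \<le> L j (Suc s)" for j s
        using N_inc[of s "Suc s"] by (auto simp: le_fun_def L_def)
      show "L j s \<le> L (Suc j) s" for j s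
      proof (rule le_funI, rule subsetI)
        fix d x assume "x \<in> L j s d"
        then obtain g where *: "x \<in> T d" "g \<in> G j (d + sh j)"
          "g \<oplus>\<^bsub>M\<^esub> (a [^] j) \<odot>\<^bsub>M\<^esub> x \<in> N s (d + sh j)"
          unfolding L_def by blast
        have e: "d + sh j + \<delta> = d + sh (Suc j)" by (simp add: algebra_simps)
        have "a \<odot>\<^bsub>M\<^esub> g \<oplus>\<^bsub>M\<^esub> (a [^] Suc j) \<odot>\<^bsub>M\<^esub> x = a \<odot>\<^bsub>M\<^esub> (g \<oplus>\<^bsub>M\<^esub> (a [^] j) \<odot>\<^bsub>M\<^esub> x)"
          using * by (simp add: smult_r_distr smult_assoc1[symmetric] R.m_comm)
        then have "a \<odot>\<^bsub>M\<^esub> g \<oplus>\<^bsub>M\<^esub> (a [^] Suc j) \<odot>\<^bsub>M\<^esub> x \<in> N s (d + sh (Suc j))"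
          using graded_closedD(2)[OF cN _ *(3), of \<delta> a] q e by simp
        moreover have "a \<odot>\<^bsub>M\<^esub> g \<in> G (Suc j) (d + sh (Suc j))" using G_a[OF *(2)] unfolding e .
        ultimately show "x \<in> L (Suc j) s d" using *(1) unfolding L_def by blast
      qed
    qed
    then obtain c where c: "\<And>s j. s \<ge> c \<Longrightarrow> L j s = L j c" by blast
    have step: "N s e \<inter> G j e \<subseteq> N c e" if s: "s \<ge> c" for s e j
    proof (induction j)
      case 0
      then show ?case using sub_zero[OF sN] by auto
    next
      case (Suc j)
      show ?case
      proof
        note [simp] = sub_carr[OF sN]
        fix z assume z: "z \<in> N s e \<inter> G (Suc j) e"
        then obtain g x where gx: "g \<in> G j e" "x \<in> T (e - sh j)" "z = g \<oplus>\<^bsub>M\<^esub> (a [^] j) \<odot>\<^bsub>M\<^esub> x"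
          using G_memE by blast
        then have "x \<in> L j s (e - sh j)" using z unfolding L_def by auto
        then have "x \<in> L j c (e - sh j)" using c[OF s] by simp
        then obtain h where h: "h \<in> G j e" "h \<oplus>\<^bsub>M\<^esub> (a [^] j) \<odot>\<^bsub>M\<^esub> x \<in> N c e" unfolding L_def by auto
        have h': "h \<oplus>\<^bsub>M\<^esub> (a [^] j) \<odot>\<^bsub>M\<^esub> x \<in> N s e" using h(2) N_inc[OF s] by blast
        have gh: "g \<ominus>\<^bsub>M\<^esub> h \<in> G j e" by (rule sub_minus[OF sG gx(1) h(1)])
        have z_eq: "z = (h \<oplus>\<^bsub>M\<^esub> (a [^] j) \<odot>\<^bsub>M\<^esub> x) \<oplus>\<^bsub>M\<^esub> (g \<ominus>\<^bsub>M\<^esub> h)"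
        proof -
          have "(h \<oplus>\<^bsub>M\<^esub> (a [^] j) \<odot>\<^bsub>M\<^esub> x) \<oplus>\<^bsub>M\<^esub> (g \<ominus>\<^bsub>M\<^esub> h)
            = (g \<oplus>\<^bsub>M\<^esub> (a [^] j) \<odot>\<^bsub>M\<^esub> x) \<oplus>\<^bsub>M\<^esub> (h \<oplus>\<^bsub>M\<^esub> \<ominus>\<^bsub>M\<^esub> h)"
            using gx h unfolding a_minus_def by (simp add: M.a_ac)
          then show ?thesis using gx h by (simp add: M.r_neg)
        qed
        have "g \<ominus>\<^bsub>M\<^esub> h \<in> N s e"
        proof (rule sub_cancel[OF sN _ h'])
          show "(h \<oplus>\<^bsub>M\<^esub> (a [^] j) \<odot>\<^bsub>M\<^esub> x) \<oplus>\<^bsub>M\<^esub> (g \<ominus>\<^bsub>M\<^esub> h) \<in> N s e" using z z_eq by simp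
        qed (use gx h gh in auto)
        then have "g \<ominus>\<^bsub>M\<^esub> h \<in> N c e" using gh Suc.IH by blast
        then show "z \<in> N c e" unfolding z_eq by (rule sub_add[OF sN h(2)])
      qed
    qed
    have "N s e = N c e" if "s \<ge> c" for s e
    proof
      show "N s e \<subseteq> N c e" using step[OF that] NT[of s e] unfolding T'_def by blast
      show "N c e \<subseteq> N s e" by (rule N_inc[OF that])
    qed
    then show "\<exists>c. \<forall>s\<ge>c. N s = N c" by (intro exI[of _ c] allI impI ext)
  qed
  ultimately show ?case by blast
qed

end

section \<open>Artin--Rees for two ideals\<close>

context fg_module_noetherian_ring
begin

text \<open>Closed subfamilies of the bigraded Rees module with components \<open>P\<^sup>i J\<^sup>d M\<close>.\<close>

definition bigraded :: "'a set \<Rightarrow> 'a set \<Rightarrow> (nat \<Rightarrow> nat \<Rightarrow> 'b set) \<Rightarrow> bool"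
  where "bigraded P J W \<longleftrightarrow> (\<forall>i d. submodule (W i d) R M \<and> W i d \<subseteq> mul (ideal_pow R P i) (pw J d) \<and>
    (\<forall>a\<in>P. \<forall>x\<in>W i d. a \<odot>\<^bsub>M\<^esub> x \<in> W (Suc i) d) \<and> (\<forall>a\<in>J. \<forall>x\<in>W i d. a \<odot>\<^bsub>M\<^esub> x \<in> W i (Suc d)))"

lemma bigradedI:
  assumes "\<And>i d. submodule (W i d) R M" "\<And>i d. W i d \<subseteq> mul (ideal_pow R P i) (pw J d)"
    and "\<And>a x i d. a \<in> P \<Longrightarrow> x \<in> W i d \<Longrightarrow> a \<odot>\<^bsub>M\<^esub> x \<in> W (Suc i) d"
    and "\<And>a x i d. a \<in> J \<Longrightarrow> x \<in> W i d \<Longrightarrow> a \<odot>\<^bsub>M\<^esub> x \<in> W i (Suc d)"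
  shows "bigraded P J W"
  using assms unfolding bigraded_def by blast

lemma bigradedD:
  assumes "bigraded P J W"
  shows "submodule (W i d) R M" "W i d \<subseteq> mul (ideal_pow R P i) (pw J d)"
    and "a \<in> P \<Longrightarrow> x \<in> W i d \<Longrightarrow> a \<odot>\<^bsub>M\<^esub> x \<in> W (Suc i) d"
    and "a \<in> J \<Longrightarrow> x \<in> W i d \<Longrightarrow> a \<odot>\<^bsub>M\<^esub> x \<in> W i (Suc d)"
  using assms unfolding bigraded_def by blast+

lemma graded_closed_ideal:
  assumes T: "graded_closed S T" and A: "\<And>a. a \<in> A \<Longrightarrow> (\<delta>, a) \<in> S" "A \<subseteq> carrier R"
    and a: "a \<in> Idl A" and x: "x \<in> T d"
  shows "a \<odot>\<^bsub>M\<^esub> x \<in> T (d + \<delta>)"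
proof -
  let ?H = "{a \<in> carrier R. \<forall>x\<in>T d. a \<odot>\<^bsub>M\<^esub> x \<in> T (d + \<delta>)}"
  have "ideal ?H R"
    by (rule ideal_multiplier[OF graded_closedD(1)[OF T] submoduleE(1)[OF graded_closedD(1)[OF T]]])
  moreover have "A \<subseteq> ?H" using A graded_closedD(2)[OF T] by blast
  ultimately have "Idl A \<subseteq> ?H" by (rule R.genideal_minimal)
  then show ?thesis using a x by blast
qed

text \<open>Generators of \<open>P\<close>, in bidegree \<open>(1, 0)\<close>, and generators of \<open>J\<close>, in bidegree
  \<open>(0, 1)\<close>, generate the bigraded Rees module from \<open>M\<close>, so the basis theorem applies.\<close>

theorem acc_bigraded:
  assumes P: "ideal P R" and J: "ideal J R"
  shows "acc_on {W. bigraded P J W}"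
  unfolding acc_on_def
proof (intro allI impI)
  fix W :: "nat \<Rightarrow> nat \<Rightarrow> nat \<Rightarrow> 'b set"
  assume "range W \<subseteq> {W. bigraded P J W}" and inc: "incseq W"
  then have W: "\<And>s. bigraded P J (W s)" by auto
  obtain A where A: "A \<subseteq> carrier R" "finite A" "P = Idl A" using finetely_gen[OF P] by blast
  obtain B where B: "B \<subseteq> carrier R" "finite B" "J = Idl B" using finetely_gen[OF J] by blast
  define S :: "((int \<times> int) \<times> 'a) set" where "S = Pair (1, 0) ` A \<union> Pair (0, 1) ` B"
  have "finite S" "snd ` S \<subseteq> carrier R" using A B by (auto simp: S_def)
  from graded_basis[OF this] obtain T where T: "graded_closed S T" "T 0 = carrier M"
    and acc: "acc_on {N. graded_closed S N \<and> N \<le> T}" by blast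
  note sT = graded_closedD(1)[OF T(1)]
  have TP: "a \<odot>\<^bsub>M\<^esub> x \<in> T (int (Suc i), d)" if "a \<in> P" "x \<in> T (int i, d)" for a x i d
    using graded_closed_ideal[OF T(1), of A "(1,0)" a x "(int i, d)"] that A by (simp add: S_def add.commute)
  have TJ: "a \<odot>\<^bsub>M\<^esub> x \<in> T (d, int (Suc i))" if "a \<in> J" "x \<in> T (d, int i)" for a x i d
    using graded_closed_ideal[OF T(1), of B "(0,1)" a x "(d, int i)"] that B by (simp add: S_def add.commute)
  have T0: "pw J d \<subseteq> T (0, int d)" for d
  proof (induction d)
    case 0
    then show ?case using T(2) by (simp only: pw_0) (simp add: zero_prod_def)
  next
    case (Suc d)
    show ?case unfolding pw_Suc[OF J] by (rule mul_least[OF sT]) (use Suc TJ in blast)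
  qed
  have T1: "mul (ideal_pow R P i) (pw J d) \<subseteq> T (int i, int d)" for i d
  proof (induction i)
    case 0
    then show ?case using T0 by (simp only: R.ideal_pow_0 mul_carrier_left[OF pw_sub[OF J]]) simp
  next
    case (Suc i)
    show ?case unfolding mul_pow_Suc[OF P pw_sub[OF J]] by (rule mul_least[OF sT]) (use Suc TP in blast)
  qed
  \<comment> \<open>extension by zero to negative degrees\<close>
  define N where "N s = (\<lambda>(z, w). if 0 \<le> z \<and> 0 \<le> w then W s (nat z) (nat w) else {\<zero>\<^bsub>M\<^esub>})" for s
  have N_nat: "N s (int i, int d) = W s i d" for s i d by (simp add: N_def)
  have N_neg: "N s (z, w) = {\<zero>\<^bsub>M\<^esub>}" if "\<not> (0 \<le> z \<and> 0 \<le> w)" for s z w using that by (auto simp: N_def)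
  have cases: "(\<exists>i d. z = int i \<and> w = int d) \<or> \<not> (0 \<le> z \<and> 0 \<le> w)" for z w
    by (metis zero_le_imp_eq_int)
  have sN: "submodule (N s e) R M" for s e
    unfolding N_def by (cases e) (simp add: bigradedD(1)[OF W] submodule_zero)
  have NP: "a \<odot>\<^bsub>M\<^esub> x \<in> N s (e + (1, 0))" if a: "a \<in> P" and x: "x \<in> N s e" for a x s e
  proof -
    obtain z w where e: "e = (z, w)" by (cases e)
    from cases[of z w] show ?thesis
    proof
      assume "\<exists>i d. z = int i \<and> w = int d"
      then obtain i d where "z = int i" "w = int d" by blast
      then show ?thesis using bigradedD(3)[OF W a, of x s i d] x N_nat[of s i d] N_nat[of s "Suc i" d]
        by (simp add: e add.commute)
    next
      assume "\<not> (0 \<le> z \<and> 0 \<le> w)"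
      then have "x = \<zero>\<^bsub>M\<^esub>" using x e N_neg by auto
      then show ?thesis using a ideal.Icarr[OF P] sub_zero[OF sN] by simp
    qed
  qed
  have NJ: "a \<odot>\<^bsub>M\<^esub> x \<in> N s (e + (0, 1))" if a: "a \<in> J" and x: "x \<in> N s e" for a x s e
  proof -
    obtain z w where e: "e = (z, w)" by (cases e)
    from cases[of z w] show ?thesis
    proof
      assume "\<exists>i d. z = int i \<and> w = int d"
      then obtain i d where "z = int i" "w = int d" by blast
      then show ?thesis using bigradedD(4)[OF W a, of x s i d] x N_nat[of s i d] N_nat[of s i "Suc d"]
        by (simp add: e add.commute)
    next
      assume "\<not> (0 \<le> z \<and> 0 \<le> w)"
      then have "x = \<zero>\<^bsub>M\<^esub>" using x e N_neg by auto
      then show ?thesis using a ideal.Icarr[OF J] sub_zero[OF sN] by simp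
    qed
  qed
  have "graded_closed S (N s)" for s
  proof -
    have "A \<subseteq> P" "B \<subseteq> J" using A B R.genideal_self by auto
    then show ?thesis unfolding graded_closed_def S_def using sN NP NJ by auto
  qed
  moreover have "N s \<le> T" for s
  proof (rule le_funI)
    fix e :: "int \<times> int"
    obtain z w where e: "e = (z, w)" by (cases e)
    from cases[of z w] show "N s e \<subseteq> T e"
    proof
      assume "\<exists>i d. z = int i \<and> w = int d"
      then show ?thesis using e N_nat T1 bigradedD(2)[OF W] by blast
    next
      assume "\<not> (0 \<le> z \<and> 0 \<le> w)"
      then show ?thesis using e N_neg sub_zero[OF sT] by simp
    qed
  qed
  moreover have "incseq N"
  proof (rule incseq_SucI, rule le_funI)
    fix s and e :: "int \<times> int"
    have "W s i d \<subseteq> W (Suc s) i d" for i d using incseq_SucD[OF inc, of s] by (simp add: le_fun_def)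
    then show "N s e \<subseteq> N (Suc s) e" unfolding N_def by (cases e) simp
  qed
  ultimately obtain c where c: "\<And>s. s \<ge> c \<Longrightarrow> N s = N c"
    using acc_onD[OF acc, of N] by blast
  have "W s i d = W c i d" if "s \<ge> c" for s i d
    using N_nat[of s i d] N_nat[of c i d] unfolding c[OF that] by blast
  then show "\<exists>c. \<forall>s\<ge>c. W s = W c" by (intro exI[of _ c] allI impI ext)
qed

text \<open>The case of one ideal is the case in which the other ideal is the whole ring.\<close>

corollary acc_graded:
  assumes J: "ideal J R"
  shows "acc_on {N. \<forall>d. submodule (N d) R M \<and> N d \<subseteq> pw J d \<and> (\<forall>a\<in>J. \<forall>x\<in>N d. a \<odot>\<^bsub>M\<^esub> x \<in> N (Suc d))}"
  unfolding acc_on_def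
proof (intro allI impI)
  let ?C = "{N. \<forall>d. submodule (N d) R M \<and> N d \<subseteq> pw J d \<and> (\<forall>a\<in>J. \<forall>x\<in>N d. a \<odot>\<^bsub>M\<^esub> x \<in> N (Suc d))}"
  fix N :: "nat \<Rightarrow> nat \<Rightarrow> 'b set"
  assume "range N \<subseteq> ?C" and inc: "incseq N"
  then have N: "N s \<in> ?C" for s by blast
  have one: "mul (ideal_pow R (carrier R) i) (pw J d) = pw J d" for i d
  proof (induction i)
    case 0
    then show ?case by (simp only: R.ideal_pow_0 mul_carrier_left[OF pw_sub[OF J]])
  next
    case (Suc i)
    then show ?case by (simp only: mul_pow_Suc[OF R.oneideal pw_sub[OF J]] mul_carrier_left[OF pw_sub[OF J]])
  qed
  have "bigraded (carrier R) J (\<lambda>_. N s)" for s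
  proof (rule bigradedI)
    show "N s d \<subseteq> mul (ideal_pow R (carrier R) i) (pw J d)" for i d unfolding one using N by blast
    fix a x d assume "a \<in> carrier R" "x \<in> N s d"
    moreover have "submodule (N s d) R M" using N by blast
    ultimately show "a \<odot>\<^bsub>M\<^esub> x \<in> N s d" by (simp add: sub_smult)
  qed (use N in blast)+
  moreover have "incseq (\<lambda>s _::nat. N s)" using inc by (auto simp: incseq_def le_fun_def)
  ultimately obtain c where c: "\<And>s. s \<ge> c \<Longrightarrow> (\<lambda>_::nat. N s) = (\<lambda>_. N c)"
    using acc_onD[OF acc_bigraded[OF R.oneideal J], of "\<lambda>s _. N s"] by blast
  have "N s = N c" if "s \<ge> c" for s using fun_cong[OF c[OF that]] .
  then show "\<exists>c. \<forall>s\<ge>c. N s = N c" by blast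
qed

text \<open>Truncating \<open>W\<close> at degree \<open>s\<close> in the first grading and continuing it by powers of \<open>P\<close> gives an
  ascending chain of bigraded families with union \<open>W\<close>. It becomes constant at some \<open>c\<close>, which means
  that \<open>W\<close> is generated over \<open>P\<close> by its components of degree at most \<open>c\<close>.\<close>

lemma artin_rees_bigraded:
  assumes P: "ideal P R" and J: "ideal J R" and W: "bigraded P J W"
  shows "\<exists>c. \<forall>i d. W (c + i) d \<subseteq> mul (ideal_pow R P i) (W c d)"
proof -
  note sW = bigradedD(1)[OF W]
  define N where "N s i d = (if i \<le> s then W i d else mul (ideal_pow R P (i - s)) (W s d))" for s i d
  have sN: "submodule (N s i d) R M" for s i d
    unfolding N_def using sW mul_pow_sub[OF P sW] by simp
  have NP: "a \<odot>\<^bsub>M\<^esub> x \<in> N s (Suc i) d" if a: "a \<in> P" and x: "x \<in> N s i d" for a x s i d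
  proof -
    consider "Suc i \<le> s" | "i = s" | "i > s" by linarith
    then show ?thesis
    proof cases
      case 1
      then show ?thesis using a x bigradedD(3)[OF W] by (simp add: N_def)
    next
      case 2
      then show ?thesis using a x mul_mem[of a P x "W s d"] by (simp add: N_def R.ideal_pow_1[OF P])
    next
      case 3
      then have "x \<in> mul (ideal_pow R P (i - s)) (W s d)" using x by (simp add: N_def)
      then have "a \<odot>\<^bsub>M\<^esub> x \<in> mul (ideal_pow R P (Suc (i - s))) (W s d)"
        unfolding mul_pow_Suc[OF P sW] by (rule mul_mem[OF a])
      then show ?thesis using 3 by (simp add: N_def Suc_diff_le less_imp_le)
    qed
  qed
  have N_inc: "N s i d \<subseteq> N (Suc s) i d" for s i d
  proof -
    consider "i \<le> s" | "i = Suc s" | "i > Suc s" by linarith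
    then show ?thesis
    proof cases
      case 1
      then show ?thesis by (simp add: N_def)
    next
      case 2
      have "mul P (W s d) \<subseteq> W (Suc s) d" by (rule mul_least[OF sW]) (rule bigradedD(3)[OF W])
      then show ?thesis using 2 by (simp add: N_def R.ideal_pow_1[OF P])
    next
      case 3
      have "mul P (W s d) \<subseteq> W (Suc s) d" by (rule mul_least[OF sW]) (rule bigradedD(3)[OF W])
      then have "mul (ideal_pow R P (i - Suc s)) (mul P (W s d)) \<subseteq> mul (ideal_pow R P (i - Suc s)) (W (Suc s) d)"
        by (rule mul_mono[OF order_refl])
      moreover have "mul (ideal_pow R P (i - Suc s)) (mul P (W s d)) = mul (ideal_pow R P (i - s)) (W s d)"
        using mul_pow_add[OF P sW, of "i - Suc s" "Suc 0" s d] 3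
        by (simp add: R.ideal_pow_1[OF P] Suc_diff_Suc)
      ultimately show ?thesis using 3 by (simp add: N_def)
    qed
  qed
  have "bigraded P J (N s)" for s
  proof (rule bigradedI)
    show "submodule (N s i d) R M" for i d by (rule sN)
    show "a \<odot>\<^bsub>M\<^esub> x \<in> N s (Suc i) d" if "a \<in> P" "x \<in> N s i d" for a x i d by (rule NP[OF that])
    fix i d
    show "N s i d \<subseteq> mul (ideal_pow R P i) (pw J d)"
    proof (cases "i \<le> s")
      case True
      then show ?thesis using bigradedD(2)[OF W] by (simp add: N_def)
    next
      case False
      have "mul (ideal_pow R P (i - s)) (W s d) \<subseteq> mul (ideal_pow R P (i - s)) (mul (ideal_pow R P s) (pw J d))"
        by (rule mul_mono[OF order_refl bigradedD(2)[OF W]])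
      also have "\<dots> = mul (ideal_pow R P i) (pw J d)"
        using mul_pow_add[OF P pw_sub[OF J], of "i - s" s] False by simp
      finally show ?thesis using False by (simp add: N_def)
    qed
  next
    fix a x i d assume a: "a \<in> J" and x: "x \<in> N s i d"
    show "a \<odot>\<^bsub>M\<^esub> x \<in> N s i (Suc d)"
    proof (cases "i \<le> s")
      case True
      then show ?thesis using a x bigradedD(4)[OF W] by (simp add: N_def)
    next
      case False
      then have "a \<odot>\<^bsub>M\<^esub> x \<in> mul J (mul (ideal_pow R P (i - s)) (W s d))"
        using mul_mem[OF a] x by (simp add: N_def)
      also have "\<dots> = mul (ideal_pow R P (i - s)) (mul J (W s d))"
        by (rule mul_commute[OF J R.ideal_pow_ideal[OF P] sW])
      also have "\<dots> \<subseteq> mul (ideal_pow R P (i - s)) (W s (Suc d))"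
        by (intro mul_mono mul_least[OF sW] order_refl) (rule bigradedD(4)[OF W])
      finally show ?thesis using False by (simp add: N_def)
    qed
  qed
  moreover have "incseq N" by (rule incseq_SucI) (simp add: le_fun_def N_inc)
  ultimately obtain c where c: "\<And>s. s \<ge> c \<Longrightarrow> N s = N c"
    using acc_onD[OF acc_bigraded[OF P J], of N] by blast
  have "W (c + i) d \<subseteq> mul (ideal_pow R P i) (W c d)" for i d
  proof -
    have "W (c + i) d = N (c + i) (c + i) d" by (simp add: N_def)
    also have "\<dots> = N c (c + i) d" by (simp add: c[of "c + i"])
    also have "\<dots> \<subseteq> mul (ideal_pow R P i) (W c d)"
      by (cases i) (simp_all add: N_def R.ideal_pow_0 mul_carrier_left[OF sW])
    finally show ?thesis .
  qed
  then show ?thesis by blast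
qed

lemma bigraded_full:
  assumes P: "ideal P R" and J: "ideal J R"
  shows "bigraded P J (\<lambda>i d. mul (ideal_pow R P i) (pw J d))"
proof (rule bigradedI)
  show "submodule (mul (ideal_pow R P i) (pw J d)) R M" for i d
    by (rule mul_pow_sub[OF P pw_sub[OF J]])
  show "a \<odot>\<^bsub>M\<^esub> x \<in> mul (ideal_pow R P (Suc i)) (pw J d)"
    if "a \<in> P" "x \<in> mul (ideal_pow R P i) (pw J d)" for a x i d
    unfolding mul_pow_Suc[OF P pw_sub[OF J]] by (rule mul_mem[OF that])
  show "a \<odot>\<^bsub>M\<^esub> x \<in> mul (ideal_pow R P i) (pw J (Suc d))"
    if "a \<in> J" "x \<in> mul (ideal_pow R P i) (pw J d)" for a x i d
    using mul_mem[OF that] unfolding pw_Suc[OF J] mul_commute[OF J R.ideal_pow_ideal[OF P] pw_sub[OF J]] .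
qed simp

text \<open>The point of working with two gradings is that the constant \<open>c\<close> serves all \<open>d\<close>
  simultaneously.\<close>

lemma uniform_artin_rees:
  assumes P: "ideal P R" and J: "ideal J R"
  shows "\<exists>c. \<forall>i d. mul (ideal_pow R P (c + i)) (pw J d) \<inter> pw J (Suc d) \<subseteq> mul (ideal_pow R P i) (pw J (Suc d))"
proof -
  note full = bigradedD[OF bigraded_full[OF P J]]
  have "bigraded P J (\<lambda>i d. mul (ideal_pow R P i) (pw J d) \<inter> pw J (Suc d))"
  proof (rule bigradedI)
    fix a x i d assume a: "a \<in> P" and x: "x \<in> mul (ideal_pow R P i) (pw J d) \<inter> pw J (Suc d)"
    then show "a \<odot>\<^bsub>M\<^esub> x \<in> mul (ideal_pow R P (Suc i)) (pw J d) \<inter> pw J (Suc d)"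
      using full(3) sub_smult[OF pw_sub[OF J] ideal.Icarr[OF P a]] by blast
  next
    fix a x i d assume a: "a \<in> J" and x: "x \<in> mul (ideal_pow R P i) (pw J d) \<inter> pw J (Suc d)"
    then have "a \<odot>\<^bsub>M\<^esub> x \<in> pw J (Suc (Suc d))" unfolding pw_Suc[OF J, of "Suc d"] using mul_mem by blast
    then show "a \<odot>\<^bsub>M\<^esub> x \<in> mul (ideal_pow R P i) (pw J (Suc d)) \<inter> pw J (Suc (Suc d))"
      using full(4) a x by blast
  qed (use submodule_Int[OF full(1) pw_sub[OF J]] in blast)+
  from artin_rees_bigraded[OF P J this] obtain c where c: "\<And>i d. mul (ideal_pow R P (c + i)) (pw J d) \<inter> pw J (Suc d)
     \<subseteq> mul (ideal_pow R P i) (mul (ideal_pow R P c) (pw J d) \<inter> pw J (Suc d))" by blast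
  have "mul (ideal_pow R P i) (mul (ideal_pow R P c) (pw J d) \<inter> pw J (Suc d)) \<subseteq> mul (ideal_pow R P i) (pw J (Suc d))" for i d
    by (rule mul_mono) auto
  with c show ?thesis by (meson order_trans)
qed

text \<open>Artin--Rees for the family \<open>P\<^sup>i J\<^sup>d M \<inter> (J\<^sup>d\<^sup>+\<^sup>1 M : P)\<close>: beyond degree \<open>c\<close> its components lie
  in \<open>P (J\<^sup>d\<^sup>+\<^sup>1 M : P)\<close> and hence in \<open>J\<^sup>d\<^sup>+\<^sup>1 M\<close>.\<close>

lemma uniform_artin_rees_colon:
  assumes P: "ideal P R" and J: "ideal J R"
  shows "\<exists>c. \<forall>d. mul (ideal_pow R P c) (pw J d) \<inter> colon_mod M (pw J (Suc d)) P \<subseteq> pw J (Suc d)"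
proof -
  note full = bigradedD[OF bigraded_full[OF P J]]
  note Pc = ideal_subset_carrier[OF P]
  note colon = submodule_colon_mod[OF pw_sub[OF J] Pc]
  have "bigraded P J (\<lambda>i d. mul (ideal_pow R P i) (pw J d) \<inter> colon_mod M (pw J (Suc d)) P)"
  proof (rule bigradedI)
    fix a x i d assume a: "a \<in> P" and x: "x \<in> mul (ideal_pow R P i) (pw J d) \<inter> colon_mod M (pw J (Suc d)) P"
    then show "a \<odot>\<^bsub>M\<^esub> x \<in> mul (ideal_pow R P (Suc i)) (pw J d) \<inter> colon_mod M (pw J (Suc d)) P"
      using full(3) sub_smult[OF colon ideal.Icarr[OF P a]] by blast
  next
    fix a x i d assume a: "a \<in> J" and x: "x \<in> mul (ideal_pow R P i) (pw J d) \<inter> colon_mod M (pw J (Suc d)) P"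
    have xM: "x \<in> carrier M" using x unfolding colon_mod_def by blast
    have aR: "a \<in> carrier R" by (rule ideal.Icarr[OF J a])
    have "b \<odot>\<^bsub>M\<^esub> (a \<odot>\<^bsub>M\<^esub> x) \<in> pw J (Suc (Suc d))" if "b \<in> P" for b
    proof -
      have "b \<odot>\<^bsub>M\<^esub> x \<in> pw J (Suc d)" using x that unfolding colon_mod_def by blast
      then have "a \<odot>\<^bsub>M\<^esub> (b \<odot>\<^bsub>M\<^esub> x) \<in> pw J (Suc (Suc d))"
        unfolding pw_Suc[OF J, of "Suc d"] using mul_mem a by blast
      then show ?thesis using smult_left_commute[OF aR _ xM, of b] that Pc by auto
    qed
    then have "a \<odot>\<^bsub>M\<^esub> x \<in> colon_mod M (pw J (Suc (Suc d))) P" using aR xM unfolding colon_mod_def by blast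
    then show "a \<odot>\<^bsub>M\<^esub> x \<in> mul (ideal_pow R P i) (pw J (Suc d)) \<inter> colon_mod M (pw J (Suc (Suc d))) P"
      using full(4) a x by blast
  qed (use submodule_Int[OF full(1) colon] in blast)+
  from artin_rees_bigraded[OF P J this] obtain c where c: "\<And>i d. mul (ideal_pow R P (c + i)) (pw J d) \<inter> colon_mod M (pw J (Suc d)) P
     \<subseteq> mul (ideal_pow R P i) (mul (ideal_pow R P c) (pw J d) \<inter> colon_mod M (pw J (Suc d)) P)" by blast
  have "mul (ideal_pow R P (c + 1)) (pw J d) \<inter> colon_mod M (pw J (Suc d)) P \<subseteq> pw J (Suc d)" for d
  proof -
    have "mul (ideal_pow R P 1) (mul (ideal_pow R P c) (pw J d) \<inter> colon_mod M (pw J (Suc d)) P) \<subseteq> pw J (Suc d)"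
      unfolding One_nat_def R.ideal_pow_1[OF P]
      by (rule mul_least[OF pw_sub[OF J]]) (auto simp: colon_mod_def)
    with c[of 1 d] show ?thesis by blast
  qed
  then show ?thesis by blast
qed

end

section \<open>Associated primes\<close>

context module
begin

text \<open>\<open>ann N x\<close> is the annihilator of the class of \<open>x\<close> in \<open>M / N\<close>.\<close>

definition ann :: "'c set \<Rightarrow> 'c \<Rightarrow> 'a set"
  where "ann N x = {r \<in> carrier R. r \<odot>\<^bsub>M\<^esub> x \<in> N}"

definition assoc_primes :: "'c set \<Rightarrow> 'a set set"
  where "assoc_primes N = {P. primeideal P R \<and> (\<exists>x\<in>carrier M. P = ann N x)}"

lemma ann_ideal: "submodule N R M \<Longrightarrow> x \<in> carrier M \<Longrightarrow> ideal (ann N x) R"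
  using ideal_multiplier[of N "{x}"] by (simp add: ann_def)

lemma ann_eq_carrier: "submodule N R M \<Longrightarrow> x \<in> N \<Longrightarrow> ann N x = carrier R"
  unfolding ann_def using sub_smult by blast

lemma ann_not_carrier: "x \<in> carrier M \<Longrightarrow> x \<notin> N \<Longrightarrow> ann N x \<noteq> carrier R"
  unfolding ann_def using R.one_closed smult_one by force

lemma ann_prime_notin: "submodule N R M \<Longrightarrow> primeideal (ann N x) R \<Longrightarrow> x \<notin> N"
  using ann_eq_carrier primeideal.I_notcarr by blast

lemma ann_add_left:
  assumes N: "submodule N R M" and n: "n \<in> N" and x: "x \<in> carrier M"
  shows "ann N (n \<oplus>\<^bsub>M\<^esub> x) = ann N x"
proof -
  have "r \<odot>\<^bsub>M\<^esub> (n \<oplus>\<^bsub>M\<^esub> x) \<in> N \<longleftrightarrow> r \<odot>\<^bsub>M\<^esub> x \<in> N" if r: "r \<in> carrier R" for r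
  proof -
    have rn: "r \<odot>\<^bsub>M\<^esub> n \<in> N" by (rule sub_smult[OF N r n])
    have "r \<odot>\<^bsub>M\<^esub> (n \<oplus>\<^bsub>M\<^esub> x) = r \<odot>\<^bsub>M\<^esub> n \<oplus>\<^bsub>M\<^esub> r \<odot>\<^bsub>M\<^esub> x"
      using r x sub_carr[OF N n] by (simp add: smult_r_distr)
    then show ?thesis
      using sub_cancel[OF N _ rn sub_carr[OF N rn] smult_closed[OF r x]] sub_add[OF N rn] by auto
  qed
  then show ?thesis unfolding ann_def by blast
qed

lemma ann_smult_prime:
  assumes P: "primeideal (ann N x) R" and x: "x \<in> carrier M" and r: "r \<in> carrier R" "r \<notin> ann N x"
    and N: "submodule N R M"
  shows "ann N (r \<odot>\<^bsub>M\<^esub> x) = ann N x"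
proof -
  have "s \<odot>\<^bsub>M\<^esub> (r \<odot>\<^bsub>M\<^esub> x) \<in> N \<longleftrightarrow> s \<odot>\<^bsub>M\<^esub> x \<in> N" if s: "s \<in> carrier R" for s
  proof
    assume "s \<odot>\<^bsub>M\<^esub> (r \<odot>\<^bsub>M\<^esub> x) \<in> N"
    then have "s \<otimes> r \<in> ann N x" using s r x by (simp add: ann_def smult_assoc1)
    then have "s \<in> ann N x" using primeideal.I_prime[OF P s r(1)] r(2) by blast
    then show "s \<odot>\<^bsub>M\<^esub> x \<in> N" by (simp add: ann_def)
  next
    assume "s \<odot>\<^bsub>M\<^esub> x \<in> N"
    then show "s \<odot>\<^bsub>M\<^esub> (r \<odot>\<^bsub>M\<^esub> x) \<in> N"
      using sub_smult[OF N r(1)] smult_left_commute[OF s r(1) x] by simp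
  qed
  then show ?thesis unfolding ann_def by blast
qed

lemma maximal_ann_prime:
  assumes N: "submodule N R M" and y: "y \<in> carrier M" "y \<notin> N"
    and max: "\<And>s. s \<in> carrier R \<Longrightarrow> s \<odot>\<^bsub>M\<^esub> y \<notin> N \<Longrightarrow> ann N (s \<odot>\<^bsub>M\<^esub> y) = ann N y"
  shows "primeideal (ann N y) R"
proof (rule primeidealI[OF ann_ideal[OF N y(1)] R.is_cring])
  show "carrier R \<noteq> ann N y" using ann_not_carrier[OF y] by simp
  fix a b assume ab: "a \<in> carrier R" "b \<in> carrier R" "a \<otimes> b \<in> ann N y"
  show "a \<in> ann N y \<or> b \<in> ann N y"
  proof (cases "b \<odot>\<^bsub>M\<^esub> y \<in> N")
    case True
    then show ?thesis using ab by (simp add: ann_def)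
  next
    case False
    have "a \<in> ann N (b \<odot>\<^bsub>M\<^esub> y)" using ab y(1) by (simp add: ann_def smult_assoc1)
    then show ?thesis using max[OF ab(2) False] by simp
  qed
qed

end

text \<open>Otherwise each \<open>K f\<close> has an element outside \<open>P\<close>, and the product of these elements lies in the
  intersection but not in the prime \<open>P\<close>.\<close>

lemma (in cring) prime_eq_of_finite_Inter:
  assumes P: "primeideal P R" and "finite F"
    and K: "\<And>f. f \<in> F \<Longrightarrow> ideal (K f) R" "\<And>f. f \<in> F \<Longrightarrow> P \<subseteq> K f"
    and Int: "\<And>a. a \<in> carrier R \<Longrightarrow> (\<And>f. f \<in> F \<Longrightarrow> a \<in> K f) \<Longrightarrow> a \<in> P"
  shows "\<exists>f\<in>F. K f = P"
proof (rule ccontr)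
  assume "\<not> ?thesis"
  then have ex: "\<exists>a. a \<in> K f \<and> a \<notin> P" if "f \<in> F" for f using K(2)[OF that] that by blast
  have "\<exists>a. a \<in> carrier R \<and> a \<notin> P \<and> (\<forall>f\<in>F. a \<in> K f)"
    using \<open>finite F\<close> K(1) ex
  proof (induction F)
    case empty
    then show ?case using primeideal.I_notcarr[OF P] ideal.Icarr[OF primeideal.axioms(1)[OF P]] by blast
  next
    case (insert f F)
    then obtain a where a: "a \<in> carrier R" "a \<notin> P" "\<And>f. f \<in> F \<Longrightarrow> a \<in> K f" by auto
    obtain b where b: "b \<in> K f" "b \<notin> P" using insert.prems(2)[of f] by blast
    have bR: "b \<in> carrier R" using ideal.Icarr[OF insert.prems(1)[of f]] b(1) by simp
    have "a \<otimes> b \<notin> P" using primeideal.I_prime[OF P a(1) bR] a(2) b(2) by blast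
    moreover have "a \<otimes> b \<in> K f" using ideal.I_l_closed[OF insert.prems(1)[of f] b(1) a(1)] by simp
    moreover have "a \<otimes> b \<in> K g" if "g \<in> F" for g
      using ideal.I_r_closed[OF insert.prems(1)[of g] a(3)[OF that] bR] that by simp
    ultimately show ?case using a(1) bR by (intro exI[of _ "a \<otimes> b"]) auto
  qed
  then show False using Int by blast
qed

lemma (in cring) prime_pow_mem:
  assumes P: "primeideal P R" and a: "a \<in> carrier R" "a [^] (m::nat) \<in> P"
  shows "a \<in> P"
  using a(2)
proof (induction m)
  case 0
  then have "\<one> \<in> P" by simp
  then have "P = carrier R" by (rule ideal.one_imp_carrier[OF primeideal.axioms(1)[OF P]])
  then show ?case using primeideal.I_notcarr[OF P] by simp
next
  case (Suc m)
  then show ?case using primeideal.I_prime[OF P nat_pow_closed[OF a(1), of m] a(1)] by auto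
qed

context fg_module_noetherian_ring
begin

text \<open>Among the annihilators modulo \<open>N\<close> of the multiples of \<open>y\<close> outside \<open>N\<close> there is a maximal one, and
  it is prime.\<close>

lemma exists_assoc_prime:
  assumes N: "submodule N R M" and y: "y \<in> carrier M" "y \<notin> N"
  shows "\<exists>s\<in>carrier R. primeideal (ann N (s \<odot>\<^bsub>M\<^esub> y)) R"
proof -
  define Z where "Z = {ann N (s \<odot>\<^bsub>M\<^esub> y) | s. s \<in> carrier R \<and> s \<odot>\<^bsub>M\<^esub> y \<notin> N}"
  have "Z \<subseteq> {J. ideal J R}" unfolding Z_def using ann_ideal[OF N] y by auto
  moreover have "ann N (\<one> \<odot>\<^bsub>M\<^esub> y) \<in> Z"
    unfolding Z_def using y by (intro CollectI exI[of _ \<one>]) simp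
  ultimately obtain P where P: "P \<in> Z" "\<And>K. K \<in> Z \<Longrightarrow> P \<subseteq> K \<Longrightarrow> K = P"
    using acc_on_maximal[OF acc_ideals] by metis
  then obtain s where s: "s \<in> carrier R" "s \<odot>\<^bsub>M\<^esub> y \<notin> N" "P = ann N (s \<odot>\<^bsub>M\<^esub> y)" unfolding Z_def by blast
  have "primeideal (ann N (s \<odot>\<^bsub>M\<^esub> y)) R"
  proof (rule maximal_ann_prime[OF N _ s(2)])
    show "s \<odot>\<^bsub>M\<^esub> y \<in> carrier M" using s y by simp
    fix t assume t: "t \<in> carrier R" "t \<odot>\<^bsub>M\<^esub> (s \<odot>\<^bsub>M\<^esub> y) \<notin> N"
    have "t \<odot>\<^bsub>M\<^esub> (s \<odot>\<^bsub>M\<^esub> y) = (t \<otimes> s) \<odot>\<^bsub>M\<^esub> y" using t s y by (simp add: smult_assoc1)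
    then have "ann N (t \<odot>\<^bsub>M\<^esub> (s \<odot>\<^bsub>M\<^esub> y)) \<in> Z"
      unfolding Z_def using t s by (intro CollectI exI[of _ "t \<otimes> s"]) simp
    moreover have "P \<subseteq> ann N (t \<odot>\<^bsub>M\<^esub> (s \<odot>\<^bsub>M\<^esub> y))"
    proof
      fix r assume "r \<in> P"
      then have r: "r \<in> carrier R" "r \<odot>\<^bsub>M\<^esub> (s \<odot>\<^bsub>M\<^esub> y) \<in> N" using s(3) by (auto simp: ann_def)
      then show "r \<in> ann N (t \<odot>\<^bsub>M\<^esub> (s \<odot>\<^bsub>M\<^esub> y))"
        using sub_smult[OF N t(1) r(2)] smult_left_commute[OF r(1) t(1), of "s \<odot>\<^bsub>M\<^esub> y"] s y by (simp add: ann_def)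
    qed
    ultimately show "ann N (t \<odot>\<^bsub>M\<^esub> (s \<odot>\<^bsub>M\<^esub> y)) = ann N (s \<odot>\<^bsub>M\<^esub> y)" using P(2) s(3) by simp
  qed
  then show ?thesis using s(1) by blast
qed

text \<open>For \<open>N = pw J\<close> these are the prime annihilators in \<open>R\<close> of homogeneous elements of the associated
  graded module \<open>\<Oplus>\<^sub>d J\<^sup>d M / J\<^sup>d\<^sup>+\<^sup>1 M\<close>; a general \<open>N\<close> restricts to the elements of a graded
  submodule, which permits Noetherian induction.\<close>

definition gr_primes :: "'a set \<Rightarrow> (nat \<Rightarrow> 'b set) \<Rightarrow> 'a set set"
  where "gr_primes J N = {P. primeideal P R \<and> (\<exists>d. \<exists>z\<in>N d. P = ann (pw J (Suc d)) z)}"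

text \<open>Noetherian induction on graded submodules \<open>N\<close> of the associated graded module with finite \<open>gr_primes J N\<close>.
  If \<open>N\<close> is maximal among them but proper, choose a homogeneous \<open>y\<close> outside \<open>N\<close> whose
  annihilator modulo \<open>N\<close> is as large as possible. Every multiple \<open>b y\<close> outside \<open>N\<close> has the
  same annihilator modulo \<open>N\<close>, so adjoining \<open>y\<close> to \<open>N\<close> yields at most one new prime.\<close>

lemma finite_gr_primes:
  assumes J: "ideal J R"
  shows "finite (gr_primes J (pw J))"
proof -
  define C where "C = {N. \<forall>d. submodule (N d) R M \<and> N d \<subseteq> pw J d \<and> (\<forall>a\<in>J. \<forall>x\<in>N d. a \<odot>\<^bsub>M\<^esub> x \<in> N (Suc d))}"
  define Z where "Z = {N \<in> C. (\<forall>d. pw J (Suc d) \<subseteq> N d) \<and> finite (gr_primes J N)}"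
  note spw = pw_sub[OF J]
  have init: "(\<lambda>d. pw J (Suc d)) \<in> Z"
  proof -
    have "gr_primes J (\<lambda>d. pw J (Suc d)) = {}"
      unfolding gr_primes_def using ann_prime_notin[OF spw] by blast
    moreover have "a \<odot>\<^bsub>M\<^esub> x \<in> pw J (Suc (Suc d))" if "a \<in> J" "x \<in> pw J (Suc d)" for a x d
      unfolding pw_Suc[OF J, of "Suc d"] by (rule mul_mem[OF that])
    ultimately show ?thesis unfolding Z_def C_def using spw pw_anti[OF J] by auto
  qed
  have acc: "acc_on C" unfolding C_def by (rule acc_graded[OF J])
  have "Z \<subseteq> C" unfolding Z_def by auto
  from acc_on_maximal[OF acc this init]
  obtain N where N: "N \<in> Z" and max: "\<And>N'. N' \<in> Z \<Longrightarrow> N \<le> N' \<Longrightarrow> N' = N"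
    by blast
  have sN: "submodule (N d) R M" and N_le: "N d \<subseteq> pw J d" and N_ge: "pw J (Suc d) \<subseteq> N d"
    and NJ: "\<And>a x. a \<in> J \<Longrightarrow> x \<in> N d \<Longrightarrow> a \<odot>\<^bsub>M\<^esub> x \<in> N (Suc d)" for d
    using N unfolding Z_def C_def by blast+
  have fin: "finite (gr_primes J N)" using N unfolding Z_def by blast
  have NJpow: "a \<odot>\<^bsub>M\<^esub> x \<in> N (d + m)" if "a \<in> ideal_pow R J m" "x \<in> N d" for a x d m
  proof -
    have "mul (ideal_pow R J m) (N d) \<subseteq> N (d + m)"
    proof (induction m)
      case 0
      show ?case by (simp only: R.ideal_pow_0 mul_carrier_left[OF sN]) simp
    next
      case (Suc m)
      show ?case unfolding mul_pow_Suc[OF J sN] by (rule mul_least[OF sN]) (use Suc NJ in auto)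
    qed
    then show ?thesis using mul_mem[OF that] by blast
  qed
  have "pw J d \<subseteq> N d" for d
  proof (rule ccontr)
    assume "\<not> pw J d \<subseteq> N d"
    then obtain y0 where y0: "y0 \<in> pw J d" "y0 \<notin> N d" by blast
    define A where "A = {ann (N e) y | e y. y \<in> pw J e \<and> y \<notin> N e}"
    have "A \<subseteq> {K. ideal K R}" unfolding A_def using ann_ideal[OF sN] sub_carr[OF spw] by blast
    moreover have "ann (N d) y0 \<in> A" unfolding A_def using y0 by blast
    ultimately obtain P where P: "P \<in> A" "\<And>K. K \<in> A \<Longrightarrow> P \<subseteq> K \<Longrightarrow> K = P"
      using acc_on_maximal[OF acc_ideals] by metis
    then obtain d y where y: "y \<in> pw J d" "y \<notin> N d" "P = ann (N d) y" unfolding A_def by blast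
    have yM: "y \<in> carrier M" by (rule sub_carr[OF spw y(1)])
    define D where "D e = (\<lambda>r. r \<odot>\<^bsub>M\<^esub> y) ` ideal_pow R J (e - d)" for e
    have sD: "submodule (D e) R M" for e
      unfolding D_def by (rule submodule_cyclic_image[OF R.ideal_pow_ideal[OF J] yM])
    define N' where "N' e = (if d \<le> e then N e <+>\<^bsub>M\<^esub> D e else N e)" for e
    have N_N': "N e \<subseteq> N' e" for e
      unfolding N'_def using set_add_left[OF sD submoduleE(1)[OF sN]] by simp
    have sN': "submodule (N' e) R M" for e
      unfolding N'_def using submodule_set_add[OF sN sD] sN by simp
    have N'_le: "N' e \<subseteq> pw J e" for e
    proof (cases "d \<le> e")
      case True
      have "D e \<subseteq> pw J e"
        unfolding D_def using pw_smult[OF J _ y(1), of _ "e - d"] True by auto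
      then show ?thesis using set_add_least[OF spw N_le[of e]] True unfolding N'_def by simp
    qed (simp add: N'_def N_le)
    have N'J: "a \<odot>\<^bsub>M\<^esub> x \<in> N' (Suc e)" if a: "a \<in> J" and x: "x \<in> N' e" for a x e
    proof (cases "d \<le> e")
      case True
      then obtain n b where nb: "n \<in> N e" "b \<in> ideal_pow R J (e - d)" "x = n \<oplus>\<^bsub>M\<^esub> b \<odot>\<^bsub>M\<^esub> y"
        using x unfolding N'_def D_def set_add_def' by auto
      have aR: "a \<in> carrier R" and bR: "b \<in> carrier R"
        using ideal.Icarr[OF J a] nb(2) R.ideal_pow_carr[OF J] by auto
      have "b \<otimes> a \<in> ideal_pow R J (Suc (e - d))"
        unfolding R.ideal_pow_Suc by (rule ideal_prod.prod[OF nb(2) a])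
      then have "(b \<otimes> a) \<odot>\<^bsub>M\<^esub> y \<in> D (Suc e)" unfolding D_def using True by (simp add: Suc_diff_le)
      moreover have "a \<odot>\<^bsub>M\<^esub> x = a \<odot>\<^bsub>M\<^esub> n \<oplus>\<^bsub>M\<^esub> (b \<otimes> a) \<odot>\<^bsub>M\<^esub> y"
        using nb aR bR yM sub_carr[OF sN nb(1)] by (simp add: smult_r_distr R.m_comm smult_assoc1[symmetric])
      ultimately have "a \<odot>\<^bsub>M\<^esub> x \<in> N (Suc e) <+>\<^bsub>M\<^esub> D (Suc e)"
        using NJ[OF a nb(1)] unfolding set_add_def' by blast
      then show ?thesis unfolding N'_def using True by simp
    next
      case False
      then have "x \<in> N e" using x by (simp add: N'_def)
      then show ?thesis using NJ[OF a] N_N' by blast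
    qed
    have "gr_primes J N' \<subseteq> insert P (gr_primes J N)"
    proof
      fix Q assume "Q \<in> gr_primes J N'"
      then obtain e z where Q: "primeideal Q R" "z \<in> N' e" "Q = ann (pw J (Suc e)) z"
        unfolding gr_primes_def by blast
      have zM: "z \<in> carrier M" by (rule sub_carr[OF sN' Q(2)])
      show "Q \<in> insert P (gr_primes J N)"
      proof (cases "\<exists>r\<in>carrier R. r \<odot>\<^bsub>M\<^esub> z \<in> N e \<and> r \<odot>\<^bsub>M\<^esub> z \<notin> pw J (Suc e)")
        case True
        then obtain r where r: "r \<in> carrier R" "r \<odot>\<^bsub>M\<^esub> z \<in> N e" "r \<odot>\<^bsub>M\<^esub> z \<notin> pw J (Suc e)" by blast
        then have "ann (pw J (Suc e)) (r \<odot>\<^bsub>M\<^esub> z) = Q"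
          using ann_smult_prime[OF _ zM r(1) _ spw, of "Suc e"] Q by (auto simp: ann_def)
        then show ?thesis using Q(1) r(2) unfolding gr_primes_def by blast
      next
        case False
        then have Qz: "ann (N e) z = Q" unfolding Q(3) ann_def using N_ge[of e] by blast
        then have "z \<notin> N e" using ann_prime_notin[OF sN, of e z] Q(1) by simp
        then have de: "d \<le> e" using Q(2) unfolding N'_def by (auto split: if_splits)
        then obtain n b where nb: "n \<in> N e" "b \<in> ideal_pow R J (e - d)" "z = n \<oplus>\<^bsub>M\<^esub> b \<odot>\<^bsub>M\<^esub> y"
          using Q(2) unfolding N'_def D_def set_add_def' by auto
        have bR: "b \<in> carrier R" using nb(2) R.ideal_pow_carr[OF J] by auto
        have by_Q: "ann (N e) (b \<odot>\<^bsub>M\<^esub> y) = Q"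
          using ann_add_left[OF sN nb(1) smult_closed[OF bR yM]] bR yM Qz nb(3) by simp
        have "b \<odot>\<^bsub>M\<^esub> y \<notin> N e" using ann_prime_notin[OF sN, of e "b \<odot>\<^bsub>M\<^esub> y"] Q(1) by_Q by simp
        moreover have "b \<odot>\<^bsub>M\<^esub> y \<in> pw J e" using pw_smult[OF J nb(2) y(1)] de by simp
        ultimately have "Q \<in> A" unfolding A_def using by_Q by blast
        moreover have "P \<subseteq> Q"
        proof
          fix r assume "r \<in> P"
          then have r: "r \<in> carrier R" "r \<odot>\<^bsub>M\<^esub> y \<in> N d" using y(3) by (auto simp: ann_def)
          have "b \<odot>\<^bsub>M\<^esub> (r \<odot>\<^bsub>M\<^esub> y) \<in> N e" using NJpow[OF nb(2) r(2)] de by simp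
          then show "r \<in> Q" using r(1) smult_left_commute[OF r(1) bR yM] by (simp add: by_Q[symmetric] ann_def)
        qed
        ultimately show ?thesis using P(2) by blast
      qed
    qed
    then have "finite (gr_primes J N')" using fin by (meson finite_insert finite_subset)
    then have "N' \<in> Z" unfolding Z_def C_def using sN' N'_le N'J N_ge N_N' by blast
    then have "N' = N" using max N_N' by (simp add: le_fun_def)
    moreover have "y \<in> N' d"
    proof -
      have "\<zero>\<^bsub>M\<^esub> \<oplus>\<^bsub>M\<^esub> \<one> \<odot>\<^bsub>M\<^esub> y \<in> N d <+>\<^bsub>M\<^esub> D d"
        unfolding set_add_def' D_def diff_self_eq_0 R.ideal_pow_0 using sub_zero[OF sN] by blast
      then show ?thesis unfolding N'_def using yM by simp
    qed
    ultimately show False using y(2) by simp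
  qed
  then have "N = pw J" using N_le by (intro ext) blast
  then show ?thesis using fin by simp
qed

text \<open>An element of \<open>J\<^sup>d M\<close> with prime annihilator \<open>P\<close> modulo \<open>J\<^sup>d\<^sup>+\<^sup>n M\<close> either has annihilator \<open>P\<close>
  already modulo \<open>J\<^sup>d\<^sup>+\<^sup>1 M\<close>, or a multiple of it with the same annihilator \<open>P\<close> lies in \<open>J\<^sup>d\<^sup>+\<^sup>1 M\<close>.\<close>

lemma gr_prime_of_quotient:
  assumes J: "ideal J R" and "z \<in> pw J d" "primeideal (ann (pw J (d + n)) z) R"
  shows "ann (pw J (d + n)) z \<in> gr_primes J (pw J)"
  using assms(2,3)
proof (induction n arbitrary: d z)
  case 0
  then show ?case using ann_prime_notin[OF pw_sub[OF J]] by fastforce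
next
  case (Suc n)
  have zM: "z \<in> carrier M" by (rule sub_carr[OF pw_sub[OF J] Suc.prems(1)])
  show ?case
  proof (cases "\<exists>r\<in>carrier R. r \<odot>\<^bsub>M\<^esub> z \<in> pw J (Suc d) \<and> r \<odot>\<^bsub>M\<^esub> z \<notin> pw J (d + Suc n)")
    case True
    then obtain r where r: "r \<in> carrier R" "r \<odot>\<^bsub>M\<^esub> z \<in> pw J (Suc d)" "r \<odot>\<^bsub>M\<^esub> z \<notin> pw J (d + Suc n)" by blast
    have *: "ann (pw J (d + Suc n)) (r \<odot>\<^bsub>M\<^esub> z) = ann (pw J (d + Suc n)) z"
      by (rule ann_smult_prime[OF Suc.prems(2) zM r(1) _ pw_sub[OF J]]) (use r(3) in \<open>simp add: ann_def\<close>)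
    show ?thesis using Suc.IH[OF r(2)] Suc.prems(2) * by simp
  next
    case False
    then have "ann (pw J (Suc d)) z = ann (pw J (d + Suc n)) z"
      unfolding ann_def using pw_anti[OF J, of "Suc d" "d + Suc n"] by auto
    then have eq: "ann (pw J (d + Suc n)) z = ann (pw J (Suc d)) z" by (rule sym)
    show ?thesis using Suc.prems unfolding eq gr_primes_def by blast
  qed
qed

end

section \<open>Ratliff--Rush closures\<close>

context module
begin

text \<open>The submodules \<open>(J\<^sup>s\<^sup>+\<^sup>n M : J\<^sup>s)\<close> increase with \<open>s\<close>, and the Ratliff--Rush closure of \<open>J\<^sup>n\<close> is
  their union: its definition only runs through the cofinal values \<open>s = n k\<close>.\<close>

definition rr_stage :: "'a set \<Rightarrow> nat \<Rightarrow> nat \<Rightarrow> 'c set"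
  where "rr_stage J n s = colon_mod M (pw J (s + n)) (ideal_pow R J s)"

lemma rr_stage_iff:
  "x \<in> rr_stage J n s \<longleftrightarrow> x \<in> carrier M \<and> (\<forall>a\<in>ideal_pow R J s. a \<odot>\<^bsub>M\<^esub> x \<in> pw J (s + n))"
  by (simp add: rr_stage_def colon_mod_def)

lemma submodule_rr_stage: "ideal J R \<Longrightarrow> submodule (rr_stage J n s) R M"
  unfolding rr_stage_def by (rule submodule_colon_mod[OF pw_sub R.ideal_pow_carr])

lemma pow_smult_shift:
  assumes J: "ideal J R" and x: "x \<in> carrier M" "\<And>a. a \<in> ideal_pow R J m \<Longrightarrow> a \<odot>\<^bsub>M\<^esub> x \<in> pw J s"
    and a: "a \<in> ideal_pow R J (q + m)"
  shows "a \<odot>\<^bsub>M\<^esub> x \<in> pw J (q + s)"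
proof -
  let ?H = "{a \<in> carrier R. \<forall>y\<in>{x}. a \<odot>\<^bsub>M\<^esub> y \<in> pw J (q + s)}"
  have H: "ideal ?H R" by (rule ideal_multiplier[OF pw_sub[OF J]]) (use x in simp)
  have "a \<in> ideal_pow R J q \<cdot> ideal_pow R J m" using a unfolding R.ideal_pow_add[OF J] .
  then have "a \<in> ?H"
  proof induction
    case (prod b c)
    have "b \<in> carrier R" "c \<in> carrier R" using prod R.ideal_pow_carr[OF J] by auto
    then show ?case using pw_smult[OF J prod(1) x(2)[OF prod(2)]] x(1) by (simp add: smult_assoc1)
  next
    case (sum b c)
    from sum.IH show ?case by (rule additive_subgroup.a_closed[OF ideal.axioms(1)[OF H]])
  qed
  then show ?thesis by simp
qed

lemma rr_stage_Suc: "ideal J R \<Longrightarrow> rr_stage J n s \<subseteq> rr_stage J n (Suc s)"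
  using pow_smult_shift[of J _ s "s + n" _ 1] by (auto simp: rr_stage_iff)

lemma rr_stage_incseq: "ideal J R \<Longrightarrow> incseq (rr_stage J n)"
  by (rule incseq_SucI) (rule rr_stage_Suc)

lemma ratliff_rush_pow_eq:
  assumes J: "ideal J R" and n: "n \<ge> 1"
  shows "ratliff_rush R M (ideal_pow R J n) = (\<Union>s. rr_stage J n s)"
proof -
  have "ratliff_rush R M (ideal_pow R J n) = (\<Union>k. rr_stage J n (n * k))"
    unfolding ratliff_rush_def rr_stage_def ideal_smult_eq R.ideal_pow_pow[OF J]
    by (simp add: algebra_simps)
  also have "\<dots> = (\<Union>s. rr_stage J n s)"
  proof (rule antisym)
    have "rr_stage J n s \<subseteq> rr_stage J n (n * s)" for s
      by (rule incseqD[OF rr_stage_incseq[OF J]]) (use n in simp)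
    then show "(\<Union>s. rr_stage J n s) \<subseteq> (\<Union>k. rr_stage J n (n * k))" by blast
  qed blast
  finally show ?thesis .
qed

lemma submodule_ratliff_rush:
  assumes "ideal J R" "n \<ge> 1"
  shows "submodule (ratliff_rush R M (ideal_pow R J n)) R M"
  unfolding ratliff_rush_pow_eq[OF assms]
  by (rule submodule_Un_chain[OF submodule_rr_stage[OF assms(1)] rr_stage_incseq[OF assms(1)]])

end

context fg_module_noetherian_ring
begin

text \<open>For fixed \<open>s\<close> the components \<open>{x \<in> J\<^sup>d M. J\<^sup>s x \<subseteq> J\<^sup>s\<^sup>+\<^sup>n\<^sup>+\<^sup>d M}\<close> form a graded family, so one \<open>c\<close>
  works for all \<open>d\<close>. The case \<open>d = 0\<close> concerns the Ratliff--Rush closure itself, the other degrees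
  are needed for the Rees module.\<close>

lemma rr_stage_stabilises:
  assumes J: "ideal J R"
  shows "\<exists>c. \<forall>s\<ge>c. \<forall>d. pw J d \<inter> rr_stage J (n + d) s = pw J d \<inter> rr_stage J (n + d) c"
proof -
  let ?N = "\<lambda>s d. pw J d \<inter> rr_stage J (n + d) s"
  let ?C = "{N. \<forall>d. submodule (N d) R M \<and> N d \<subseteq> pw J d \<and> (\<forall>a\<in>J. \<forall>x\<in>N d. a \<odot>\<^bsub>M\<^esub> x \<in> N (Suc d))}"
  have "a \<odot>\<^bsub>M\<^esub> x \<in> ?N s (Suc d)" if a: "a \<in> J" and x: "x \<in> ?N s d" for a x s d
  proof -
    have aR: "a \<in> carrier R" by (rule ideal.Icarr[OF J a])
    have xM: "x \<in> carrier M" using x by (simp add: rr_stage_iff)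
    have "b \<odot>\<^bsub>M\<^esub> (a \<odot>\<^bsub>M\<^esub> x) \<in> pw J (s + (n + Suc d))" if b: "b \<in> ideal_pow R J s" for b
    proof -
      have bR: "b \<in> carrier R" using b R.ideal_pow_carr[OF J] by blast
      have "a \<odot>\<^bsub>M\<^esub> (b \<odot>\<^bsub>M\<^esub> x) \<in> pw J (Suc (s + (n + d)))"
        unfolding pw_Suc[OF J] by (rule mul_mem[OF a]) (use b x in \<open>simp add: rr_stage_iff\<close>)
      then show ?thesis using smult_left_commute[OF aR bR xM] by simp
    qed
    moreover have "a \<odot>\<^bsub>M\<^esub> x \<in> pw J (Suc d)" unfolding pw_Suc[OF J] using a x by (intro mul_mem) auto
    ultimately show ?thesis using aR xM by (simp add: rr_stage_iff)
  qed
  then have "?N s \<in> ?C" for s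
    using submodule_Int[OF pw_sub[OF J] submodule_rr_stage[OF J]] by blast
  moreover have "incseq ?N"
  proof (rule incseq_SucI, rule le_funI)
    fix s d show "?N s d \<subseteq> ?N (Suc s) d" using rr_stage_Suc[OF J, of "n + d" s] by blast
  qed
  ultimately obtain c where c: "\<And>s. s \<ge> c \<Longrightarrow> ?N s = ?N c"
    using acc_onD[OF acc_graded[OF J], of ?N] by blast
  show ?thesis
  proof (intro exI[of _ c] allI impI)
    fix s d assume "c \<le> s"
    from fun_cong[OF c[OF this]] show "?N s d = ?N c d" .
  qed
qed

lemma ratliff_rush_eq_stage:
  assumes J: "ideal J R" and n: "n \<ge> 1"
  shows "\<exists>c. ratliff_rush R M (ideal_pow R J n) = rr_stage J n c"
proof -
  obtain c where c: "\<And>s. s \<ge> c \<Longrightarrow> pw J 0 \<inter> rr_stage J (n + 0) s = pw J 0 \<inter> rr_stage J (n + 0) c"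
    using rr_stage_stabilises[OF J, of n] by blast
  have "pw J 0 \<inter> rr_stage J n s = rr_stage J n s" for s
    unfolding pw_0 by (auto simp: rr_stage_iff)
  then have eq: "rr_stage J n s = rr_stage J n c" if "s \<ge> c" for s
    using c[OF that] by simp
  have "rr_stage J n s \<subseteq> rr_stage J n c" for s
  proof (cases "s \<ge> c")
    case True
    then show ?thesis using eq by blast
  next
    case False
    then show ?thesis using incseqD[OF rr_stage_incseq[OF J]] by simp
  qed
  then have "(\<Union>s. rr_stage J n s) = rr_stage J n c" by blast
  then show ?thesis unfolding ratliff_rush_pow_eq[OF J n] by blast
qed

text \<open>The source of linear growth. Let \<open>x \<in> P\<^sup>k\<^sup>n M\<close> and \<open>P x\<close> in the closure, which is
  \<open>(J\<^sup>s\<^sup>+\<^sup>n M : J\<^sup>s)\<close> for some \<open>s\<close>. For \<open>f \<in> J\<^sup>s\<close> the element \<open>f x\<close> lies in \<open>J\<^sup>s M\<close> and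
  has to be moved up to \<open>J\<^sup>s\<^sup>+\<^sup>n M\<close>. As long as \<open>f x \<in> P\<^sup>k\<^sup>(\<^sup>n\<^sup>-\<^sup>i\<^sup>) J\<^sup>s\<^sup>+\<^sup>i M\<close> with
  \<open>i < n\<close>, the colon form of Artin--Rees puts \<open>f x\<close> into \<open>J\<^sup>s\<^sup>+\<^sup>i\<^sup>+\<^sup>1 M\<close>, and the plain form then retains all but
  \<open>k\<close> of the powers of \<open>P\<close>. So \<open>n\<close> steps cost \<open>k n\<close> powers.\<close>

lemma ratliff_rush_linear_bound:
  assumes P: "ideal P R" and J: "ideal J R"
  shows "\<exists>k. \<forall>n\<ge>1. pw P (k * n) \<inter> colon_mod M (ratliff_rush R M (ideal_pow R J n)) P
      \<subseteq> ratliff_rush R M (ideal_pow R J n)"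
proof -
  obtain c1 where c1: "\<And>i d. mul (ideal_pow R P (c1 + i)) (pw J d) \<inter> pw J (Suc d) \<subseteq> mul (ideal_pow R P i) (pw J (Suc d))"
    using uniform_artin_rees[OF P J] by blast
  obtain c2 where c2: "\<And>d. mul (ideal_pow R P c2) (pw J d) \<inter> colon_mod M (pw J (Suc d)) P \<subseteq> pw J (Suc d)"
    using uniform_artin_rees_colon[OF P J] by blast
  define k where "k = max c1 c2"
  note spw = pw_sub[OF J]
  have anti: "mul (ideal_pow R P j) (pw J d) \<subseteq> mul (ideal_pow R P i) (pw J d)" if "i \<le> j" for i j d
    by (rule mul_mono[OF R.ideal_pow_anti[OF P that] order_refl])
  show ?thesis
  proof (intro exI[of _ k] allI impI subsetI)
    fix n :: nat and x
    assume n: "n \<ge> 1"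
    assume x: "x \<in> pw P (k * n) \<inter> colon_mod M (ratliff_rush R M (ideal_pow R J n)) P"
    obtain s where s: "ratliff_rush R M (ideal_pow R J n) = rr_stage J n s"
      using ratliff_rush_eq_stage[OF J n] by blast
    have xM: "x \<in> carrier M" using x by (simp add: colon_mod_def)
    have "f \<odot>\<^bsub>M\<^esub> x \<in> pw J (s + n)" if f: "f \<in> ideal_pow R J s" for f
    proof -
      have fR: "f \<in> carrier R" using f R.ideal_pow_carr[OF J] by blast
      have colon: "f \<odot>\<^bsub>M\<^esub> x \<in> colon_mod M (pw J (Suc (s + i))) P" if "i < n" for i
      proof -
        have "p \<odot>\<^bsub>M\<^esub> (f \<odot>\<^bsub>M\<^esub> x) \<in> pw J (Suc (s + i))" if p: "p \<in> P" for p
        proof -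
          have "p \<odot>\<^bsub>M\<^esub> x \<in> rr_stage J n s" using x p s by (simp add: colon_mod_def)
          then have "f \<odot>\<^bsub>M\<^esub> (p \<odot>\<^bsub>M\<^esub> x) \<in> pw J (s + n)" using f by (simp add: rr_stage_iff)
          then have "f \<odot>\<^bsub>M\<^esub> (p \<odot>\<^bsub>M\<^esub> x) \<in> pw J (Suc (s + i))"
            using pw_anti[OF J, of "Suc (s + i)" "s + n"] \<open>i < n\<close> by auto
          then show ?thesis using smult_left_commute[OF fR ideal.Icarr[OF P p] xM] by simp
        qed
        then show ?thesis using fR xM by (simp add: colon_mod_def)
      qed
      have "f \<odot>\<^bsub>M\<^esub> x \<in> mul (ideal_pow R P (k * (n - i))) (pw J (s + i))" if "i \<le> n" for i
        using that
      proof (induction i)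
        case 0
        have "f \<odot>\<^bsub>M\<^esub> x \<in> mul (ideal_pow R J s) (pw P (k * n))" using f x by (intro mul_mem) auto
        also have "\<dots> = mul (ideal_pow R P (k * n)) (pw J s)"
          by (rule mul_commute[OF R.ideal_pow_ideal[OF J] R.ideal_pow_ideal[OF P] carrier_is_submodule])
        finally show ?case by simp
      next
        case (Suc i)
        then have IH: "f \<odot>\<^bsub>M\<^esub> x \<in> mul (ideal_pow R P (k * (n - i))) (pw J (s + i))" and i: "i < n" by auto
        have k_split: "k * (n - i) = k + k * (n - Suc i)"
          using i by (metis Suc_diff_Suc mult_Suc_right)
        have "c2 \<le> k * (n - i)" "c1 + k * (n - Suc i) \<le> k * (n - i)"
          unfolding k_split by (auto simp: k_def)
        then have "f \<odot>\<^bsub>M\<^esub> x \<in> mul (ideal_pow R P c2) (pw J (s + i))"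
          and 1: "f \<odot>\<^bsub>M\<^esub> x \<in> mul (ideal_pow R P (c1 + k * (n - Suc i))) (pw J (s + i))"
          using IH anti by blast+
        then have "f \<odot>\<^bsub>M\<^esub> x \<in> pw J (Suc (s + i))" using c2 colon[OF i] by blast
        then have "f \<odot>\<^bsub>M\<^esub> x \<in> mul (ideal_pow R P (k * (n - Suc i))) (pw J (Suc (s + i)))" using c1 1 by blast
        then show ?case by simp
      qed
      from this[of n] have "f \<odot>\<^bsub>M\<^esub> x \<in> mul (ideal_pow R P 0) (pw J (s + n))" by simp
      then show ?thesis by (simp only: R.ideal_pow_0 mul_carrier_left[OF spw])
    qed
    then show "x \<in> ratliff_rush R M (ideal_pow R J n)" using xM by (simp add: s rr_stage_iff)
  qed
qed

text \<open>If the closure is \<open>(J\<^sup>s\<^sup>+\<^sup>n M : J\<^sup>s)\<close> and \<open>J\<^sup>s\<close> is generated by \<open>f\<^sub>1, \<dots>, f\<^sub>r\<close>, the annihilator of \<open>x\<close>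
  modulo the closure is the intersection of the annihilators of the \<open>f\<^sub>i x\<close> modulo \<open>J\<^sup>s\<^sup>+\<^sup>n M\<close>. If it is prime, it
  is one of these.\<close>

lemma assoc_primes_ratliff_rush:
  assumes J: "ideal J R" and n: "n \<ge> 1"
  shows "assoc_primes (ratliff_rush R M (ideal_pow R J n)) \<subseteq> gr_primes J (pw J)"
proof
  fix P assume "P \<in> assoc_primes (ratliff_rush R M (ideal_pow R J n))"
  moreover obtain s where s: "ratliff_rush R M (ideal_pow R J n) = rr_stage J n s"
    using ratliff_rush_eq_stage[OF J n] by blast
  ultimately obtain x where P: "primeideal P R" and x: "x \<in> carrier M" "P = ann (rr_stage J n s) x"
    unfolding assoc_primes_def by auto
  note spw = pw_sub[OF J]
  obtain F where F: "F \<subseteq> carrier R" "finite F" "ideal_pow R J s = Idl F"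
    using finetely_gen[OF R.ideal_pow_ideal[OF J]] by blast
  have FJ: "F \<subseteq> ideal_pow R J s" unfolding F(3) by (rule R.genideal_self[OF F(1)])
  have swap: "r \<odot>\<^bsub>M\<^esub> (f \<odot>\<^bsub>M\<^esub> x) = f \<odot>\<^bsub>M\<^esub> (r \<odot>\<^bsub>M\<^esub> x)" if "r \<in> carrier R" "f \<in> F" for r f
    using smult_left_commute[OF that(1) _ x(1), of f] that(2) F(1) by blast
  have "\<exists>f\<in>F. ann (pw J (s + n)) (f \<odot>\<^bsub>M\<^esub> x) = P"
  proof (rule R.prime_eq_of_finite_Inter[OF P F(2)])
    fix f assume f: "f \<in> F"
    then have fR: "f \<in> carrier R" using F(1) by blast
    show "ideal (ann (pw J (s + n)) (f \<odot>\<^bsub>M\<^esub> x)) R" by (rule ann_ideal[OF spw smult_closed[OF fR x(1)]])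
    show "P \<subseteq> ann (pw J (s + n)) (f \<odot>\<^bsub>M\<^esub> x)"
      using swap[OF _ f] f FJ x(1) unfolding x(2) by (auto simp: ann_def rr_stage_iff)
  next
    fix a assume a: "a \<in> carrier R" "\<And>f. f \<in> F \<Longrightarrow> a \<in> ann (pw J (s + n)) (f \<odot>\<^bsub>M\<^esub> x)"
    let ?H = "{b \<in> carrier R. \<forall>y\<in>{a \<odot>\<^bsub>M\<^esub> x}. b \<odot>\<^bsub>M\<^esub> y \<in> pw J (s + n)}"
    have "ideal ?H R" by (rule ideal_multiplier[OF spw]) (use a x in simp)
    moreover have "F \<subseteq> ?H" using a swap F(1) by (auto simp: ann_def)
    ultimately have "ideal_pow R J s \<subseteq> ?H" unfolding F(3) by (rule R.genideal_minimal)
    then have "a \<odot>\<^bsub>M\<^esub> x \<in> rr_stage J n s" using a(1) x(1) by (auto simp: rr_stage_iff)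
    then show "a \<in> P" using a(1) by (simp add: x(2) ann_def)
  qed
  then obtain f where f: "f \<in> F" "ann (pw J (s + n)) (f \<odot>\<^bsub>M\<^esub> x) = P" by blast
  have "f \<odot>\<^bsub>M\<^esub> x \<in> pw J s" using mul_mem[of f "ideal_pow R J s" x "carrier M"] f(1) FJ x(1) by blast
  from gr_prime_of_quotient[OF J this, of n] show "P \<in> gr_primes J (pw J)" using f(2) P by simp
qed

text \<open>Krull's intersection theorem, from Artin--Rees for the family \<open>J\<^sup>i M \<inter> R x\<close>.\<close>

lemma krull_intersection:
  assumes J: "ideal J R" and x: "\<And>n. x \<in> pw J n"
  shows "\<exists>b\<in>J. x = b \<odot>\<^bsub>M\<^esub> x"
proof -
  have xM: "x \<in> carrier M" using x[of 0] unfolding pw_0 .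
  define L where "L = (\<lambda>r. r \<odot>\<^bsub>M\<^esub> x) ` carrier R"
  have sL: "submodule L R M" unfolding L_def by (rule submodule_cyclic_image[OF R.oneideal xM])
  have xL: "x \<in> L" unfolding L_def using xM by (intro image_eqI[of _ _ \<one>]) auto
  have full: "pw (carrier R) d = carrier M" for d
  proof (induction d)
    case 0
    show ?case by (rule pw_0)
  next
    case (Suc d)
    then show ?case by (simp only: pw_Suc[OF R.oneideal] mul_carrier_left[OF carrier_is_submodule])
  qed
  have "bigraded J (carrier R) (\<lambda>i d. pw J i \<inter> L)"
  proof (rule bigradedI)
    show "submodule (pw J i \<inter> L) R M" for i by (rule submodule_Int[OF pw_sub[OF J] sL])
    show "pw J i \<inter> L \<subseteq> mul (ideal_pow R J i) (pw (carrier R) d)" for i d unfolding full by blast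
    show "a \<odot>\<^bsub>M\<^esub> y \<in> pw J (Suc i) \<inter> L" if "a \<in> J" "y \<in> pw J i \<inter> L" for a y i
      unfolding pw_Suc[OF J] using that mul_mem[of a J y "pw J i"] sub_smult[OF sL ideal.Icarr[OF J that(1)]] by blast
    show "a \<odot>\<^bsub>M\<^esub> y \<in> pw J i \<inter> L" if "a \<in> carrier R" "y \<in> pw J i \<inter> L" for a y i
      using that sub_smult[OF submodule_Int[OF pw_sub[OF J] sL]] by blast
  qed
  from artin_rees_bigraded[OF J R.oneideal this] obtain c
    where c: "\<And>i. pw J (c + i) \<inter> L \<subseteq> mul (ideal_pow R J i) (pw J c \<inter> L)" by blast
  have "x \<in> mul J (pw J c \<inter> L)" using c[of "Suc 0"] x xL unfolding R.ideal_pow_1[OF J] by blast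
  also have "\<dots> \<subseteq> (\<lambda>r. r \<odot>\<^bsub>M\<^esub> x) ` J"
  proof (rule mul_least[OF submodule_cyclic_image[OF J xM]])
    fix a y assume a: "a \<in> J" and "y \<in> pw J c \<inter> L"
    then obtain r where r: "r \<in> carrier R" "y = r \<odot>\<^bsub>M\<^esub> x" unfolding L_def by blast
    have "a \<odot>\<^bsub>M\<^esub> y = (a \<otimes> r) \<odot>\<^bsub>M\<^esub> x" using r ideal.Icarr[OF J a] xM by (simp add: smult_assoc1)
    then show "a \<odot>\<^bsub>M\<^esub> y \<in> (\<lambda>r. r \<odot>\<^bsub>M\<^esub> x) ` J" using ideal.I_r_closed[OF J a r(1)] by blast
  qed
  finally show ?thesis by blast
qed

text \<open>If the closure were all of \<open>M\<close>, then \<open>J\<^sup>s M = J\<^sup>s\<^sup>+\<^sup>1 M\<close> for some \<open>s\<close>, so \<open>J\<^sup>s M\<close> lies in all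
  \<open>J\<^sup>i M\<close>. By Krull's theorem, applied to \<open>t\<^sup>s e\<close>, and by cancelling the regular element \<open>t\<^sup>s\<close>, every
  \<open>e \<in> M\<close> satisfies \<open>e = b e\<close> with \<open>b \<in> J\<close>, so that \<open>M = J M\<close>.\<close>

lemma ratliff_rush_proper:
  assumes J: "ideal J R" and n: "n \<ge> 1" and proper: "ideal_smult R M J \<noteq> carrier M"
    and t: "t \<in> J" "\<And>y. y \<in> carrier M \<Longrightarrow> t \<odot>\<^bsub>M\<^esub> y = \<zero>\<^bsub>M\<^esub> \<Longrightarrow> y = \<zero>\<^bsub>M\<^esub>"
  shows "ratliff_rush R M (ideal_pow R J n) \<noteq> carrier M"
proof
  assume all: "ratliff_rush R M (ideal_pow R J n) = carrier M"
  obtain s where "ratliff_rush R M (ideal_pow R J n) = rr_stage J n s"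
    using ratliff_rush_eq_stage[OF J n] by blast
  with all have s: "rr_stage J n s = carrier M" by simp
  have "pw J s \<subseteq> pw J (s + n)"
  proof (rule mul_least[OF pw_sub[OF J]])
    fix a x assume a: "a \<in> ideal_pow R J s" and "x \<in> carrier M"
    then have "x \<in> rr_stage J n s" by (simp only: s)
    then show "a \<odot>\<^bsub>M\<^esub> x \<in> pw J (s + n)" using a by (simp add: rr_stage_iff)
  qed
  also have "\<dots> \<subseteq> pw J (Suc s)" by (rule pw_anti[OF J]) (use n in simp)
  finally have step: "pw J s \<subseteq> pw J (Suc s)" .
  have "pw J s \<subseteq> pw J (s + i)" for i
  proof (induction i)
    case (Suc i)
    have "pw J s \<subseteq> mul J (pw J s)" using step unfolding pw_Suc[OF J] .
    also have "\<dots> \<subseteq> mul J (pw J (s + i))" by (rule mul_mono[OF order_refl Suc])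
    finally show ?case by (simp add: pw_Suc[OF J])
  qed simp
  then have deep: "pw J s \<subseteq> pw J i" for i
    using pw_anti[OF J, of i "s + i"] by (meson le_add2 order_trans)
  have tR: "t \<in> carrier R" by (rule ideal.Icarr[OF J t(1)])
  have t_pow: "y = \<zero>\<^bsub>M\<^esub>" if "y \<in> carrier M" "(t [^] m) \<odot>\<^bsub>M\<^esub> y = \<zero>\<^bsub>M\<^esub>" for y and m :: nat
    using that
  proof (induction m arbitrary: y)
    case (Suc m)
    have "(t [^] m) \<odot>\<^bsub>M\<^esub> (t \<odot>\<^bsub>M\<^esub> y) = \<zero>\<^bsub>M\<^esub>" using Suc.prems tR by (simp add: smult_assoc1)
    then have "t \<odot>\<^bsub>M\<^esub> y = \<zero>\<^bsub>M\<^esub>" using Suc.IH[of "t \<odot>\<^bsub>M\<^esub> y"] Suc.prems(1) tR by simp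
    then show ?case using t(2) Suc.prems(1) by blast
  qed simp
  have "e \<in> ideal_smult R M J" if e: "e \<in> carrier M" for e
  proof -
    let ?u = "t [^] s"
    have uR: "?u \<in> carrier R" using tR by simp
    have "?u \<odot>\<^bsub>M\<^esub> e \<in> pw J s" by (rule mul_mem[OF R.elem_pow_in_ideal_pow[OF J t(1)] e])
    then have "?u \<odot>\<^bsub>M\<^esub> e \<in> pw J i" for i using deep by blast
    then obtain b where b: "b \<in> J" "?u \<odot>\<^bsub>M\<^esub> e = b \<odot>\<^bsub>M\<^esub> (?u \<odot>\<^bsub>M\<^esub> e)" using krull_intersection[OF J] by blast
    have bR: "b \<in> carrier R" by (rule ideal.Icarr[OF J b(1)])
    have "?u \<odot>\<^bsub>M\<^esub> (e \<ominus>\<^bsub>M\<^esub> b \<odot>\<^bsub>M\<^esub> e) = ?u \<odot>\<^bsub>M\<^esub> e \<ominus>\<^bsub>M\<^esub> b \<odot>\<^bsub>M\<^esub> (?u \<odot>\<^bsub>M\<^esub> e)"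
      using uR bR e by (simp add: a_minus_def smult_r_distr smult_r_minus smult_left_commute)
    also have "\<dots> = \<zero>\<^bsub>M\<^esub>" unfolding b(2)[symmetric] using uR e by (simp add: a_minus_def M.r_neg)
    finally have "e \<ominus>\<^bsub>M\<^esub> b \<odot>\<^bsub>M\<^esub> e = \<zero>\<^bsub>M\<^esub>" using t_pow e bR by simp
    then have "e = b \<odot>\<^bsub>M\<^esub> e"
      using M.minus_equality[of e "\<ominus>\<^bsub>M\<^esub> (b \<odot>\<^bsub>M\<^esub> e)"] e bR by (simp add: M.minus_eq)
    then show ?thesis unfolding ideal_smult_eq using mul_mem[OF b(1) e] by simp
  qed
  moreover have "ideal_smult R M J \<subseteq> carrier M"
    unfolding ideal_smult_eq by (rule mul_subset[OF ideal_subset_carrier[OF J] carrier_is_submodule])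
  ultimately show False using proper by blast
qed

end

lemma (in module) regular_element_of_grade:
  assumes "grade R J M > 0"
  obtains t where "t \<in> J" "t \<in> carrier R" "\<And>y. y \<in> carrier M \<Longrightarrow> t \<odot>\<^bsub>M\<^esub> y = \<zero>\<^bsub>M\<^esub> \<Longrightarrow> y = \<zero>\<^bsub>M\<^esub>"
proof -
  obtain xs where xs: "regular_seq R M xs" "set xs \<subseteq> J" "enat (length xs) > 0"
    using assms unfolding grade_def less_Sup_iff by blast
  then have len: "0 < length xs" by (simp add: zero_enat_def)
  have I0: "ideal (Idl {}) R" by (rule R.genideal_ideal) simp
  have "Idl {} \<subseteq> {\<zero>}" by (rule R.genideal_minimal[OF R.zeroideal]) simp
  then have zero: "ideal_smult R M (Idl {}) \<subseteq> {\<zero>\<^bsub>M\<^esub>}"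
    unfolding ideal_smult_eq by (intro mul_least submodule_zero) auto
  have sub: "submodule (ideal_smult R M (Idl {})) R M"
    unfolding ideal_smult_eq by (rule submodule_mul[OF ideal_subset_carrier[OF I0] order_refl])
  show thesis
  proof (rule that)
    show "xs ! 0 \<in> J" "xs ! 0 \<in> carrier R" using xs len nth_mem unfolding regular_seq_def by blast+
    fix y assume y: "y \<in> carrier M" "(xs ! 0) \<odot>\<^bsub>M\<^esub> y = \<zero>\<^bsub>M\<^esub>"
    have "(xs ! 0) \<odot>\<^bsub>M\<^esub> y \<in> ideal_smult R M (Idl (set (take 0 xs)))"
      unfolding y(2) take_0 list.set by (rule sub_zero[OF sub])
    then have "y \<in> ideal_smult R M (Idl (set (take 0 xs)))"
      using xs(1) len y(1) unfolding regular_seq_def by blast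
    then show "y = \<zero>\<^bsub>M\<^esub>" using zero by auto
  qed
qed

section \<open>Primary decompositions with prescribed exponents\<close>

context fg_module_noetherian_ring
begin

text \<open>\<open>Q\<close> is a \<open>P\<close>-primary submodule above \<open>N\<close> that can serve as the component of \<open>N\<close> at \<open>P\<close> and
  that contains \<open>P\<^sup>K M\<close>; primariness is expressed through the associated primes of \<open>M / Q\<close>, and the
  clause on \<open>ann N x\<close> says that \<open>P\<close> is not associated to \<open>Q / N\<close>.\<close>

definition component :: "'b set \<Rightarrow> nat \<Rightarrow> 'a set \<Rightarrow> 'b set \<Rightarrow> bool"
  where "component N K P Q \<longleftrightarrow> submodule Q R M \<and> N \<subseteq> Q \<and> pw P K \<subseteq> Q \<and> Q \<noteq> carrier M \<and>
    (\<forall>x\<in>Q. ann N x \<noteq> P) \<and> (\<forall>x\<in>carrier M. primeideal (ann Q x) R \<longrightarrow> ann Q x = P)"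

text \<open>The bound implies that \<open>P\<close> is not associated to \<open>(N + P\<^sup>K M) / N\<close>. So there is a maximal \<open>Q\<close> above
  \<open>N + P\<^sup>K M\<close> such that \<open>P\<close> is not associated to \<open>Q / N\<close>. If a prime \<open>P'\<close> is the annihilator of \<open>x\<close>
  modulo \<open>Q\<close>, then maximality makes \<open>P\<close> associated to \<open>(Q + R x) / N\<close>, and this forces \<open>P' = P\<close>.\<close>

lemma exists_component:
  assumes N: "submodule N R M" and P: "P \<in> assoc_primes N"
    and bound: "pw P K \<inter> colon_mod M N P \<subseteq> N"
  shows "\<exists>Q. component N K P Q"
proof -
  obtain x0 where prime: "primeideal P R" and x0: "x0 \<in> carrier M" "P = ann N x0"
    using P unfolding assoc_primes_def by blast
  have I: "ideal P R" by (rule primeideal.axioms(1)[OF prime])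
  define C where "C = {Q. submodule Q R M}"
  define Z where "Z = {Q \<in> C. N \<subseteq> Q \<and> pw P K \<subseteq> Q \<and> (\<forall>x\<in>Q. ann N x \<noteq> P)}"
  have init: "N <+>\<^bsub>M\<^esub> pw P K \<in> Z"
  proof -
    have "ann N x \<noteq> P" if xin: "x \<in> N <+>\<^bsub>M\<^esub> pw P K" for x
    proof
      assume x: "ann N x = P"
      obtain n z where nz: "n \<in> N" "z \<in> pw P K" "x = n \<oplus>\<^bsub>M\<^esub> z"
        using xin unfolding set_add_def' by blast
      have zM: "z \<in> carrier M" by (rule sub_carr[OF pw_sub[OF I] nz(2)])
      have z: "ann N z = P" using ann_add_left[OF N nz(1) zM] x nz(3) by simp
      then have "z \<in> colon_mod M N P" using zM by (auto simp: colon_mod_def ann_def)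
      then have "z \<in> N" using bound nz(2) by blast
      then show False using ann_prime_notin[OF N, of z] z prime by simp
    qed
    then show ?thesis
      unfolding Z_def C_def
      using submodule_set_add[OF N pw_sub[OF I]] set_add_left[OF pw_sub[OF I] submoduleE(1)[OF N]]
        set_add_right[OF N submoduleE(1)[OF pw_sub[OF I]]] by simp
  qed
  have acc: "acc_on C" unfolding C_def by (rule acc_submodules)
  have "Z \<subseteq> C" unfolding Z_def by auto
  from acc_on_maximal[OF acc this init]
  obtain Q where Q: "Q \<in> Z" and max: "\<And>Q'. Q' \<in> Z \<Longrightarrow> Q \<subseteq> Q' \<Longrightarrow> Q' = Q" by blast
  have sQ: "submodule Q R M" and NQ: "N \<subseteq> Q" and PQ: "pw P K \<subseteq> Q" and annQ: "\<And>x. x \<in> Q \<Longrightarrow> ann N x \<noteq> P"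
    using Q unfolding Z_def C_def by blast+
  have "Q \<noteq> carrier M" using annQ x0 by blast
  moreover have "ann Q x = P" if x: "x \<in> carrier M" and prime_x: "primeideal (ann Q x) R" for x
  proof -
    define L where "L = (\<lambda>r. r \<odot>\<^bsub>M\<^esub> x) ` carrier R"
    have sL: "submodule L R M" unfolding L_def by (rule submodule_cyclic_image[OF R.oneideal x])
    have xL: "x \<in> L" unfolding L_def using x by (intro image_eqI[of _ _ \<one>]) auto
    have Q_le: "Q \<subseteq> Q <+>\<^bsub>M\<^esub> L" by (rule set_add_left[OF sL submoduleE(1)[OF sQ]])
    have "x \<in> Q <+>\<^bsub>M\<^esub> L" using set_add_right[OF sQ submoduleE(1)[OF sL]] xL by blast
    moreover have "x \<notin> Q" by (rule ann_prime_notin[OF sQ prime_x])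
    ultimately have "Q <+>\<^bsub>M\<^esub> L \<notin> Z" using max[OF _ Q_le] by blast
    then obtain z where z: "z \<in> Q <+>\<^bsub>M\<^esub> L" "ann N z = P"
      unfolding Z_def C_def using submodule_set_add[OF sQ sL] Q_le NQ PQ by blast
    then obtain w r where wr: "w \<in> Q" "r \<in> carrier R" "z = w \<oplus>\<^bsub>M\<^esub> r \<odot>\<^bsub>M\<^esub> x"
      unfolding set_add_def' L_def by blast
    have zM: "z \<in> carrier M" using wr x sub_carr[OF sQ] by simp
    have "z \<notin> Q" using annQ z(2) by blast
    then have "r \<notin> ann Q x" using sub_add[OF sQ wr(1)] wr by (auto simp: ann_def)
    then have "ann Q (r \<odot>\<^bsub>M\<^esub> x) = ann Q x" by (rule ann_smult_prime[OF prime_x x wr(2) _ sQ])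
    moreover have "ann Q z = ann Q (r \<odot>\<^bsub>M\<^esub> x)"
      unfolding wr(3) by (rule ann_add_left[OF sQ wr(1) smult_closed[OF wr(2) x]])
    ultimately have zx: "ann Q z = ann Q x" by simp
    have "P \<subseteq> ann Q x" unfolding zx[symmetric] z(2)[symmetric] using NQ by (auto simp: ann_def)
    moreover have "ann Q x \<subseteq> P"
    proof (rule ccontr)
      assume "\<not> ann Q x \<subseteq> P"
      then obtain s where s: "s \<in> ann Q z" "s \<notin> P" unfolding zx by blast
      have sR: "s \<in> carrier R" and szQ: "s \<odot>\<^bsub>M\<^esub> z \<in> Q" using s(1) by (auto simp: ann_def)
      have "ann N (s \<odot>\<^bsub>M\<^esub> z) = ann N z"
        by (rule ann_smult_prime[OF _ zM sR _ N]) (use prime z(2) s(2) in auto)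
      then show False using annQ[OF szQ] z(2) by simp
    qed
    ultimately show ?thesis by blast
  qed
  ultimately show ?thesis unfolding component_def using sQ NQ PQ annQ by blast
qed

text \<open>One component is taken for each associated prime of \<open>N\<close>. An element outside \<open>N\<close> has a multiple with prime
  annihilator modulo \<open>N\<close>, so it avoids the component at that prime; hence the components intersect in
  \<open>N\<close>. Omitting the component at \<open>P\<close> loses \<open>P\<close> as an associated prime, so no component is
  redundant.\<close>

theorem primary_decomposition_with_exponent:
  assumes N: "submodule N R M" "N \<noteq> carrier M" and fin: "finite (assoc_primes N)"
    and bound: "\<And>P. P \<in> assoc_primes N \<Longrightarrow> pw P K \<inter> colon_mod M N P \<subseteq> N"
  shows "\<exists>l Q. minimal_primary_decomposition R M N l Q \<and>
    (\<forall>i\<in>{1..l}. ideal_pow R (rad R (colon_ring R M (Q i))) K \<subseteq> colon_ring R M (Q i))"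
proof -
  have "\<exists>Q. component N K P Q" if "P \<in> assoc_primes N" for P
    by (rule exists_component[OF N(1) that bound[OF that]])
  then obtain Q where Q: "\<And>P. P \<in> assoc_primes N \<Longrightarrow> component N K P (Q P)" by metis
  have sQ: "submodule (Q P) R M" and NQ: "N \<subseteq> Q P" and PQ: "pw P K \<subseteq> Q P" and Q_proper: "Q P \<noteq> carrier M"
    and Q_ann: "\<And>x. x \<in> Q P \<Longrightarrow> ann N x \<noteq> P"
    and Q_assoc: "\<And>x. x \<in> carrier M \<Longrightarrow> primeideal (ann (Q P) x) R \<Longrightarrow> ann (Q P) x = P"
    if "P \<in> assoc_primes N" for P
    using Q[OF that] unfolding component_def by simp_all
  have prime: "primeideal P R" if "P \<in> assoc_primes N" for P using that unfolding assoc_primes_def by blast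
  have I: "ideal P R" if "P \<in> assoc_primes N" for P by (rule primeideal.axioms(1)[OF prime[OF that]])
  have pow_in: "ideal_pow R P K \<subseteq> colon_ring R M (Q P)" if P: "P \<in> assoc_primes N" for P
  proof
    fix a assume a: "a \<in> ideal_pow R P K"
    then have "a \<odot>\<^bsub>M\<^esub> x \<in> Q P" if "x \<in> carrier M" for x
      using mul_mem[of a "ideal_pow R P K" x "carrier M"] PQ[OF P] that by blast
    then show "a \<in> colon_ring R M (Q P)" using a R.ideal_pow_carr[OF I[OF P]] by (auto simp: colon_ring_def)
  qed
  have rad_eq: "rad R (colon_ring R M (Q P)) = P" if P: "P \<in> assoc_primes N" for P
  proof
    show "P \<subseteq> rad R (colon_ring R M (Q P))"
      using R.elem_pow_in_ideal_pow[OF I[OF P], of _ K] pow_in[OF P] ideal.Icarr[OF I[OF P]]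
      unfolding rad_def by blast
    show "rad R (colon_ring R M (Q P)) \<subseteq> P"
    proof
      fix a assume "a \<in> rad R (colon_ring R M (Q P))"
      then obtain m :: nat where a: "a \<in> carrier R" "a [^] m \<in> colon_ring R M (Q P)" unfolding rad_def by blast
      obtain y where y: "y \<in> carrier M" "y \<notin> Q P" using Q_proper[OF P] sub_carr[OF sQ[OF P]] by blast
      obtain s where s: "s \<in> carrier R" "primeideal (ann (Q P) (s \<odot>\<^bsub>M\<^esub> y)) R"
        using exists_assoc_prime[OF sQ[OF P] y] by blast
      have sy: "s \<odot>\<^bsub>M\<^esub> y \<in> carrier M" using s y by simp
      have "a [^] m \<in> ann (Q P) (s \<odot>\<^bsub>M\<^esub> y)" using a sy by (simp add: colon_ring_def ann_def)
      then have "a [^] m \<in> P" using Q_assoc[OF P sy s(2)] by simp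
      then show "a \<in> P" by (rule R.prime_pow_mem[OF prime[OF P] a(1)])
    qed
  qed
  have primary: "primary_submodule R M (Q P)" if P: "P \<in> assoc_primes N" for P
    unfolding primary_submodule_def rad_eq[OF P]
  proof (intro conjI sQ[OF P] Q_proper[OF P] ballI impI)
    fix a x assume a: "a \<in> carrier R" and x: "x \<in> carrier M" "a \<odot>\<^bsub>M\<^esub> x \<in> Q P" "x \<notin> Q P"
    obtain s where s: "s \<in> carrier R" "primeideal (ann (Q P) (s \<odot>\<^bsub>M\<^esub> x)) R"
      using exists_assoc_prime[OF sQ[OF P] x(1,3)] by blast
    have "a \<in> ann (Q P) (s \<odot>\<^bsub>M\<^esub> x)"
      using sub_smult[OF sQ[OF P] s(1) x(2)] smult_left_commute[OF a s(1) x(1)] a by (simp add: ann_def)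
    then show "a \<in> P" using Q_assoc[OF P smult_closed[OF s(1) x(1)] s(2)] by simp
  qed
  have escape: "\<exists>P\<in>assoc_primes N. y \<notin> Q P" if y: "y \<in> carrier M" "y \<notin> N" for y
  proof -
    obtain s where s: "s \<in> carrier R" "primeideal (ann N (s \<odot>\<^bsub>M\<^esub> y)) R"
      using exists_assoc_prime[OF N(1) y] by blast
    let ?P = "ann N (s \<odot>\<^bsub>M\<^esub> y)"
    have P: "?P \<in> assoc_primes N" unfolding assoc_primes_def using s y by auto
    have "s \<odot>\<^bsub>M\<^esub> y \<notin> Q ?P" using Q_ann[OF P] by blast
    then show ?thesis using sub_smult[OF sQ[OF P] s(1)] P by blast
  qed
  define l where "l = card (assoc_primes N)"
  obtain g where g: "bij_betw g {1..l} (assoc_primes N)"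
    using ex_bij_betw_nat_finite_1[OF fin] unfolding l_def by blast
  have gP: "g i \<in> assoc_primes N" if "i \<in> {1..l}" for i using bij_betwE[OF g] that by blast
  have gimage: "g ` {1..l} = assoc_primes N" using g by (rule bij_betw_imp_surj_on)
  have ginj: "inj_on g {1..l}" using g by (rule bij_betw_imp_inj_on)
  obtain y where "y \<in> carrier M" "y \<notin> N" using N sub_carr[OF N(1)] by blast
  then have "assoc_primes N \<noteq> {}" using escape by blast
  then have l: "1 \<le> l" unfolding l_def using fin by (simp add: Suc_le_eq card_gt_0_iff)
  have "minimal_primary_decomposition R M N l (\<lambda>i. Q (g i))"
    unfolding minimal_primary_decomposition_def
  proof (intro conjI l ballI)
    show "primary_submodule R M (Q (g i))" if "i \<in> {1..l}" for i by (rule primary[OF gP[OF that]])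
    show "N = (\<Inter>i\<in>{1..l}. Q (g i))"
    proof
      show "N \<subseteq> (\<Inter>i\<in>{1..l}. Q (g i))" using NQ gP by blast
      show "(\<Inter>i\<in>{1..l}. Q (g i)) \<subseteq> N"
      proof
        fix x assume x: "x \<in> (\<Inter>i\<in>{1..l}. Q (g i))"
        then have "x \<in> Q (g 1)" using l by auto
        then have "x \<in> carrier M" using sub_carr[OF sQ[OF gP]] l by auto
        moreover have "x \<in> Q P" if "P \<in> assoc_primes N" for P using x that unfolding gimage[symmetric] by auto
        ultimately show "x \<in> N" using escape by blast
      qed
    qed
    show "inj_on (\<lambda>i. rad R (colon_ring R M (Q (g i)))) {1..l}"
    proof (rule inj_onI)
      fix i i' assume i: "i \<in> {1..l}" "i' \<in> {1..l}"
        and eq: "rad R (colon_ring R M (Q (g i))) = rad R (colon_ring R M (Q (g i')))"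
      from eq have "g i = g i'" unfolding rad_eq[OF gP[OF i(1)]] rad_eq[OF gP[OF i(2)]] .
      then show "i = i'" by (rule inj_onD[OF ginj _ i])
    qed
    fix j assume j: "j \<in> {1..l}"
    show "\<not> carrier M \<inter> (\<Inter>i\<in>{1..l} - {j}. Q (g i)) \<subseteq> Q (g j)"
    proof
      assume redundant: "carrier M \<inter> (\<Inter>i\<in>{1..l} - {j}. Q (g i)) \<subseteq> Q (g j)"
      obtain x where x: "x \<in> carrier M" "g j = ann N x" using gP[OF j] unfolding assoc_primes_def by blast
      have "\<exists>i\<in>{1..l} - {j}. ann (Q (g i)) x = g j"
      proof (rule R.prime_eq_of_finite_Inter[OF prime[OF gP[OF j]]])
        show "ideal (ann (Q (g i)) x) R" "g j \<subseteq> ann (Q (g i)) x" if "i \<in> {1..l} - {j}" for i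
          using ann_ideal[OF sQ[OF gP] x(1)] NQ[OF gP, of i] that unfolding x(2) by (auto simp: ann_def)
        fix a assume a: "a \<in> carrier R" "\<And>i. i \<in> {1..l} - {j} \<Longrightarrow> a \<in> ann (Q (g i)) x"
        have ax: "a \<odot>\<^bsub>M\<^esub> x \<in> carrier M" using a(1) x(1) by simp
        have others: "a \<odot>\<^bsub>M\<^esub> x \<in> Q (g i)" if "i \<in> {1..l} - {j}" for i using a(2)[OF that] by (simp add: ann_def)
        then have "a \<odot>\<^bsub>M\<^esub> x \<in> Q (g j)" using redundant ax by blast
        then have "a \<odot>\<^bsub>M\<^esub> x \<in> Q (g i)" if "i \<in> {1..l}" for i using others that by (cases "i = j") auto
        then have "a \<odot>\<^bsub>M\<^esub> x \<in> Q P" if "P \<in> assoc_primes N" for P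
          using that unfolding gimage[symmetric] by blast
        then have "a \<odot>\<^bsub>M\<^esub> x \<in> N" using escape[OF ax] by blast
        then show "a \<in> g j" using a(1) by (simp add: x(2) ann_def)
      qed simp
      then obtain i where i: "i \<in> {1..l}" "i \<noteq> j" "ann (Q (g i)) x = g j" by blast
      have "ann (Q (g i)) x = g i" by (rule Q_assoc[OF gP[OF i(1)] x(1)]) (use i(3) prime[OF gP[OF j]] in simp)
      then show False using i j ginj by (auto dest: inj_onD)
    qed
  qed
  moreover have "ideal_pow R (rad R (colon_ring R M (Q (g i)))) K \<subseteq> colon_ring R M (Q (g i))" if "i \<in> {1..l}" for i
    using pow_in[OF gP[OF that]] rad_eq[OF gP[OF that]] by simp
  ultimately show ?thesis by (intro exI[of _ l] exI[of _ "\<lambda>i. Q (g i)"]) blast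
qed

end

section \<open>The Rees ring\<close>

lemma (in abelian_monoid) finsum_swap:
  assumes "finite A" "finite B" "\<And>i j. i \<in> A \<Longrightarrow> j \<in> B \<Longrightarrow> h i j \<in> carrier G"
  shows "(\<Oplus>i\<in>A. \<Oplus>j\<in>B. h i j) = (\<Oplus>j\<in>B. \<Oplus>i\<in>A. h i j)"
  using assms(1,3)
proof (induction A)
  case empty
  then show ?case by simp
next
  case (insert x A)
  have "(\<Oplus>i\<in>insert x A. \<Oplus>j\<in>B. h i j) = (\<Oplus>j\<in>B. h x j) \<oplus> (\<Oplus>j\<in>B. \<Oplus>i\<in>A. h i j)"
    using insert assms(2) by (subst finsum_insert) (auto intro!: finsum_closed)
  also have "\<dots> = (\<Oplus>j\<in>B. h x j \<oplus> (\<Oplus>i\<in>A. h i j))"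
    using insert assms(2) by (intro finsum_addf[symmetric]) (auto intro!: finsum_closed)
  also have "\<dots> = (\<Oplus>j\<in>B. \<Oplus>i\<in>insert x A. h i j)"
    using insert assms(2) by (intro finsum_cong') (auto simp: finsum_insert Pi_def intro!: finsum_closed)
  finally show ?case .
qed

lemma (in abelian_monoid) finsum_in:
  assumes "N \<subseteq> carrier G" "\<zero> \<in> N" "\<And>x y. x \<in> N \<Longrightarrow> y \<in> N \<Longrightarrow> x \<oplus> y \<in> N"
    and "\<And>i. i \<in> A \<Longrightarrow> h i \<in> N"
  shows "(\<Oplus>i\<in>A. h i) \<in> N"
  using assms(4)
proof (induction A rule: infinite_finite_induct)
  case (insert x F)
  have "(\<Oplus>i\<in>insert x F. h i) = h x \<oplus> (\<Oplus>i\<in>F. h i)"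
    using insert assms(1) by (intro finsum_insert) auto
  then show ?case using insert assms(3) by simp
qed (use assms(2) in \<open>simp_all add: finsum_infinite\<close>)

context cring
begin

lemma ideal_of_closed:
  assumes "K \<subseteq> carrier R" "\<zero> \<in> K" "\<And>x y. x \<in> K \<Longrightarrow> y \<in> K \<Longrightarrow> x \<oplus> y \<in> K"
    and mult: "\<And>a x. a \<in> carrier R \<Longrightarrow> x \<in> K \<Longrightarrow> a \<otimes> x \<in> K"
  shows "ideal K R"
proof (rule idealI[OF ring_axioms])
  show "subgroup K (add_monoid R)"
  proof (rule add.subgroupI)
    fix a assume a: "a \<in> K"
    then have "(\<ominus> \<one>) \<otimes> a \<in> K" by (intro mult) auto
    then show "\<ominus> a \<in> K" using a assms(1) l_minus[of \<one> a] by auto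
  qed (use assms in auto)
  fix a x assume "a \<in> K" "x \<in> carrier R"
  then show "x \<otimes> a \<in> K" "a \<otimes> x \<in> K" using mult[of x a] assms(1) m_comm[of a x] by auto
qed

lemma ideal_finsum_in: "ideal J R \<Longrightarrow> (\<And>i. i \<in> A \<Longrightarrow> h i \<in> J) \<Longrightarrow> (\<Oplus>i\<in>A. h i) \<in> J"
  by (rule finsum_in)
    (auto dest: ideal.axioms(1) intro: additive_subgroup.zero_closed additive_subgroup.a_closed additive_subgroup.a_Hcarr)

abbreviation supp :: "(int \<Rightarrow> 'a) \<Rightarrow> int set" where "supp f \<equiv> {i. f i \<noteq> \<zero>}"

abbreviation conv :: "(int \<Rightarrow> 'a) \<Rightarrow> (int \<Rightarrow> 'a) \<Rightarrow> int \<Rightarrow> 'a"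
  where "conv \<equiv> monoid.mult (laurent_ring R)"

abbreviation laurent :: "(int \<Rightarrow> 'a) set" where "laurent \<equiv> carrier (laurent_ring R)"

lemma laurent_iff: "f \<in> laurent \<longleftrightarrow> (\<forall>n. f n \<in> carrier R) \<and> finite (supp f)"
  by (auto simp: laurent_ring_def)

lemma laurentD: "f \<in> laurent \<Longrightarrow> f n \<in> carrier R" "f \<in> laurent \<Longrightarrow> finite (supp f)"
  by (simp_all add: laurent_iff)

lemma conv_def: "conv f g n = (\<Oplus>i\<in>supp f. f i \<otimes> g (n - i))"
  by (simp add: laurent_ring_def)

lemma conv_eq:
  assumes "finite A" "supp f \<subseteq> A" "\<And>i. f i \<in> carrier R" "\<And>i. g i \<in> carrier R"
  shows "conv f g n = (\<Oplus>i\<in>A. f i \<otimes> g (n - i))"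
  unfolding conv_def by (rule add.finprod_mono_neutral_cong_left) (use assms in auto)

lemma conv_closed_carrier: "f \<in> laurent \<Longrightarrow> g \<in> laurent \<Longrightarrow> conv f g n \<in> carrier R"
  unfolding conv_def by (rule finsum_closed) (auto simp: laurentD)

lemma supp_conv:
  assumes "f \<in> laurent" "g \<in> laurent"
  shows "supp (conv f g) \<subseteq> (\<lambda>(i, j). i + j) ` (supp f \<times> supp g)"
proof
  fix n assume n: "n \<in> supp (conv f g)"
  have "\<exists>i\<in>supp f. g (n - i) \<noteq> \<zero>"
  proof (rule ccontr)
    assume "\<not> ?thesis"
    then have "conv f g n = \<zero>" unfolding conv_def
      by (intro add.finprod_one_eqI) (use assms laurentD in auto)
    then show False using n by simp
  qed
  then obtain i where "i \<in> supp f" "n - i \<in> supp g" by blast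
  then show "n \<in> (\<lambda>(i, j). i + j) ` (supp f \<times> supp g)" by (intro image_eqI[of _ _ "(i, n - i)"]) auto
qed

lemma conv_closed: "f \<in> laurent \<Longrightarrow> g \<in> laurent \<Longrightarrow> conv f g \<in> laurent"
  unfolding laurent_iff[of "conv f g"]
  using conv_closed_carrier supp_conv[THEN finite_subset] by (auto simp: laurentD)

lemma conv_comm:
  assumes "f \<in> laurent" "g \<in> laurent"
  shows "conv f g = conv g f"
proof
  fix n
  let ?A = "supp f \<union> (\<lambda>j. n - j) ` supp g"
  let ?B = "supp g \<union> (\<lambda>i. n - i) ` supp f"
  have img: "(\<lambda>j. n - j) ` ?B = ?A" by (auto simp: image_Un image_image)
  have fin: "finite ?A" "finite ?B" using assms by (auto simp: laurentD)
  have "conv f g n = (\<Oplus>i\<in>?A. f i \<otimes> g (n - i))"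
    by (rule conv_eq) (use fin assms laurentD in auto)
  also have "\<dots> = (\<Oplus>i\<in>(\<lambda>j. n - j) ` ?B. f i \<otimes> g (n - i))" unfolding img ..
  also have "\<dots> = (\<Oplus>j\<in>?B. f (n - j) \<otimes> g (n - (n - j)))"
    by (rule finsum_reindex) (use assms laurentD in \<open>auto simp: inj_on_def\<close>)
  also have "\<dots> = (\<Oplus>j\<in>?B. g j \<otimes> f (n - j))"
    by (rule finsum_cong') (use assms laurentD m_comm in auto)
  also have "\<dots> = conv g f n"
    by (rule conv_eq[symmetric]) (use fin assms laurentD in auto)
  finally show "conv f g n = conv g f n" .
qed

lemma conv_assoc:
  assumes "f \<in> laurent" "g \<in> laurent" "h \<in> laurent"
  shows "conv (conv f g) h = conv f (conv g h)"
proof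
  fix n
  let ?A = "supp f"
  let ?C = "(\<lambda>(i, j). i + j) ` (supp f \<times> supp g)"
  note fc = laurentD(1)[OF assms(1)] and gc = laurentD(1)[OF assms(2)] and hc = laurentD(1)[OF assms(3)]
  have finA: "finite ?A" and finC: "finite ?C" using assms laurentD(2) by auto
  \<comment> \<open>\<open>?C\<close> is chosen such that \<open>?C - i\<close> contains the support of \<open>g\<close> for every \<open>i\<close> in the support of \<open>f\<close>\<close>
  have "conv (conv f g) h n = (\<Oplus>k\<in>?C. conv f g k \<otimes> h (n - k))"
    by (rule conv_eq[OF finC supp_conv[OF assms(1,2)] conv_closed_carrier[OF assms(1,2)] hc])
  also have "\<dots> = (\<Oplus>k\<in>?C. \<Oplus>i\<in>?A. (f i \<otimes> g (k - i)) \<otimes> h (n - k))"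
  proof (rule finsum_cong')
    fix k assume "k \<in> ?C"
    show "conv f g k \<otimes> h (n - k) = (\<Oplus>i\<in>?A. (f i \<otimes> g (k - i)) \<otimes> h (n - k))"
      unfolding conv_def by (rule finsum_ldistr[OF finA hc]) (simp add: fc gc)
  qed (auto intro!: finsum_closed simp: fc gc hc)
  also have "\<dots> = (\<Oplus>i\<in>?A. \<Oplus>k\<in>?C. (f i \<otimes> g (k - i)) \<otimes> h (n - k))"
    by (rule finsum_swap[OF finC finA]) (simp add: fc gc hc)
  also have "\<dots> = (\<Oplus>i\<in>?A. f i \<otimes> conv g h (n - i))"
  proof (rule finsum_cong')
    fix i assume i: "i \<in> ?A"
    let ?D = "(\<lambda>k. k - i) ` ?C"
    have sub: "supp g \<subseteq> ?D" using i by (force simp: image_iff)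
    have "conv g h (n - i) = (\<Oplus>l\<in>?D. g l \<otimes> h (n - i - l))"
      by (rule conv_eq[OF _ sub gc hc]) (use finC in simp)
    also have "\<dots> = (\<Oplus>k\<in>?C. g (k - i) \<otimes> h (n - i - (k - i)))"
      by (rule finsum_reindex) (auto simp: gc hc inj_on_def)
    finally have "f i \<otimes> conv g h (n - i) = f i \<otimes> (\<Oplus>k\<in>?C. g (k - i) \<otimes> h (n - k))" by simp
    also have "\<dots> = (\<Oplus>k\<in>?C. f i \<otimes> (g (k - i) \<otimes> h (n - k)))"
      by (rule finsum_rdistr[OF finC fc]) (simp add: gc hc)
    also have "\<dots> = (\<Oplus>k\<in>?C. (f i \<otimes> g (k - i)) \<otimes> h (n - k))"
      by (rule finsum_cong') (auto simp: fc gc hc m_assoc)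
    finally show "(\<Oplus>k\<in>?C. (f i \<otimes> g (k - i)) \<otimes> h (n - k)) = f i \<otimes> conv g h (n - i)" ..
  qed (auto intro!: conv_closed_carrier assms simp: fc)
  also have "\<dots> = conv f (conv g h) n" by (simp add: conv_def[of f])
  finally show "conv (conv f g) h n = conv f (conv g h) n" .
qed

lemma conv_l_distr:
  assumes "f \<in> laurent" "g \<in> laurent" "h \<in> laurent"
  shows "conv (\<lambda>n. f n \<oplus> g n) h = (\<lambda>n. conv f h n \<oplus> conv g h n)"
proof
  fix n
  note fc = laurentD(1)[OF assms(1)] and gc = laurentD(1)[OF assms(2)] and hc = laurentD(1)[OF assms(3)]
  let ?A = "supp f \<union> supp g"
  have fin: "finite ?A" using assms laurentD(2) by auto
  have "conv (\<lambda>n. f n \<oplus> g n) h n = (\<Oplus>i\<in>?A. (f i \<oplus> g i) \<otimes> h (n - i))"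
    by (rule conv_eq[OF fin _ _ hc]) (auto simp: fc gc)
  also have "\<dots> = (\<Oplus>i\<in>?A. f i \<otimes> h (n - i) \<oplus> g i \<otimes> h (n - i))"
    by (rule finsum_cong') (auto simp: fc gc hc l_distr)
  also have "\<dots> = (\<Oplus>i\<in>?A. f i \<otimes> h (n - i)) \<oplus> (\<Oplus>i\<in>?A. g i \<otimes> h (n - i))"
    by (rule finsum_addf) (auto simp: fc gc hc)
  also have "\<dots> = conv f h n \<oplus> conv g h n"
    using conv_eq[OF fin _ fc hc] conv_eq[OF fin _ gc hc] by simp
  finally show "conv (\<lambda>n. f n \<oplus> g n) h n = conv f h n \<oplus> conv g h n" .
qed

lemma conv_monom:
  assumes "a \<in> carrier R" "\<And>i. g i \<in> carrier R"
  shows "conv (laurent_monom R a d) g n = a \<otimes> g (n - d)"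
proof -
  have "conv (laurent_monom R a d) g n = (\<Oplus>i\<in>{d}. laurent_monom R a d i \<otimes> g (n - i))"
    by (rule conv_eq) (use assms in \<open>auto simp: laurent_monom_def\<close>)
  then show ?thesis using assms by (simp add: laurent_monom_def finsum_insert)
qed

lemma laurentI:
  assumes "\<And>n. f n \<in> carrier R" "finite A" "\<And>n. n \<notin> A \<Longrightarrow> f n = \<zero>"
  shows "f \<in> laurent"
proof -
  have "supp f \<subseteq> A" using assms(3) by blast
  then show ?thesis using assms(1,2) finite_subset unfolding laurent_iff by blast
qed

lemma monom_in_laurent: "a \<in> carrier R \<Longrightarrow> laurent_monom R a d \<in> laurent"
  by (rule laurentI[of _ "{d}"]) (auto simp: laurent_monom_def)

lemma laurent_add: "f \<in> laurent \<Longrightarrow> g \<in> laurent \<Longrightarrow> (\<lambda>n. f n \<oplus> g n) \<in> laurent"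
  by (rule laurentI[of _ "supp f \<union> supp g"]) (auto simp: laurentD)

lemma laurent_neg: "f \<in> laurent \<Longrightarrow> (\<lambda>n. \<ominus> f n) \<in> laurent"
  by (rule laurentI[of _ "supp f"]) (auto simp: laurentD)

lemma monom_mult:
  assumes "a \<in> carrier R" "b \<in> carrier R"
  shows "conv (laurent_monom R a d) (laurent_monom R b e) = laurent_monom R (a \<otimes> b) (d + e)"
proof
  fix n
  have "conv (laurent_monom R a d) (laurent_monom R b e) n = a \<otimes> laurent_monom R b e (n - d)"
    by (rule conv_monom) (use assms in \<open>auto simp: laurent_monom_def\<close>)
  then show "conv (laurent_monom R a d) (laurent_monom R b e) n = laurent_monom R (a \<otimes> b) (d + e) n"
    using assms by (auto simp: laurent_monom_def)
qed

lemma rees_carrier_iff: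
  "f \<in> carrier (rees_ring R J) \<longleftrightarrow> f \<in> laurent \<and> (\<forall>n. f n \<in> ideal_pow R J (nat n))"
  by (simp add: rees_ring_def)

lemma rees_simps:
  "monoid.mult (rees_ring R J) = conv"
  "one (rees_ring R J) = laurent_monom R \<one> 0"
  "ring.zero (rees_ring R J) = (\<lambda>n. \<zero>)"
  "ring.add (rees_ring R J) = (\<lambda>f g n. f n \<oplus> g n)"
  by (simp_all add: rees_ring_def laurent_ring_def laurent_monom_def)

text \<open>This is the ideal \<open>(Jt)\<^sup>m\<close> of the Rees ring: a coefficient in degree \<open>n < m\<close> comes from degree \<open>m\<close>
  by multiplication with \<open>u\<^sup>m\<^sup>-\<^sup>n\<close> and so belongs to \<open>J\<^sup>m\<close>, one in degree \<open>n \<ge> m\<close> belongs to \<open>J\<^sup>n\<close>.\<close>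

definition rees_trunc :: "'a set \<Rightarrow> nat \<Rightarrow> (int \<Rightarrow> 'a) set"
  where "rees_trunc J m = {f \<in> laurent. \<forall>n. f n \<in> ideal_pow R J (max m (nat n))}"

lemma rees_trunc_0: "rees_trunc J 0 = carrier (rees_ring R J)"
  by (auto simp: rees_trunc_def rees_carrier_iff)

lemma rees_trunc_mult:
  assumes J: "ideal J R" and f: "f \<in> rees_trunc J k" and g: "g \<in> rees_trunc J m"
  shows "conv f g \<in> rees_trunc J (k + m)"
proof -
  have fg: "f \<in> laurent" "g \<in> laurent" using f g by (auto simp: rees_trunc_def)
  have "conv f g n \<in> ideal_pow R J (max (k + m) (nat n))" for n
    unfolding conv_def
  proof (rule ideal_finsum_in[OF ideal_pow_ideal[OF J]])
    fix i
    have "f i \<otimes> g (n - i) \<in> ideal_pow R J (max k (nat i) + max m (nat (n - i)))"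
      using f g by (intro ideal_pow_mult[OF J]) (auto simp: rees_trunc_def)
    moreover have "max (k + m) (nat n) \<le> max k (nat i) + max m (nat (n - i))" by arith
    ultimately show "f i \<otimes> g (n - i) \<in> ideal_pow R J (max (k + m) (nat n))"
      using ideal_pow_anti[OF J] by blast
  qed
  then show ?thesis using conv_closed[OF fg] by (simp add: rees_trunc_def)
qed

lemma rees_trunc_add:
  assumes J: "ideal J R" and "f \<in> rees_trunc J m" "g \<in> rees_trunc J m"
  shows "(\<lambda>n. f n \<oplus> g n) \<in> rees_trunc J m"
  using assms(2,3) laurent_add additive_subgroup.a_closed[OF ideal.axioms(1)[OF ideal_pow_ideal[OF J]]]
  by (simp add: rees_trunc_def)

lemma rees_trunc_zero: "ideal J R \<Longrightarrow> (\<lambda>n. \<zero>) \<in> rees_trunc J m"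
  using additive_subgroup.zero_closed[OF ideal.axioms(1)[OF ideal_pow_ideal]]
  by (simp add: rees_trunc_def laurent_iff)

lemma rees_cring:
  assumes J: "ideal J R"
  shows "cring (rees_ring R J)"
proof (rule cringI)
  let ?A = "rees_ring R J"
  have L: "f \<in> laurent" if "f \<in> carrier ?A" for f using that by (simp add: rees_carrier_iff)
  have c: "f n \<in> carrier R" if "f \<in> carrier ?A" for f n using laurentD(1)[OF L[OF that]] .
  show "abelian_group ?A"
  proof (rule abelian_groupI)
    fix f g assume fg: "f \<in> carrier ?A" "g \<in> carrier ?A"
    then show "f \<oplus>\<^bsub>?A\<^esub> g \<in> carrier ?A"
      using rees_trunc_add[OF J, of f 0 g] by (simp add: rees_simps rees_trunc_0)
    show "f \<oplus>\<^bsub>?A\<^esub> g = g \<oplus>\<^bsub>?A\<^esub> f" using c fg by (auto simp: rees_simps a_comm)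
  next
    show "\<zero>\<^bsub>?A\<^esub> \<in> carrier ?A" using rees_trunc_zero[OF J, of 0] by (simp add: rees_simps rees_trunc_0)
  next
    fix f g h assume "f \<in> carrier ?A" "g \<in> carrier ?A" "h \<in> carrier ?A"
    then show "f \<oplus>\<^bsub>?A\<^esub> g \<oplus>\<^bsub>?A\<^esub> h = f \<oplus>\<^bsub>?A\<^esub> (g \<oplus>\<^bsub>?A\<^esub> h)" using c by (auto simp: rees_simps a_assoc)
  next
    fix f assume f: "f \<in> carrier ?A"
    show "\<zero>\<^bsub>?A\<^esub> \<oplus>\<^bsub>?A\<^esub> f = f" using c[OF f] by (simp add: rees_simps)
    have "(\<lambda>n. \<ominus> f n) \<in> carrier ?A"
      using f laurent_neg additive_subgroup.a_inv_closed[OF ideal.axioms(1)[OF ideal_pow_ideal[OF J]]]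
      by (simp add: rees_carrier_iff)
    moreover have "(\<lambda>n. \<ominus> f n) \<oplus>\<^bsub>?A\<^esub> f = \<zero>\<^bsub>?A\<^esub>" using c[OF f] by (simp add: rees_simps l_neg)
    ultimately show "\<exists>y\<in>carrier ?A. y \<oplus>\<^bsub>?A\<^esub> f = \<zero>\<^bsub>?A\<^esub>" by blast
  qed
  show "comm_monoid ?A"
  proof (rule comm_monoidI)
    show "\<one>\<^bsub>?A\<^esub> \<in> carrier ?A"
      using monom_in_laurent[of \<one> 0] additive_subgroup.zero_closed[OF ideal.axioms(1)[OF ideal_pow_ideal[OF J]]]
      by (auto simp: rees_simps rees_carrier_iff laurent_monom_def ideal_pow_0)
  next
    fix f assume f: "f \<in> carrier ?A"
    show "\<one>\<^bsub>?A\<^esub> \<otimes>\<^bsub>?A\<^esub> f = f" using conv_monom[of \<one> f 0] c[OF f] by (auto simp: rees_simps)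
  next
    fix f g assume fg: "f \<in> carrier ?A" "g \<in> carrier ?A"
    show "f \<otimes>\<^bsub>?A\<^esub> g \<in> carrier ?A"
      using rees_trunc_mult[OF J, of f 0 g 0] fg by (simp add: rees_simps rees_trunc_0)
    show "f \<otimes>\<^bsub>?A\<^esub> g = g \<otimes>\<^bsub>?A\<^esub> f" using conv_comm[OF L L] fg by (simp add: rees_simps)
  next
    fix f g h assume "f \<in> carrier ?A" "g \<in> carrier ?A" "h \<in> carrier ?A"
    then show "f \<otimes>\<^bsub>?A\<^esub> g \<otimes>\<^bsub>?A\<^esub> h = f \<otimes>\<^bsub>?A\<^esub> (g \<otimes>\<^bsub>?A\<^esub> h)"
      using conv_assoc[OF L L L] by (simp add: rees_simps)
  qed
  fix f g h assume "f \<in> carrier ?A" "g \<in> carrier ?A" "h \<in> carrier ?A"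
  then show "(f \<oplus>\<^bsub>?A\<^esub> g) \<otimes>\<^bsub>?A\<^esub> h = f \<otimes>\<^bsub>?A\<^esub> h \<oplus>\<^bsub>?A\<^esub> g \<otimes>\<^bsub>?A\<^esub> h"
    using conv_l_distr[OF L L L] by (simp add: rees_simps)
qed

lemma rees_trunc_ideal:
  assumes J: "ideal J R"
  shows "ideal (rees_trunc J m) (rees_ring R J)"
proof -
  interpret A: cring "rees_ring R J" by (rule rees_cring[OF J])
  show ?thesis
  proof (rule A.ideal_of_closed)
    show "rees_trunc J m \<subseteq> carrier (rees_ring R J)"
    proof
      fix f assume f: "f \<in> rees_trunc J m"
      have "f n \<in> ideal_pow R J (nat n)" for n
        using f ideal_pow_anti[OF J, of "nat n" "max m (nat n)"] by (auto simp: rees_trunc_def)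
      then show "f \<in> carrier (rees_ring R J)" using f by (simp add: rees_carrier_iff rees_trunc_def)
    qed
    show "\<zero>\<^bsub>rees_ring R J\<^esub> \<in> rees_trunc J m" using rees_trunc_zero[OF J] by (simp add: rees_simps)
    show "f \<oplus>\<^bsub>rees_ring R J\<^esub> g \<in> rees_trunc J m" if "f \<in> rees_trunc J m" "g \<in> rees_trunc J m" for f g
      using rees_trunc_add[OF J that] by (simp add: rees_simps)
    show "f \<otimes>\<^bsub>rees_ring R J\<^esub> g \<in> rees_trunc J m" if "f \<in> carrier (rees_ring R J)" "g \<in> rees_trunc J m" for f g
      using rees_trunc_mult[OF J, of f 0 g m] that by (simp add: rees_simps rees_trunc_0)
  qed
qed

lemma rees_monom_closed:
  assumes J: "ideal J R" and a: "a \<in> ideal_pow R J m"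
  shows "laurent_monom R a (int m) \<in> carrier (rees_ring R J)"
proof -
  have "a \<in> carrier R" using a ideal_pow_carr[OF J] by blast
  then show ?thesis
    using a monom_in_laurent[of a "int m"] additive_subgroup.zero_closed[OF ideal.axioms(1)[OF ideal_pow_ideal[OF J]]]
    by (auto simp: rees_carrier_iff laurent_monom_def)
qed

lemma rees_It_ideal:
  assumes J: "ideal J R"
  shows "ideal (rees_It R J) (rees_ring R J)" and "a \<in> J \<Longrightarrow> laurent_monom R a 1 \<in> rees_It R J"
    and "rees_It R J \<subseteq> rees_trunc J 1"
proof -
  interpret A: cring "rees_ring R J" by (rule rees_cring[OF J])
  let ?S = "{laurent_monom R a 1 | a. a \<in> J}"
  have S: "?S \<subseteq> carrier (rees_ring R J)"
    using rees_monom_closed[OF J, of _ 1] by (auto simp: ideal_pow_1[OF J])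
  show "ideal (rees_It R J) (rees_ring R J)" unfolding rees_It_def by (rule A.genideal_ideal[OF S])
  show "laurent_monom R a 1 \<in> rees_It R J" if "a \<in> J"
    unfolding rees_It_def using A.genideal_self[OF S] that by blast
  show "rees_It R J \<subseteq> rees_trunc J 1"
    unfolding rees_It_def
  proof (rule A.genideal_minimal[OF rees_trunc_ideal[OF J]])
    show "?S \<subseteq> rees_trunc J 1"
    proof clarify
      fix a assume a: "a \<in> J"
      then have aR: "a \<in> carrier R" by (rule ideal.Icarr[OF J])
      show "laurent_monom R a 1 \<in> rees_trunc J 1"
        using a monom_in_laurent[OF aR, of 1] additive_subgroup.zero_closed[OF ideal.axioms(1)[OF ideal_pow_ideal[OF J]]]
        by (auto simp: rees_trunc_def laurent_monom_def ideal_pow_1[OF J])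
    qed
  qed
qed

lemma rees_It_pow_subset:
  assumes J: "ideal J R"
  shows "ideal_pow (rees_ring R J) (rees_It R J) m \<subseteq> rees_trunc J m"
proof (induction m)
  interpret A: cring "rees_ring R J" by (rule rees_cring[OF J])
  case 0
  then show ?case by (simp add: A.ideal_pow_0 rees_trunc_0)
next
  interpret A: cring "rees_ring R J" by (rule rees_cring[OF J])
  case (Suc m)
  show ?case
  proof
    fix f assume "f \<in> ideal_pow (rees_ring R J) (rees_It R J) (Suc m)"
    then have "f \<in> ideal_prod (rees_ring R J) (ideal_pow (rees_ring R J) (rees_It R J) m) (rees_It R J)"
      unfolding A.ideal_pow_Suc .
    then show "f \<in> rees_trunc J (Suc m)"
    proof induction
      case (prod g h)
      then show ?case
        using rees_trunc_mult[OF J, of g m h 1] Suc.IH rees_It_ideal(3)[OF J] by (auto simp: rees_simps)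
    next
      case (sum g h)
      then show ?case using rees_trunc_add[OF J] by (simp add: rees_simps)
    qed
  qed
qed

lemma monom_in_rees_It_pow:
  assumes J: "ideal J R" and "a \<in> ideal_pow R J m"
  shows "laurent_monom R a (int m) \<in> ideal_pow (rees_ring R J) (rees_It R J) m"
  using assms(2)
proof (induction m arbitrary: a)
  case 0
  interpret A: cring "rees_ring R J" by (rule rees_cring[OF J])
  from 0 show ?case using rees_monom_closed[OF J 0] by (simp add: A.ideal_pow_0)
next
  case (Suc m)
  interpret A: cring "rees_ring R J" by (rule rees_cring[OF J])
  let ?K = "ideal_pow (rees_ring R J) (rees_It R J)"
  from Suc.prems have "a \<in> ideal_pow R J m \<cdot> J" unfolding ideal_pow_Suc .
  then show ?case
  proof induction
    case (prod b c)
    have bc: "b \<in> carrier R" "c \<in> carrier R" using prod ideal_pow_carr[OF J] ideal.Icarr[OF J] by auto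
    have "laurent_monom R b (int m) \<otimes>\<^bsub>rees_ring R J\<^esub> laurent_monom R c 1 \<in> ?K (Suc m)"
      unfolding A.ideal_pow_Suc
      by (rule ideal_prod.prod[OF Suc.IH[OF prod(1)] rees_It_ideal(2)[OF J prod(2)]])
    moreover have "laurent_monom R b (int m) \<otimes>\<^bsub>rees_ring R J\<^esub> laurent_monom R c 1
        = laurent_monom R (b \<otimes> c) (int (Suc m))"
      using bc by (simp add: rees_simps monom_mult add.commute)
    ultimately show ?case by simp
  next
    case (sum b c)
    have "?K (Suc m) = ideal_prod (rees_ring R J) (?K m) (rees_It R J)" by (rule A.ideal_pow_Suc)
    then have "laurent_monom R b (int (Suc m)) \<oplus>\<^bsub>rees_ring R J\<^esub> laurent_monom R c (int (Suc m)) \<in> ?K (Suc m)"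
      using sum.IH by (auto intro: ideal_prod.sum)
    moreover have "laurent_monom R b (int (Suc m)) \<oplus>\<^bsub>rees_ring R J\<^esub> laurent_monom R c (int (Suc m))
        = laurent_monom R (b \<oplus> c) (int (Suc m))"
      by (auto simp: rees_simps laurent_monom_def)
    ultimately show ?case by simp
  qed
qed

lemma rees_u_pow:
  assumes J: "ideal J R"
  shows "rees_u R [^]\<^bsub>rees_ring R J\<^esub> (n::nat) = laurent_monom R \<one> (- int n)"
proof (induction n)
  case 0
  show ?case by (simp add: Group.nat_pow_0 rees_simps)
next
  case (Suc n)
  then show ?case
    by (simp add: Group.nat_pow_Suc rees_simps rees_u_def monom_mult algebra_simps)
qed

end

section \<open>The saturation in the Rees module\<close>

lemma ultimate_colon_eqI:
  fixes A :: "('e, 'f) ring_scheme" and B :: "('e, 'g, 'h) module_scheme"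
  assumes "\<And>m. m \<ge> c \<Longrightarrow> colon_mod B Y (ideal_pow A K m) = Z"
  shows "ultimate_colon A B Y K = Z"
  unfolding ultimate_colon_def
proof (rule the_equality)
  show ev: "\<forall>\<^sub>F m in sequentially. colon_mod B Y (ideal_pow A K m) = Z"
    unfolding eventually_sequentially using assms by blast
  fix Z' assume "\<forall>\<^sub>F m in sequentially. colon_mod B Y (ideal_pow A K m) = Z'"
  with ev have "\<forall>\<^sub>F m in sequentially. Z' = Z" by eventually_elim simp
  then show "Z' = Z" by simp
qed

context module
begin

abbreviation rmod :: "'a set \<Rightarrow> (int \<Rightarrow> 'a, int \<Rightarrow> 'c) module" where "rmod \<equiv> rees_module R M"

abbreviation act :: "(int \<Rightarrow> 'a) \<Rightarrow> (int \<Rightarrow> 'c) \<Rightarrow> int \<Rightarrow> 'c"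
  where "act \<equiv> module.smult (laurent_module R M)"

abbreviation msupp :: "(int \<Rightarrow> 'c) \<Rightarrow> int set" where "msupp x \<equiv> {n. x n \<noteq> \<zero>\<^bsub>M\<^esub>}"

lemma rmod_smult: "module.smult (rmod J) = act"
  by (simp add: rees_module_def)

lemma rmod_carrier_iff:
  "x \<in> carrier (rmod J) \<longleftrightarrow> (\<forall>n. x n \<in> carrier M) \<and> finite (msupp x) \<and> (\<forall>n. x n \<in> pw J (nat n))"
  by (auto simp: rees_module_def laurent_module_def ideal_smult_eq)

lemma act_def: "act f x n = (\<Oplus>\<^bsub>M\<^esub>i\<in>R.supp f. f i \<odot>\<^bsub>M\<^esub> x (n - i))"
  by (simp add: laurent_module_def)

lemma act_monom:
  assumes "a \<in> carrier R" "\<And>i. x i \<in> carrier M"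
  shows "act (laurent_monom R a d) x n = a \<odot>\<^bsub>M\<^esub> x (n - d)"
proof -
  have "act (laurent_monom R a d) x n = (\<Oplus>\<^bsub>M\<^esub>i\<in>{d}. laurent_monom R a d i \<odot>\<^bsub>M\<^esub> x (n - i))"
    unfolding act_def
    by (rule M.add.finprod_mono_neutral_cong_left) (use assms in \<open>auto simp: laurent_monom_def\<close>)
  then show ?thesis using assms by (simp add: laurent_monom_def M.finsum_insert)
qed

lemma sub_finsum:
  assumes N: "submodule N R M" and "\<And>i. i \<in> A \<Longrightarrow> h i \<in> N"
  shows "(\<Oplus>\<^bsub>M\<^esub>i\<in>A. h i) \<in> N"
  by (rule M.finsum_in[OF submoduleE(1)[OF N] sub_zero[OF N] sub_add[OF N] assms(2)])

lemma finite_msupp_act: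
  assumes f: "f \<in> R.laurent" and x: "finite (msupp x)"
  shows "finite (msupp (act f x))"
proof (rule finite_subset)
  show "finite ((\<lambda>(i, j). i + j) ` (R.supp f \<times> msupp x))" using R.laurentD(2)[OF f] x by simp
  show "msupp (act f x) \<subseteq> (\<lambda>(i, j). i + j) ` (R.supp f \<times> msupp x)"
  proof
    fix n assume n: "n \<in> msupp (act f x)"
    have "\<exists>i\<in>R.supp f. x (n - i) \<noteq> \<zero>\<^bsub>M\<^esub>"
    proof (rule ccontr)
      assume "\<not> ?thesis"
      then have "act f x n = \<zero>\<^bsub>M\<^esub>" unfolding act_def
        by (intro M.add.finprod_one_eqI) (use R.laurentD(1)[OF f] in auto)
      then show False using n by simp
    qed
    then obtain i where "i \<in> R.supp f" "n - i \<in> msupp x" by blast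
    then show "n \<in> (\<lambda>(i, j). i + j) ` (R.supp f \<times> msupp x)" by (intro image_eqI[of _ _ "(i, n - i)"]) auto
  qed
qed

definition u_multiples :: "'a set \<Rightarrow> nat \<Rightarrow> (int \<Rightarrow> 'c) set"
  where "u_multiples J n = {(rees_u R [^]\<^bsub>rees_ring R J\<^esub> n) \<odot>\<^bsub>rmod J\<^esub> x | x. x \<in> carrier (rmod J)}"

lemma u_multiples_iff:
  assumes J: "ideal J R"
  shows "y \<in> u_multiples J n \<longleftrightarrow> finite (msupp y) \<and> (\<forall>d. y d \<in> pw J (nat (d + int n)))"
proof -
  have shift: "finite {d. P (d + k)}" if "finite {d. P d}" for P and k :: int
  proof (rule finite_subset)
    show "{d. P (d + k)} \<subseteq> (\<lambda>d. d - k) ` {d. P d}" by (force simp: image_iff)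
  qed (use that in simp)
  have u: "((rees_u R [^]\<^bsub>rees_ring R J\<^esub> n) \<odot>\<^bsub>rmod J\<^esub> x) = (\<lambda>d. x (d + int n))" if "x \<in> carrier (rmod J)" for x
  proof
    fix d
    have x: "x i \<in> carrier M" for i using that by (simp add: rmod_carrier_iff)
    show "((rees_u R [^]\<^bsub>rees_ring R J\<^esub> n) \<odot>\<^bsub>rmod J\<^esub> x) d = x (d + int n)"
      unfolding R.rees_u_pow[OF J] rmod_smult using act_monom[of \<one> x "- int n" d] x by simp
  qed
  show ?thesis
  proof
    assume "y \<in> u_multiples J n"
    then obtain x where x: "x \<in> carrier (rmod J)" "y = (\<lambda>d. x (d + int n))"
      unfolding u_multiples_def using u by auto
    then show "finite (msupp y) \<and> (\<forall>d. y d \<in> pw J (nat (d + int n)))"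
      using shift[of "\<lambda>d. x d \<noteq> \<zero>\<^bsub>M\<^esub>" "int n"] by (simp add: rmod_carrier_iff)
  next
    assume y: "finite (msupp y) \<and> (\<forall>d. y d \<in> pw J (nat (d + int n)))"
    let ?x = "\<lambda>d. y (d - int n)"
    have "?x d \<in> pw J (nat d)" for d using y[THEN conjunct2, rule_format, of "d - int n"] by simp
    moreover have "finite (msupp ?x)" using shift[of "\<lambda>d. y d \<noteq> \<zero>\<^bsub>M\<^esub>" "- int n"] y by simp
    ultimately have x: "?x \<in> carrier (rmod J)" using sub_carr[OF pw_sub[OF J]] by (auto simp: rmod_carrier_iff)
    show "y \<in> u_multiples J n"
      unfolding u_multiples_def by (intro CollectI exI[of _ ?x] conjI x) (simp add: u[OF x])
  qed
qed

text \<open>With \<open>\<E>\<close> the Rees module, membership in \<open>(u\<^sup>n \<E> : (Jt)\<^sup>m)\<close> can be tested degree by degree. Monomials \<open>a t\<^sup>m\<close> give one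
  direction. For the other, write a coefficient of an element of \<open>(Jt)\<^sup>m\<close> in degree \<open>i\<close> as an element of
  \<open>J\<^sup>q\<^sup>+\<^sup>m\<close> with \<open>q = max m i - m\<close>.\<close>

lemma colon_u_multiples_iff:
  assumes J: "ideal J R"
  shows "x \<in> colon_mod (rmod J) (u_multiples J n) (ideal_pow (rees_ring R J) (rees_It R J) m) \<longleftrightarrow>
    x \<in> carrier (rmod J) \<and> (\<forall>d. \<forall>a\<in>ideal_pow R J m. a \<odot>\<^bsub>M\<^esub> x d \<in> pw J (nat (d + int m + int n)))"
    (is "?L \<longleftrightarrow> ?R")
proof
  assume L: ?L
  then have x: "x \<in> carrier (rmod J)" by (simp add: colon_mod_def)
  then have xM: "x i \<in> carrier M" for i by (simp add: rmod_carrier_iff)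
  have "a \<odot>\<^bsub>M\<^esub> x d \<in> pw J (nat (d + int m + int n))" if a: "a \<in> ideal_pow R J m" for a d
  proof -
    have aR: "a \<in> carrier R" using a R.ideal_pow_carr[OF J] by blast
    have "act (laurent_monom R a (int m)) x \<in> u_multiples J n"
      using L R.monom_in_rees_It_pow[OF J a] by (simp add: colon_mod_def rmod_smult)
    then have "act (laurent_monom R a (int m)) x (d + int m) \<in> pw J (nat (d + int m + int n))"
      unfolding u_multiples_iff[OF J] by blast
    then show ?thesis using act_monom[of a x "int m" "d + int m"] aR xM by simp
  qed
  then show ?R using x by blast
next
  assume R: ?R
  then have x: "x \<in> carrier (rmod J)" by blast
  have xM: "x i \<in> carrier M" for i using x by (simp add: rmod_carrier_iff)
  have "act f x \<in> u_multiples J n" if "f \<in> ideal_pow (rees_ring R J) (rees_It R J) m" for f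
  proof -
    have f: "f \<in> R.rees_trunc J m" using that R.rees_It_pow_subset[OF J] by blast
    then have fL: "f \<in> R.laurent" by (simp add: R.rees_trunc_def)
    have "act f x k \<in> pw J (nat (k + int n))" for k
      unfolding act_def
    proof (rule sub_finsum[OF pw_sub[OF J]])
      fix i
      let ?q = "max m (nat i) - m"
      have "f i \<in> ideal_pow R J (?q + m)" using f by (simp add: R.rees_trunc_def)
      then have "f i \<odot>\<^bsub>M\<^esub> x (k - i) \<in> pw J (?q + nat (k - i + int m + int n))"
        using R by (intro pow_smult_shift[OF J xM]) auto
      moreover have "nat (k + int n) \<le> ?q + nat (k - i + int m + int n)" by arith
      ultimately show "f i \<odot>\<^bsub>M\<^esub> x (k - i) \<in> pw J (nat (k + int n))" using pw_anti[OF J] by blast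
    qed
    then show ?thesis
      unfolding u_multiples_iff[OF J] using finite_msupp_act[OF fL] x by (simp add: rmod_carrier_iff)
  qed
  then show ?L using x by (simp add: colon_mod_def rmod_smult)
qed

lemma degree_zero_in_colon_iff:
  assumes J: "ideal J R" and e: "e \<in> carrier M"
  shows "degree_zero M e \<in> colon_mod (rmod J) (u_multiples J n) (ideal_pow (rees_ring R J) (rees_It R J) m)
    \<longleftrightarrow> e \<in> rr_stage J n m"
proof -
  have "msupp (degree_zero M e) \<subseteq> {0}" by (auto simp: degree_zero_def laurent_monom_def)
  then have fin: "finite (msupp (degree_zero M e))" by (rule finite_subset) simp
  have "degree_zero M e \<in> carrier (rmod J)"
    unfolding rmod_carrier_iff using fin e sub_zero[OF pw_sub[OF J]]
    by (auto simp: degree_zero_def laurent_monom_def pw_0)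
  moreover have "(\<forall>d. \<forall>a\<in>ideal_pow R J m. a \<odot>\<^bsub>M\<^esub> degree_zero M e d \<in> pw J (nat (d + int m + int n)))
    \<longleftrightarrow> e \<in> rr_stage J n m"
  proof -
    have "a \<odot>\<^bsub>M\<^esub> \<zero>\<^bsub>M\<^esub> \<in> pw J k" if "a \<in> ideal_pow R J m" for a k
      using sub_zero[OF pw_sub[OF J]] subsetD[OF R.ideal_pow_carr[OF J] that] by simp
    moreover have "nat (int m + int n) = m + n" by simp
    ultimately show ?thesis
      using e unfolding rr_stage_iff degree_zero_def laurent_monom_def by auto
  qed
  ultimately show ?thesis unfolding colon_u_multiples_iff[OF J] by blast
qed

end

context fg_module_noetherian_ring
begin

text \<open>In degrees \<open>d \<ge> 0\<close> the condition on the coefficient is the one of \<open>rr_stage J (n + d)\<close>; in degrees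
  \<open>-n \<le> d < 0\<close>, where the Rees module has component \<open>M\<close>, it is that of \<open>rr_stage J (n + d)\<close> on all of
  \<open>M\<close>; in degrees below \<open>-n\<close> it always holds. So finitely many applications of
  \<open>rr_stage_stabilises\<close> suffice.\<close>

lemma colon_u_multiples_stabilises:
  assumes J: "ideal J R"
  shows "\<exists>c. \<forall>m\<ge>c. colon_mod (rmod J) (u_multiples J n) (ideal_pow (rees_ring R J) (rees_It R J) m)
    = colon_mod (rmod J) (u_multiples J n) (ideal_pow (rees_ring R J) (rees_It R J) c)"
proof -
  let ?f = "\<lambda>k s. (\<lambda>d. pw J d \<inter> rr_stage J (k + d) s)"
  have "\<exists>c. \<forall>s\<ge>c. \<forall>k\<in>{..n}. ?f k s = ?f k c"
  proof (rule finite_family_stabilises)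
    fix k
    obtain c where c: "\<And>s d. s \<ge> c \<Longrightarrow> ?f k s d = ?f k c d" using rr_stage_stabilises[OF J, of k] by blast
    show "\<exists>c. \<forall>s\<ge>c. ?f k s = ?f k c" by (intro exI[of _ c] allI impI ext c)
  qed simp
  then obtain c where c: "\<forall>s\<ge>c. \<forall>k\<in>{..n}. ?f k s = ?f k c" ..
  have c: "?f k s d = ?f k c d" if "s \<ge> c" "k \<le> n" for k s d
    by (rule fun_cong[OF c[rule_format, OF that(1)]]) (use that(2) in simp)
  have same: "(\<forall>a\<in>ideal_pow R J m. a \<odot>\<^bsub>M\<^esub> y \<in> pw J (nat (d + int m + int n))) \<longleftrightarrow>
      (\<forall>a\<in>ideal_pow R J c. a \<odot>\<^bsub>M\<^esub> y \<in> pw J (nat (d + int c + int n)))"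
    if m: "m \<ge> c" and y: "y \<in> pw J (nat d)" for m y d
  proof -
    have yM: "y \<in> carrier M" by (rule sub_carr[OF pw_sub[OF J] y])
    consider "d \<ge> 0" | "d < 0" "d \<ge> - int n" | "d < - int n" by linarith
    then show ?thesis
    proof cases
      case 1
      then have "nat (d + int s + int n) = s + (n + nat d)" for s by simp
      then show ?thesis using c[OF m order_refl, of "nat d"] y yM by (auto simp: rr_stage_iff set_eq_iff)
    next
      case 2
      then have "nat (d + int s + int n) = s + nat (d + int n)" for s by simp
      moreover have "nat (d + int n) \<le> n" using 2 by simp
      ultimately show ?thesis using c[OF m, of "nat (d + int n)" 0] y yM by (auto simp: rr_stage_iff set_eq_iff pw_0)
    next
      case 3
      have "a \<odot>\<^bsub>M\<^esub> y \<in> pw J (nat (d + int s + int n))" if "a \<in> ideal_pow R J s" for a s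
      proof -
        have "nat (d + int s + int n) \<le> s" using 3 by simp
        then show ?thesis using mul_mem[OF that yM] pw_anti[OF J] by blast
      qed
      then show ?thesis by blast
    qed
  qed
  show ?thesis
  proof (intro exI[of _ c] allI impI)
    fix m assume m: "m \<ge> c"
    show "colon_mod (rmod J) (u_multiples J n) (ideal_pow (rees_ring R J) (rees_It R J) m)
      = colon_mod (rmod J) (u_multiples J n) (ideal_pow (rees_ring R J) (rees_It R J) c)"
    proof (rule Set.set_eqI)
      fix x :: "int \<Rightarrow> 'b"
      show "x \<in> colon_mod (rmod J) (u_multiples J n) (ideal_pow (rees_ring R J) (rees_It R J) m) \<longleftrightarrow>
        x \<in> colon_mod (rmod J) (u_multiples J n) (ideal_pow (rees_ring R J) (rees_It R J) c)"
        unfolding colon_u_multiples_iff[OF J] using same[OF m] by (simp add: rmod_carrier_iff) blast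
    qed
  qed
qed

theorem ultimate_colon_degree_zero:
  assumes J: "ideal J R" and n: "n \<ge> 1"
  shows "ultimate_colon (rees_ring R J) (rmod J) (u_multiples J n) (rees_It R J) \<inter> degree_zero M ` carrier M
    = degree_zero M ` ratliff_rush R M (ideal_pow R J n)"
proof -
  let ?C = "\<lambda>m. colon_mod (rmod J) (u_multiples J n) (ideal_pow (rees_ring R J) (rees_It R J) m)"
  obtain c where c: "\<And>m. m \<ge> c \<Longrightarrow> ?C m = ?C c" using colon_u_multiples_stabilises[OF J, of n] by blast
  have ult: "ultimate_colon (rees_ring R J) (rmod J) (u_multiples J n) (rees_It R J) = ?C c"
    by (rule ultimate_colon_eqI[OF c])
  have "degree_zero M e \<in> ?C c \<longleftrightarrow> e \<in> ratliff_rush R M (ideal_pow R J n)" if e: "e \<in> carrier M" for e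
  proof -
    have "e \<in> ratliff_rush R M (ideal_pow R J n) \<longleftrightarrow> (\<exists>s. e \<in> rr_stage J n s)"
      unfolding ratliff_rush_pow_eq[OF J n] by blast
    also have "\<dots> \<longleftrightarrow> (\<exists>s\<ge>c. e \<in> rr_stage J n s)"
      using incseqD[OF rr_stage_incseq[OF J]] by (meson nle_le subsetD)
    also have "\<dots> \<longleftrightarrow> (\<exists>s\<ge>c. degree_zero M e \<in> ?C s)"
      unfolding degree_zero_in_colon_iff[OF J e] ..
    also have "\<dots> \<longleftrightarrow> degree_zero M e \<in> ?C c" using c by blast
    finally show ?thesis ..
  qed
  then show ?thesis
    unfolding ult using sub_carr[OF submodule_ratliff_rush[OF J n]] by blast
qed

text \<open>The exponent at each prime comes from \<open>ratliff_rush_linear_bound\<close>; the maximum over the finitely many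
  primes of the associated graded module serves for all closures at once.\<close>

theorem linear_growth:
  assumes J: "ideal J R" and proper: "ideal_smult R M J \<noteq> carrier M" and grade: "grade R J M > 0"
  shows "\<exists>k\<ge>1. \<forall>n\<ge>1. \<exists>l Q.
    minimal_primary_decomposition R M (ratliff_rush R M (ideal_pow R J n)) l Q \<and>
    (\<forall>i\<in>{1..l}. ideal_pow R (rad R (colon_ring R M (Q i))) (k * n) \<subseteq> colon_ring R M (Q i))"
proof -
  let ?N = "\<lambda>n. ratliff_rush R M (ideal_pow R J n)"
  obtain t where t: "t \<in> J" "\<And>y. y \<in> carrier M \<Longrightarrow> t \<odot>\<^bsub>M\<^esub> y = \<zero>\<^bsub>M\<^esub> \<Longrightarrow> y = \<zero>\<^bsub>M\<^esub>"
    using regular_element_of_grade[OF grade] by blast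
  have fin: "finite (gr_primes J (pw J))" by (rule finite_gr_primes[OF J])
  have idl: "ideal P R" if "P \<in> gr_primes J (pw J)" for P
    using that primeideal.axioms(1) unfolding gr_primes_def by blast
  have "\<exists>k. \<forall>n\<ge>1. pw P (k * n) \<inter> colon_mod M (?N n) P \<subseteq> ?N n" if "P \<in> gr_primes J (pw J)" for P
    by (rule ratliff_rush_linear_bound[OF idl[OF that] J])
  then obtain k where k: "\<And>P n. P \<in> gr_primes J (pw J) \<Longrightarrow> n \<ge> 1 \<Longrightarrow>
      pw P (k P * n) \<inter> colon_mod M (?N n) P \<subseteq> ?N n"
    by metis
  define K where "K = Max (insert 1 (k ` gr_primes J (pw J)))"
  have "1 \<le> K" unfolding K_def using fin by simp
  moreover have "\<exists>l Q. minimal_primary_decomposition R M (?N n) l Q \<and>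
    (\<forall>i\<in>{1..l}. ideal_pow R (rad R (colon_ring R M (Q i))) (K * n) \<subseteq> colon_ring R M (Q i))" if n: "n \<ge> 1" for n
  proof (rule primary_decomposition_with_exponent)
    show "submodule (?N n) R M" by (rule submodule_ratliff_rush[OF J n])
    show "?N n \<noteq> carrier M" by (rule ratliff_rush_proper[OF J n proper t])
    show "finite (assoc_primes (?N n))" by (rule finite_subset[OF assoc_primes_ratliff_rush[OF J n] fin])
    fix P assume "P \<in> assoc_primes (?N n)"
    then have P: "P \<in> gr_primes J (pw J)" using assoc_primes_ratliff_rush[OF J n] by blast
    have "k P \<le> K" unfolding K_def using fin P by (intro Max_ge) auto
    then have "pw P (K * n) \<subseteq> pw P (k P * n)" by (intro pw_anti[OF idl[OF P]]) simp
    then show "pw P (K * n) \<inter> colon_mod M (?N n) P \<subseteq> ?N n" using k[OF P n] by blast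
  qed
  ultimately show ?thesis by blast
qed

end

theorem theorem3p2:
  fixes R :: "('a, 'r) ring_scheme" and E :: "('a, 'b, 'm) module_scheme" and I :: "'a set"
  assumes "cring R" and "noetherian_ring R" and "\<one>\<^bsub>R\<^esub> \<noteq> \<zero>\<^bsub>R\<^esub>"
    and "fin_gen_module R E" and "carrier E \<noteq> {\<zero>\<^bsub>E\<^esub>}"
    and "ideal I R"
    and "ideal_smult R E I \<noteq> carrier E"
    and "grade R I E > 0"
  defines "\<R> \<equiv> rees_ring R I" and "\<E> \<equiv> rees_module R E I"
  shows
    "(\<forall>n::nat. n \<ge> 1 \<longrightarrow>
        ultimate_colon \<R> \<E> {(rees_u R [^]\<^bsub>\<R>\<^esub> n) \<odot>\<^bsub>\<E>\<^esub> x | x. x \<in> carrier \<E>} (rees_It R I)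
          \<inter> degree_zero E ` carrier E
        = degree_zero E ` ratliff_rush R E (ideal_pow R I n))
     \<and>
     (\<exists>k::nat. k \<ge> 1 \<and>
        (\<forall>n::nat. n \<ge> 1 \<longrightarrow>
          (\<exists>l Q. minimal_primary_decomposition R E (ratliff_rush R E (ideal_pow R I n)) l Q \<and>
            (\<forall>i\<in>{1..l}.
               ideal_pow R (rad R (colon_ring R E (Q i))) (k * n) \<subseteq> colon_ring R E (Q i)))))"
proof -
  interpret E: fg_module_noetherian_ring R E
    using assms(2,4) by (intro fg_module_noetherian_ring.intro fg_module_noetherian_ring_axioms.intro)
      (simp_all add: fin_gen_module_def)
  show ?thesis
    unfolding \<R>_def \<E>_def
    using E.ultimate_colon_degree_zero[OF assms(6), unfolded E.u_multiples_def]
      E.linear_growth[OF assms(6,7,8)] by blast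
qed

end
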